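(* Let $\mathcal{T}$ be a fractal spray in $\mathbb{R}^d$ on a monophase generator $G$ with generating inradius $g=\rho(G)>0$, curvature coefficients $\kappa_0,\dots,\kappa_d$, scaling measure $\eta_s$ and scaling zeta function $\zeta_s$. Assume that $\zeta_s$ is languid on a screen $S$ (with window $W$) and that $S$ avoids the points of $\mathcal{D}_{\mathcal T}(W)$. Then, as distributions acting on test functions in $C_c^\infty(0,\infty)$, the $d$-dimensional volume of the inner tubular neighbourhood of the spray is given by $$V(\mathcal{T},\varepsilon)=\sum_{\omega\in\mathcal{D}_{\mathcal T}(W)}\operatorname{res}\bigl(\zeta_{\mathcal T}(\varepsilon,s);\,s=\omega\bigr)+\mathcal{R}(\varepsilon),$$ where $$\zeta_{\mathcal T}(\varepsilon,s)=\varepsilon^{d-s}\,\zeta_s(s)\sum_{k=0}^{d}\frac{g^{s-k}}{s-k}\,\kappa_k ,$$ the error term is the distribution $$\mathcal{R}(\varepsilon)=\frac{1}{2\pi i}\int_S\zeta_{\mathcal T}(\varepsilon,s)\,ds,$$ and it satisfies the estimate $\mathcal{R}(\varepsilon)=O(\varepsilon^{\,d-\sup S})$ as $\varepsilon\to0^+$, in the distributional sense.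
   Context: Inner tubes. For bounded $A\subset\mathbb{R}^d$ and $\varepsilon\ge 0$, $V(A,\varepsilon)$ is the $d$-dimensional Lebesgue measure of $\{x\in A:\operatorname{dist}(x,\partial A)\le\varepsilon\}$. The inradius is $\rho(A)=\sup\{\varepsilon>0:\exists x,\ B(x,\varepsilon)\subset A\}$. Fractal spray. A generator $G\subset\mathbb{R}^d$ is a nonempty bounded open set. A fractal spray $\mathcal{T}$ on $G$ is a bounded open subset of $\mathbb{R}^d$ that is the disjoint union of open sets $\Omega_n$, $n=1,2,\dots$, with $\Omega_n$ congruent to $\ell_nG$, where $(\ell_n)$ is a sequence of positive numbers (the scaling ratios). Its inner tube volume is $V(\mathcal{T},\varepsilon)=\sum_n V(\Omega_n,\varepsilon)$. Monophase generator. $G$ with inradius $g$ is monophase if there are real constants $\kappa_0,\dots,\kappa_{d-1}$ with $V(G,\varepsilon)=\sum_{k=0}^{d-1}\kappa_k\varepsilon^{d-k}$ for $0\le\varepsilon<g$. One also sets $\kappa_d:=-\operatorname{vol}_d(G)$. Scaling measure and zeta function. $\eta_s=\sum_n\delta_{1/\ell_n}$ (sum of Dirac masses) and $\zeta_s(s)=\int_0^\infty x^{-s}\,d\eta_s(x)=\sum_n\ell_n^{s}$; the same symbol denotes its meromorphic extension, which is assumed to exist on a neighbourhood of the window $W$ used. Screen and window. For a bounded Lipschitz function $f:\mathbb{R}\to\mathbb{R}$, the screen is $S=\{f(t)+it:t\in\mathbb{R}\}$ (oriented upward), $\sup S=\sup_tf(t)$, $\inf S=\inf_t f(t)$, and the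 window is $W=\{z\in\mathbb{C}:\operatorname{Re}z\ge f(\operatorname{Im}z)\}$. Languid. $\zeta_s$ (or $\eta_s$) is languid on $S$ if there are real constants $M,c>0$ and a sequence $(T_n)_{n\in\mathbb{Z}}$ in $\mathbb{R}$ with $T_{-n}<0<T_n$ for $n\ge1$, $T_n\to\infty$, $T_{-n}\to-\infty$, $T_n/|T_{-n}|\to1$ as $n\to\infty$, such that: (L1) for all $n\in\mathbb{Z}$ and all $\sigma\ge f(T_n)$, $|\zeta_s(\sigma+iT_n)|\le c(|T_n|+1)^M$; (L2) for all $t\in\mathbb{R}$ with $|t|\ge1$, $|\zeta_s(f(t)+it)|\le c|t|^M$. Complex dimensions. $\mathcal{D}_s$ is the set of poles of $\zeta_s$, $\mathcal{D}_{\mathcal T}:=\mathcal{D}_s\cup\{0,1,\dots,d-1\}$ and $\mathcal{D}_{\mathcal T}(W):=\mathcal{D}_{\mathcal T}\cap W$. A point lying in both $\mathcal{D}_s$ and $\{0,\dots,d-1\}$ contributes only one term to the sum. Distributional meaning. The identity means that for every $\psi\in C_c^\infty(0,\infty)$, $\int_0^\infty V(\mathcal{T},\varepsilon)\psi(\varepsilon)\,d\varepsilon=\sum_{\omega}\operatorname{res}(\langle\zeta_{\mathcal T}(\varepsilon,s),\psi(\varepsilon)\rangle;\omega)+\langle\mathcal{R},\psi\rangle$, where $\langle\zeta_{\mathcal T}(\varepsilon,s),\psi(\varepsilon)\rangle=\int_0^\infty\zeta_{\mathcal T}(\varepsilon,s)\psi(\varepsilon)\,d\varepsilon$ and $\langle\mathcal{R},\psi\rangle=\frac1{2\pi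 i}\int_S\langle\zeta_{\mathcal T}(\varepsilon,s),\psi(\varepsilon)\rangle\,ds$; the sum is the limit as $n\to\infty$ of the sums over those $\omega$ with $T_{-n}<\operatorname{Im}\omega<T_n$. For a distribution $\mathcal{R}$, $\mathcal{R}(\varepsilon)=O(\varepsilon^\alpha)$ as $\varepsilon\to0^+$ means that for every test function $\psi$, with $\psi_a(x):=\frac1a\psi(\frac xa)$, one has $\langle\mathcal{R},\psi_a\rangle=O(a^\alpha)$ as $a\to0^+$ (the implied constant may depend on $\psi$).
   Formalization: The formal theorem also assumes f(0) < d, i.e. the point s = d lies strictly right of the screen; otherwise the identity fails by vol(T) or the screen integral diverges (e.g. d=1, G=(0,1), ℓ_n=2^{-n}, f≡2), since the pole of ζ_T at s = d is not in D_T. *)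

theory Defs
  imports
    "HOL-Complex_Analysis.Complex_Analysis"
    "HOL-Library.Landau_Symbols"
begin

section \<open>Inner tubes, generators and fractal sprays\<close>

definition inner_tube_volume :: "'a::euclidean_space set \<Rightarrow> real \<Rightarrow> real" where
  "inner_tube_volume A \<epsilon> = measure lebesgue {x \<in> A. infdist x (frontier A) \<le> \<epsilon>}"

definition inradius :: "'a::euclidean_space set \<Rightarrow> real" where
  "inradius A = Sup {\<epsilon>. \<epsilon> > 0 \<and> (\<exists>x. ball x \<epsilon> \<subseteq> A)}"

definition congruent_sets :: "'a::euclidean_space set \<Rightarrow> 'a set \<Rightarrow> bool" where
  "congruent_sets A B \<longleftrightarrow> (\<exists>\<phi>. (\<forall>x y. dist (\<phi> x) (\<phi> y) = dist x y) \<and> B = \<phi> ` A)"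

definition generator :: "'a::euclidean_space set \<Rightarrow> bool" where
  "generator G \<longleftrightarrow> G \<noteq> {} \<and> bounded G \<and> open G"

text \<open>The pieces and scaling ratios are indexed from 0.\<close>

definition fractal_spray ::
  "'a::euclidean_space set \<Rightarrow> (nat \<Rightarrow> real) \<Rightarrow> (nat \<Rightarrow> 'a set) \<Rightarrow> 'a set \<Rightarrow> bool" where
  "fractal_spray G \<l> \<Omega> \<T> \<longleftrightarrow>
     generator G \<and> bounded \<T> \<and> open \<T> \<and>
     (\<forall>n. open (\<Omega> n)) \<and> disjoint_family \<Omega> \<and> \<T> = (\<Union>n. \<Omega> n) \<and>
     (\<forall>n. \<l> n > 0 \<and> congruent_sets ((*\<^sub>R) (\<l> n) ` G) (\<Omega> n))"

definition spray_tube_volume :: "(nat \<Rightarrow> 'a::euclidean_space set) \<Rightarrow> real \<Rightarrow> real" where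
  "spray_tube_volume \<Omega> \<epsilon> = (\<Sum>n. inner_tube_volume (\<Omega> n) \<epsilon>)"

text \<open>\<open>G\<close> is monophase, with curvature coefficients \<open>\<kappa> 0, \<dots>, \<kappa> d\<close>, where \<open>d\<close> is the
  dimension of the ambient space; the value \<open>\<kappa> d\<close> is a convention.\<close>

definition monophase_with :: "'a::euclidean_space set \<Rightarrow> (nat \<Rightarrow> real) \<Rightarrow> bool" where
  "monophase_with G \<kappa> \<longleftrightarrow>
     (\<forall>\<epsilon>. 0 \<le> \<epsilon> \<and> \<epsilon> < inradius G \<longrightarrow>
        inner_tube_volume G \<epsilon> = (\<Sum>k<DIM('a). \<kappa> k * \<epsilon> ^ (DIM('a) - k))) \<and>
     \<kappa> DIM('a) = - measure lebesgue G"

section \<open>Scaling zeta function, screens and languidity\<close>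

text \<open>The integral of \<open>x powr -s\<close> against the scaling measure (the sum of the Dirac masses at
  the \<open>1 / \<l> n\<close>), where it converges absolutely.\<close>

definition scaling_series :: "(nat \<Rightarrow> real) \<Rightarrow> complex \<Rightarrow> complex" where
  "scaling_series \<l> s = (\<Sum>n. complex_of_real (\<l> n) powr s)"

text \<open>\<open>\<zeta>\<close> is the meromorphic extension of the series to the open set \<open>U\<close>. Nice meromorphy only
  normalises values: no removable singularities, and the value 0 at each pole.\<close>

definition scaling_zeta_on :: "(nat \<Rightarrow> real) \<Rightarrow> complex set \<Rightarrow> (complex \<Rightarrow> complex) \<Rightarrow> bool" where
  "scaling_zeta_on \<l> U \<zeta> \<longleftrightarrow>
     open U \<and> \<zeta> nicely_meromorphic_on U \<and>
     (\<forall>s\<in>U. summable (\<lambda>n. \<l> n powr Re s) \<longrightarrow> \<zeta> s = scaling_series \<l> s)"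

definition screen_function :: "(real \<Rightarrow> real) \<Rightarrow> bool" where
  "screen_function f \<longleftrightarrow> bounded (range f) \<and> (\<exists>C. C-lipschitz_on UNIV f)"

definition screen_path :: "(real \<Rightarrow> real) \<Rightarrow> real \<Rightarrow> complex" where
  "screen_path f t = Complex (f t) t"

definition screen :: "(real \<Rightarrow> real) \<Rightarrow> complex set" where
  "screen f = range (screen_path f)"

definition window :: "(real \<Rightarrow> real) \<Rightarrow> complex set" where
  "window f = {z. Re z \<ge> f (Im z)}"

text \<open>Languidity along a given sequence of heights \<open>T\<close>; the sequence is exposed because the sum
  over the complex dimensions is taken along it.\<close>

definition languid_along ::
  "(complex \<Rightarrow> complex) \<Rightarrow> (real \<Rightarrow> real) \<Rightarrow> (int \<Rightarrow> real) \<Rightarrow> bool" where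
  "languid_along \<zeta> f T \<longleftrightarrow>
     (\<forall>n\<ge>1. T (- n) < 0 \<and> 0 < T n) \<and>
     filterlim (\<lambda>n. T (int n)) at_top sequentially \<and>
     filterlim (\<lambda>n. T (- int n)) at_bot sequentially \<and>
     (\<lambda>n. T (int n) / \<bar>T (- int n)\<bar>) \<longlonglongrightarrow> 1 \<and>
     (\<exists>M>0. \<exists>c>0.
        (\<forall>n. \<forall>\<sigma>\<ge>f (T n). norm (\<zeta> (Complex \<sigma> (T n))) \<le> c * (\<bar>T n\<bar> + 1) powr M) \<and>
        (\<forall>t. \<bar>t\<bar> \<ge> 1 \<longrightarrow> norm (\<zeta> (screen_path f t)) \<le> c * \<bar>t\<bar> powr M))"

definition complex_dimensions ::
  "nat \<Rightarrow> (complex \<Rightarrow> complex) \<Rightarrow> complex set \<Rightarrow> complex set" where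
  "complex_dimensions d \<zeta> W = ({\<omega>. is_pole \<zeta> \<omega>} \<union> of_nat ` {..<d}) \<inter> W"

definition tubular_zeta ::
  "nat \<Rightarrow> real \<Rightarrow> (nat \<Rightarrow> real) \<Rightarrow> (complex \<Rightarrow> complex) \<Rightarrow> real \<Rightarrow> complex \<Rightarrow> complex" where
  "tubular_zeta d g \<kappa> \<zeta> \<epsilon> s =
     complex_of_real \<epsilon> powr (of_nat d - s) * \<zeta> s *
     (\<Sum>k\<le>d. complex_of_real g powr (s - of_nat k) / (s - of_nat k) * complex_of_real (\<kappa> k))"

section \<open>Test functions and distributional pairings\<close>

text \<open>Elements of \<open>C\<^sub>c\<^sup>\<infinity>(0,\<infinity>)\<close>, complex-valued and extended by 0 to the real line.\<close>

definition test_function :: "(real \<Rightarrow> complex) \<Rightarrow> bool" where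
  "test_function \<psi> \<longleftrightarrow>
     (\<exists>D. D 0 = \<psi> \<and> (\<forall>n x. (D n has_vector_derivative D (Suc n) x) (at x))) \<and>
     compact (closure {x. \<psi> x \<noteq> 0}) \<and> closure {x. \<psi> x \<noteq> 0} \<subseteq> {0<..}"

definition rescale :: "real \<Rightarrow> (real \<Rightarrow> complex) \<Rightarrow> real \<Rightarrow> complex" where
  "rescale a \<psi> x = complex_of_real (1 / a) * \<psi> (x / a)"

definition pairing :: "(real \<Rightarrow> complex) \<Rightarrow> (real \<Rightarrow> complex) \<Rightarrow> complex" where
  "pairing h \<psi> = integral {0<..} (\<lambda>\<epsilon>. h \<epsilon> * \<psi> \<epsilon>)"

text \<open>As for the contour integral of the library, the integral along the screen is taken through
  the derivative of the parametrisation. A screen function is only Lipschitz, so this derivative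
  exists almost everywhere; its junk values elsewhere do not affect the integral.\<close>

definition screen_integrand :: "(real \<Rightarrow> real) \<Rightarrow> (complex \<Rightarrow> complex) \<Rightarrow> real \<Rightarrow> complex" where
  "screen_integrand f F t = F (screen_path f t) * vector_derivative (screen_path f) (at t)"

definition screen_integrable :: "(real \<Rightarrow> real) \<Rightarrow> (complex \<Rightarrow> complex) \<Rightarrow> bool" where
  "screen_integrable f F \<longleftrightarrow> screen_integrand f F absolutely_integrable_on UNIV"

definition screen_integral :: "(real \<Rightarrow> real) \<Rightarrow> (complex \<Rightarrow> complex) \<Rightarrow> complex" where
  "screen_integral f F = integral UNIV (screen_integrand f F)"

definition paired_tubular_zeta ::
  "nat \<Rightarrow> real \<Rightarrow> (nat \<Rightarrow> real) \<Rightarrow> (complex \<Rightarrow> complex) \<Rightarrow> (real \<Rightarrow> complex) \<Rightarrow> complex \<Rightarrow> complex" where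
  "paired_tubular_zeta d g \<kappa> \<zeta> \<psi> s = pairing (\<lambda>\<epsilon>. tubular_zeta d g \<kappa> \<zeta> \<epsilon> s) \<psi>"

definition error_term ::
  "nat \<Rightarrow> real \<Rightarrow> (nat \<Rightarrow> real) \<Rightarrow> (complex \<Rightarrow> complex) \<Rightarrow> (real \<Rightarrow> real) \<Rightarrow> (real \<Rightarrow> complex) \<Rightarrow> complex" where
  "error_term d g \<kappa> \<zeta> f \<psi> =
     1 / (2 * of_real pi * \<i>) * screen_integral f (paired_tubular_zeta d g \<kappa> \<zeta> \<psi>)"

text \<open>\<open>L\<close> is the sum of \<open>r\<close> over \<open>A\<close>, taken along the heights \<open>T\<close>. Finiteness of the truncations
  is required since \<^const>\<open>sum\<close> is 0 over infinite sets.\<close>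

definition has_truncated_sum ::
  "(complex \<Rightarrow> complex) \<Rightarrow> complex set \<Rightarrow> (int \<Rightarrow> real) \<Rightarrow> complex \<Rightarrow> bool" where
  "has_truncated_sum r A T L \<longleftrightarrow>
     (\<forall>n::nat. finite {\<omega> \<in> A. T (- int n) < Im \<omega> \<and> Im \<omega> < T (int n)}) \<and>
     (\<lambda>n. \<Sum>\<omega> \<in> {\<omega> \<in> A. T (- int n) < Im \<omega> \<and> Im \<omega> < T (int n)}. r \<omega>) \<longlonglongrightarrow> L"

end

(* A piece with scaling ratio l has inner tube volume l^d v(x/l), where v is the inner tube volume of G.  The Mellin
   transform of v in the strip d-1 < Re s < d is the factor sum_k g^(s-k) kappa_k / (s-k), so that of the spray is this
   factor times zeta_s(s) wherever the series converges.  It does converge on some line Re s = c < d: the sum of the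
   l_n^d is finite because the spray is bounded, and the screen passes to the left of d, so zeta_s is regular at d and
   Landau's theorem moves the abscissa of convergence to the left of d.  By Parseval, the pairing of the tube volume
   with a test function is an integral over this line, which is then shifted to the screen; the Mellin transform of the
   test function decays faster than any power, which beats the languid growth of zeta_s.

   The screen is only Lipschitz and may cross the line.  The residue identity is therefore proved for thin horizontal
   slabs, where a local primitive handles the screen and a rectangle the poles, and slabs are glued by bisection. *)
theory Submission
  imports Defs "HOL-Probability.Sinc_Integral"
begin

text \<open>The strip d-1 < Re s < d is forced: v is O(x) at 0 and constant beyond the inradius.
  Boundedness of the spray gives convergence of the series only on the right edge of this strip,
  where the factor has its pole at s = d; Landau's theorem closes that gap. Since the line stays
  left of d, the pole at d is never crossed, which is why the complex dimensions contain the
  integers only up to d-1.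

  Where the screen runs to the right of the line, the region between them is traversed with the
  opposite orientation. It contributes no residue, because all complex dimensions lie strictly left
  of the line. It is outside the window, so the extension of zeta_s may be undefined there, and the
  kernel falls back on the convergent series.

  The velocity of the screen exists only almost everywhere. Over a short arc the screen integral is
  therefore evaluated as the increment of a holomorphic primitive along a Lipschitz path. This rests
  on two facts about Lipschitz functions on the line: differentiability almost everywhere, and the
  fundamental theorem of calculus.\<close>

section \<open>Lipschitz functions on the line\<close>

text \<open>The difference quotients of a Lipschitz function are bounded by its constant, so
  dominated convergence applies to them. The integral of a quotient telescopes to the difference of
  two short averages, one at each endpoint.\<close>

lemma lipschitz_has_integral_derivative:
  fixes q :: "real \<Rightarrow> 'b::euclidean_space"
  assumes lip: "C-lipschitz_on {a..b} q" and "a \<le> b" and N: "negligible N"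
    and deriv: "\<And>t. t \<in> {a<..<b} - N \<Longrightarrow> (q has_vector_derivative q' t) (at t)"
  shows "(q' has_integral (q b - q a)) {a..b}"
proof -
  \<comment> \<open>\<open>Q\<close> extends \<open>q\<close> by constants beyond the interval, so
    that \<open>Q (t + h n)\<close> makes sense up to the right end and the average over
    \<open>{b..b + h n}\<close> is exactly \<open>q b\<close>.\<close>
  define Q where "Q = (\<lambda>t. q (max a (min b t)))"
  define h where "h = (\<lambda>n::nat. 1 / real (Suc n))"
  define D where "D = (\<lambda>n t. (Q (t + h n) - Q t) /\<^sub>R h n)"
  define Z where "Z = N \<union> {a, b}"
  have hpos: "h n > 0" for n by (simp add: h_def)
  have h0: "h \<longlonglongrightarrow> 0"
    unfolding h_def using LIMSEQ_inverse_real_of_nat by (simp add: inverse_eq_divide)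
  have C: "C \<ge> 0" using lip by (rule lipschitz_on_nonneg)
  have Qlip: "norm (Q s - Q t) \<le> C * \<bar>s - t\<bar>" for s t
  proof -
    have "norm (Q s - Q t) \<le> C * \<bar>max a (min b s) - max a (min b t)\<bar>"
      using lipschitz_onD[OF lip, of "max a (min b s)" "max a (min b t)"] \<open>a \<le> b\<close>
      by (simp add: Q_def dist_norm)
    also have "\<dots> \<le> C * \<bar>s - t\<bar>"
      by (intro mult_left_mono C) linarith
    finally show ?thesis .
  qed
  have Qcont: "continuous_on S Q" for S
    by (rule lipschitz_on_continuous_on[of C])
       (use Qlip C in \<open>auto simp: lipschitz_on_def dist_norm\<close>)
  have Qint: "Q integrable_on {u..v}" for u v
    by (intro integrable_continuous_real Qcont)
  have Dint: "(D n has_integral (q b - integral {a..a + h n} Q /\<^sub>R h n)) {a..b}" for n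
  proof -
    have *: "((\<lambda>t. Q (t + h n)) has_integral integral {a + h n..b + h n} Q) {a..b}"
      using has_integral_affinity[OF integrable_integral[OF Qint[of "a + h n" "b + h n"], unfolded interval_cbox],
          of 1 "h n"] by (simp add: image_affinity_cbox algebra_simps image_diff_atLeastAtMost)
    have "(D n has_integral ((integral {a + h n..b + h n} Q - integral {a..b} Q) /\<^sub>R h n)) {a..b}"
      unfolding D_def by (intro has_integral_cmul has_integral_diff * integrable_integral Qint)
    moreover have "integral {a + h n..b + h n} Q - integral {a..b} Q
        = integral {b..b + h n} Q - integral {a..a + h n} Q"
    proof -
      have 1: "integral {a..b} Q + integral {b..b + h n} Q = integral {a..b + h n} Q"
        using \<open>a \<le> b\<close> hpos[of n] by (intro Henstock_Kurzweil_Integration.integral_combine Qint) auto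
      have 2: "integral {a..a + h n} Q + integral {a + h n..b + h n} Q = integral {a..b + h n} Q"
        using \<open>a \<le> b\<close> hpos[of n] by (intro Henstock_Kurzweil_Integration.integral_combine Qint) auto
      show ?thesis using 1 2 by (simp add: algebra_simps)
    qed
    moreover have "integral {b..b + h n} Q = h n *\<^sub>R q b"
    proof -
      have "integral {b..b + h n} Q = integral {b..b + h n} (\<lambda>_. q b)"
        by (rule Henstock_Kurzweil_Integration.integral_cong) (use \<open>a \<le> b\<close> in \<open>auto simp: Q_def max_def min_def\<close>)
      also have "\<dots> = h n *\<^sub>R q b"
        using hpos[of n] by simp
      finally show ?thesis .
    qed
    ultimately show ?thesis using hpos[of n] by (simp add: algebra_simps)
  qed
  have avg: "(\<lambda>n. integral {a..a + h n} Q /\<^sub>R h n) \<longlonglongrightarrow> q a"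
  proof (rule Lim_null[THEN iffD2], rule Lim_null_comparison)
    show "\<forall>\<^sub>F n in sequentially. norm (integral {a..a + h n} Q /\<^sub>R h n - q a) \<le> C * h n"
    proof (rule always_eventually, rule allI)
      fix n
      have "((\<lambda>t. Q t - Q a) has_integral (integral {a..a + h n} Q - h n *\<^sub>R Q a)) {a..a + h n}"
        using hpos[of n] has_integral_const_real[of "Q a" a "a + h n"]
        by (intro has_integral_diff integrable_integral Qint) auto
      then have "norm (integral {a..a + h n} Q - h n *\<^sub>R Q a) \<le> C * h n * Henstock_Kurzweil_Integration.content {a..a + h n}"
      proof (rule has_integral_bound_real[of _ "{}", rotated 2])
        show "0 \<le> C * h n" using C hpos[of n] by simp
        show "norm (Q x - Q a) \<le> C * h n" if "x \<in> {a..a + h n} - {}" for x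
        proof -
          have "C * \<bar>x - a\<bar> \<le> C * h n" using that C by (intro mult_left_mono) auto
          then show ?thesis using Qlip[of x a] by linarith
        qed
      qed simp
      also have "\<dots> = C * h n * h n" using hpos[of n] by simp
      finally have "norm (integral {a..a + h n} Q - h n *\<^sub>R Q a) / h n \<le> C * h n"
        using hpos[of n] by (simp add: field_simps)
      moreover have "integral {a..a + h n} Q /\<^sub>R h n - q a = (integral {a..a + h n} Q - h n *\<^sub>R Q a) /\<^sub>R h n"
        using hpos[of n] \<open>a \<le> b\<close> by (simp add: algebra_simps Q_def)
      ultimately show "norm (integral {a..a + h n} Q /\<^sub>R h n - q a) \<le> C * h n"
        using hpos[of n] by (simp add: divide_inverse mult.commute)
    qed
    show "(\<lambda>n. C * h n) \<longlonglongrightarrow> 0" using tendsto_mult_left[OF h0, of C] by simp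
  qed
  have negZ: "negligible Z" using N by (simp add: Z_def)
  \<comment> \<open>Dominated convergence is applied with convergence at every point, so the
    quotients and their limit are both set to 0 on the null set \<open>Z\<close>, which includes the
    endpoints.\<close>
  define D' where "D' = (\<lambda>n t. if t \<in> Z then 0 else D n t)"
  define g where "g = (\<lambda>t. if t \<in> Z then 0 else q' t)"
  have D'int: "(D' n has_integral (q b - integral {a..a + h n} Q /\<^sub>R h n)) {a..b}" for n
    by (rule has_integral_spike[OF negZ _ Dint]) (auto simp: D'_def)
  have bd: "norm (D' n t) \<le> C" for n t
  proof -
    have "norm (D n t) \<le> C"
    proof -
      have "norm (D n t) = norm (Q (t + h n) - Q t) / h n"
        using hpos[of n] by (simp add: D_def divide_inverse mult.commute)
      then show ?thesis
        using Qlip[of "t + h n" t] hpos[of n] by (simp add: pos_divide_le_eq)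
    qed
    then show ?thesis using C by (simp add: D'_def)
  qed
  have conv: "(\<lambda>n. D' n t) \<longlonglongrightarrow> g t" if t: "t \<in> {a..b}" for t
  proof (cases "t \<in> Z")
    case False
    then have t': "t \<in> {a<..<b} - N" using t by (auto simp: Z_def)
    have "((\<lambda>y. (q (t + y) - q t) /\<^sub>R y) \<longlongrightarrow> q' t) (at 0)"
    proof -
      have "((\<lambda>y. norm (q (t + y) - q t - y *\<^sub>R q' t) / norm y) \<longlongrightarrow> 0) (at 0)"
        using deriv[OF t'] by (simp add: has_vector_derivative_def has_derivative_at)
      also have "?this \<longleftrightarrow> ((\<lambda>y. norm ((q (t + y) - q t) /\<^sub>R y - q' t)) \<longlongrightarrow> 0) (at 0)"
      proof (rule LIM_cong)
        fix y :: real assume "y \<noteq> 0"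
        have "norm (q (t + y) - q t - y *\<^sub>R q' t) / norm y = norm ((q (t + y) - q t) /\<^sub>R y - q' t)"
        proof -
          have *: "(q (t + y) - q t) /\<^sub>R y - q' t = (q (t + y) - q t - y *\<^sub>R q' t) /\<^sub>R y"
            using \<open>y \<noteq> 0\<close> by (simp add: scaleR_diff_right)
          show ?thesis unfolding * norm_scaleR by (simp add: divide_inverse mult.commute)
        qed
        then show "norm (q (t + y) - q t - y *\<^sub>R q' t) / norm y = norm ((q (t + y) - q t) /\<^sub>R y - q' t)" .
      qed simp_all
      finally have "((\<lambda>y. norm ((q (t + y) - q t) /\<^sub>R y - q' t)) \<longlongrightarrow> 0) (at 0)" .
      then have "((\<lambda>y. (q (t + y) - q t) /\<^sub>R y - q' t) \<longlongrightarrow> 0) (at 0)"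
        by (rule tendsto_norm_zero_cancel)
      then show ?thesis by (subst Lim_null)
    qed
    then have "((\<lambda>n. (q (t + h n) - q t) /\<^sub>R h n) \<longlongrightarrow> q' t) sequentially"
      by (rule filterlim_compose[of _ _ _ h]) (auto simp: filterlim_at h0 less_imp_neq[OF hpos] hpos less_imp_neq[OF hpos, symmetric])
    moreover have "eventually (\<lambda>n. (q (t + h n) - q t) /\<^sub>R h n = D' n t) sequentially"
    proof -
      have "eventually (\<lambda>n. h n < b - t) sequentially"
        using order_tendstoD(2)[OF h0, of "b - t"] t' by simp
      then show ?thesis
      proof eventually_elim
        case (elim n)
        have "max a (min b (t + h n)) = t + h n" "max a (min b t) = t"
          using elim t' hpos[of n] by auto
        then show ?case using False by (simp add: D'_def D_def Q_def)
      qed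
    qed
    ultimately show ?thesis
      using False by (auto simp: g_def intro: Lim_transform_eventually)
  qed (simp add: D'_def g_def)
  have dc: "g integrable_on {a..b}" "(\<lambda>n. integral {a..b} (D' n)) \<longlonglongrightarrow> integral {a..b} g"
    using dominated_convergence[of D' "{a..b}" "\<lambda>_. C" g] D'int bd conv by auto
  have "(\<lambda>n. integral {a..b} (D' n)) \<longlonglongrightarrow> q b - q a"
    using integral_unique[OF D'int] avg by (auto intro!: tendsto_intros)
  then have "integral {a..b} g = q b - q a" using dc(2) LIMSEQ_unique by blast
  then have "(g has_integral (q b - q a)) {a..b}" using dc(1) by (metis integrable_integral)
  then show ?thesis
    by (rule has_integral_spike[OF negZ, rotated]) (auto simp: g_def)
qed

text \<open>Adding a steep linear function turns \<open>f\<close> into an increasing homeomorphism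
  \<open>h\<close>. The length of the image of a set under \<open>h\<close> is an absolutely
  continuous measure, so \<open>h\<close> is an indefinite integral of its Radon-Nikodym density,
  and Lebesgue differentiation supplies the derivative.\<close>

lemma lipschitz_differentiable_ae:
  fixes f :: "real \<Rightarrow> real"
  assumes lip: "C-lipschitz_on UNIV f"
  obtains N where "negligible N" "\<And>x. x \<notin> N \<Longrightarrow> f differentiable (at x)"
proof -
  have C: "C \<ge> 0" using lip by (rule lipschitz_on_nonneg)
  have flip: "\<bar>f x - f y\<bar> \<le> C * \<bar>x - y\<bar>" for x y
    using lipschitz_onD[OF lip, of x y] by (simp add: dist_real_def)
  \<comment> \<open>\<open>f\<close> decreases at rate at most \<open>C\<close>, so the slope
    \<open>C + 1\<close> leaves increments of \<open>h\<close> of at least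
    \<open>y - x\<close>.\<close>
  define h where "h = (\<lambda>x. f x + (C + 1) * x)"
  have hlow: "h y - h x \<ge> y - x" if "x \<le> y" for x y
    using flip[of x y] that by (simp add: h_def algebra_simps)
  have hup: "\<bar>h y - h x\<bar> \<le> (2 * C + 1) * \<bar>y - x\<bar>" for x y
  proof -
    have "h y - h x = (f y - f x) + (C + 1) * (y - x)" by (simp add: h_def algebra_simps)
    then have "\<bar>h y - h x\<bar> \<le> \<bar>f y - f x\<bar> + (C + 1) * \<bar>y - x\<bar>"
      using C by (simp add: abs_triangle_ineq[THEN order_trans] abs_mult)
    then show ?thesis using flip[of y x] by (simp add: algebra_simps)
  qed
  have hcont: "continuous_on S h" for S
    unfolding h_def by (intro continuous_intros lipschitz_on_continuous_on[OF lipschitz_on_subset[OF lip]]) auto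
  have sm: "strict_mono h"
    by (rule strict_monoI) (use hlow in \<open>smt (verit)\<close>)
  have inj: "inj h" using sm by (rule strict_mono_imp_inj_on)
  have surj: "\<exists>x. h x = y" for y
  proof -
    define B where "B = \<bar>y - h 0\<bar>"
    have "\<exists>x\<ge>-B. x \<le> B \<and> h x = y"
      by (rule IVT') (use hlow[of "-B" 0] hlow[of 0 B] hcont in \<open>auto simp: B_def\<close>)
    then show ?thesis by blast
  qed
  then have bij: "bij h" using inj by (metis bijI surjI surj_def)
  define k where "k = inv h"
  have hk: "h (k y) = y" and kh: "k (h x) = x" for x y
    using bij by (auto simp: k_def bij_is_surj surj_f_inv_f bij_is_inj)
  have kmono: "mono k"
    by (rule monoI) (metis hk linorder_not_le sm strict_mono_less)
  have kmeas[measurable]: "k \<in> borel_measurable borel"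
    using kmono by (rule borel_measurable_mono)
  define \<mu> where "\<mu> = distr lborel borel k"
  have \<mu>: "emeasure \<mu> A = emeasure lborel (h ` A)" "h ` A \<in> sets borel" if "A \<in> sets borel" for A
  proof -
    have *: "k -` A = h ` A" by (auto simp: kh) (metis hk image_eqI)
    show "emeasure \<mu> A = emeasure lborel (h ` A)" unfolding \<mu>_def using that * by (simp add: emeasure_distr)
    show "h ` A \<in> sets borel" using measurable_sets[OF kmeas that] * by simp
  qed
  have "absolutely_continuous lborel \<mu>"
    unfolding absolutely_continuous_def
  proof
    fix A assume A: "A \<in> null_sets (lborel :: real measure)"
    then have Ab: "A \<in> sets borel" and "negligible A"
      by (auto simp: negligible_iff_null_sets null_sets_completionI)
    have "negligible (h ` A)"
      by (rule negligible_locally_Lipschitz_image)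
         (use \<open>negligible A\<close> hup in \<open>auto intro!: exI[of _ UNIV] exI[of _ "2 * C + 1"]\<close>)
    then have "emeasure lborel (h ` A) = 0"
      using \<mu>(2)[OF Ab] by (auto simp: negligible_iff_emeasure0)
    then show "A \<in> null_sets \<mu>" using \<mu>(1)[OF Ab] Ab by (auto simp: null_sets_def \<mu>_def)
  qed
  then obtain r where r[measurable]: "r \<in> borel_measurable lborel" and dens: "density lborel r = \<mu>"
    using sigma_finite_measure.Radon_Nikodym[OF sigma_finite_lborel, of \<mu>] by (auto simp: \<mu>_def)
  have rint: "(\<integral>\<^sup>+x. r x * indicator {a..b} x \<partial>lborel) = ennreal (h b - h a)" if "a \<le> b" for a b
  proof -
    have "h ` {a..b} = {h a..h b}"
    proof -
      have "y \<in> h ` {a..b}" if "h a \<le> y" "y \<le> h b" for y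
        using IVT'[of h a y b] that \<open>a \<le> b\<close> hcont by auto
      then show ?thesis using sm by (auto simp: strict_mono_less_eq)
    qed
    then have "emeasure \<mu> {a..b} = ennreal (h b - h a)"
      using \<mu>(1)[of "{a..b}"] that sm by (auto simp: strict_mono_less_eq)
    then show ?thesis by (simp add: dens[symmetric] emeasure_density)
  qed
  have fin: "AE x in lborel. r x \<noteq> \<infinity>"
  proof -
    have "AE x in lborel. r x * indicator {- real n..real n} x \<noteq> \<infinity>" for n
      by (rule nn_integral_PInf_AE) (auto simp: rint)
    then have "AE x in lborel. \<forall>n. r x * indicator {- real n..real n} x \<noteq> \<infinity>"
      by (simp add: AE_all_countable)
    then show ?thesis
    proof eventually_elim
      case (elim x)
      obtain n where "\<bar>x\<bar> \<le> real n" using real_arch_simple by blast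
      then have "indicator {- real n..real n} x = (1::ennreal)" by (auto simp: abs_le_iff)
      then show ?case using elim[rule_format, of n] by simp
    qed
  qed
  define K where "K = (\<lambda>x. enn2real (r x))"
  have Kint: "(K has_integral (h b - h a)) {a..b}" if "a \<le> b" for a b
  proof -
    have "(\<integral>\<^sup>+x. ennreal (K x * indicator {a..b} x) \<partial>lborel) = (\<integral>\<^sup>+x. r x * indicator {a..b} x \<partial>lborel)"
      by (rule nn_integral_cong_AE, use fin in eventually_elim)
         (auto simp: K_def indicator_def ennreal_enn2real_if)
    with rint[OF that] have *: "(\<integral>\<^sup>+x. ennreal (K x * indicator {a..b} x) \<partial>lborel) = ennreal (h b - h a)"
      by simp
    have "((\<lambda>x. K x * indicator {a..b} x) has_integral (h b - h a)) UNIV"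
      by (rule nn_integral_has_integral[OF _ _ *]) (use hlow[OF that] that in \<open>simp_all add: K_def\<close>)
    also have "(\<lambda>x. K x * indicator {a..b} x) = (\<lambda>x. if x \<in> {a..b} then K x else 0)" by auto
    finally show ?thesis by (simp only: has_integral_restrict_UNIV)
  qed
  \<comment> \<open>The differentiation theorem used below averages over intervals that start at the
    point, which yields only the right derivative; the reflected density yields the left
    one.\<close>
  have Kint2: "((\<lambda>x. K (- x)) has_integral (h (-a) - h (-b))) {a..b}" if "a \<le> b" for a b
    using has_integral_affinity[OF Kint[of "-b" "-a", unfolded interval_cbox], of "-1" 0] that
    by (simp add: image_affinity_cbox)
  have "K integrable_on cbox a b" for a b
    using Kint[of a b] by (cases "a \<le> b") (auto)
  then obtain N1 where N1: "negligible N1" 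
    "\<And>x e. \<lbrakk>x \<notin> N1; 0 < e\<rbrakk> \<Longrightarrow> \<exists>d>0. \<forall>h. 0 < h \<and> h < d \<longrightarrow>
        norm (integral (cbox x (x + h *\<^sub>R One)) K /\<^sub>R h ^ DIM(real) - K x) < e"
    using integrable_ccontinuous_explicit[of K] by metis
  have "(\<lambda>x. K (- x)) integrable_on cbox a b" for a b
    using Kint2[of a b] by (cases "a \<le> b") (auto)
  then obtain N2 where N2: "negligible N2" 
    "\<And>x e. \<lbrakk>x \<notin> N2; 0 < e\<rbrakk> \<Longrightarrow> \<exists>d>0. \<forall>h. 0 < h \<and> h < d \<longrightarrow>
        norm (integral (cbox x (x + h *\<^sub>R One)) (\<lambda>x. K (- x)) /\<^sub>R h ^ DIM(real) - K (- x)) < e"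
    using integrable_ccontinuous_explicit[of "\<lambda>x. K (- x)"] by metis
  have neg2: "negligible (uminus ` N2)"
    by (rule negligible_locally_Lipschitz_image)
       (use N2(1) in \<open>auto intro!: exI[of _ UNIV] exI[of _ "1::real"] simp: abs_minus_commute\<close>)
  show thesis
  proof (rule that[of "N1 \<union> uminus ` N2"])
    show "negligible (N1 \<union> uminus ` N2)" using N1 neg2 by simp
    fix x assume x: "x \<notin> N1 \<union> uminus ` N2"
    then have x2: "- x \<notin> N2" by (metis UnCI image_eqI minus_minus)
    have "((\<lambda>y. (h y - h x) / (y - x)) \<longlongrightarrow> K x) (at x)"
    proof (rule LIM_I)
      fix e :: real assume "e > 0"
      obtain d1 where d1: "d1 > 0" "\<And>u. 0 < u \<Longrightarrow> u < d1 \<Longrightarrow> \<bar>(h (x + u) - h x) / u - K x\<bar> < e"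
      proof -
        obtain d where "d > 0" and d: "\<forall>u. 0 < u \<and> u < d \<longrightarrow>
          norm (integral (cbox x (x + u *\<^sub>R One)) K /\<^sub>R u ^ DIM(real) - K x) < e"
          using N1(2)[of x e] x \<open>e > 0\<close> by auto
        show thesis
        proof (rule that[OF \<open>d > 0\<close>])
          fix u :: real assume u: "0 < u" "u < d"
          have "integral {x..x + u} K = h (x + u) - h x"
            using Kint[of x "x + u"] u by (intro integral_unique) auto
          then show "\<bar>(h (x + u) - h x) / u - K x\<bar> < e"
            using d u by (auto simp: divide_inverse mult.commute)
        qed
      qed
      obtain d2 where d2: "d2 > 0" "\<And>u. 0 < u \<Longrightarrow> u < d2 \<Longrightarrow> \<bar>(h x - h (x - u)) / u - K x\<bar> < e"
      proof -
        obtain d where "d > 0" and d: "\<forall>u. 0 < u \<and> u < d \<longrightarrow>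
          norm (integral (cbox (-x) (-x + u *\<^sub>R One)) (\<lambda>x. K (- x)) /\<^sub>R u ^ DIM(real) - K (- (- x))) < e"
          using N2(2)[of "-x" e] x2 \<open>e > 0\<close> by auto
        show thesis
        proof (rule that[OF \<open>d > 0\<close>])
          fix u :: real assume u: "0 < u" "u < d"
          have "integral {-x..-x + u} (\<lambda>x. K (- x)) = h x - h (x - u)"
            using Kint2[of "-x" "-x + u"] u by (intro integral_unique) auto
          then show "\<bar>(h x - h (x - u)) / u - K x\<bar> < e"
            using d u by (auto simp: divide_inverse mult.commute)
        qed
      qed
      show "\<exists>s>0. \<forall>y. y \<noteq> x \<and> norm (y - x) < s \<longrightarrow> norm ((h y - h x) / (y - x) - K x) < e"
      proof (intro exI[of _ "min d1 d2"] conjI allI impI)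
        show "min d1 d2 > 0" using d1 d2 by simp
        fix y assume y: "y \<noteq> x \<and> norm (y - x) < min d1 d2"
        show "norm ((h y - h x) / (y - x) - K x) < e"
        proof (cases "y > x")
          case True
          then show ?thesis using d1(2)[of "y - x"] y by simp
        next
          case False
          then have "(h x - h y) / (x - y) = (h y - h x) / (y - x)"
            using y by (simp add: divide_simps algebra_simps)
          then show ?thesis using d2(2)[of "x - y"] y False by simp
        qed
      qed
    qed
    then have "(h has_field_derivative K x) (at x)"
      by (simp add: has_field_derivative_iff)
    then have "((\<lambda>y. h y - (C + 1) * y) has_field_derivative K x - (C + 1)) (at x)"
      by (auto intro!: derivative_eq_intros)
    then have "(f has_field_derivative K x - (C + 1)) (at x)" by (simp add: h_def)
    then show "f differentiable (at x)" by (auto simp: field_differentiable_def real_differentiable_def)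
  qed
qed

section \<open>Inner tubes under similarities\<close>

text \<open>Only distances are prescribed and surjectivity is derived. The notion covers a homothety
  followed by a congruence, and inverses stay within it.\<close>

definition similarity :: "real \<Rightarrow> ('a::euclidean_space \<Rightarrow> 'a) \<Rightarrow> bool" where
  "similarity r \<phi> \<longleftrightarrow> r > 0 \<and> (\<forall>x y. dist (\<phi> x) (\<phi> y) = r * dist x y)"

text \<open>Subtracting the value at 0 and dividing by the ratio leaves an isometry that fixes 0; in
  finite dimension this is an orthogonal map, hence bijective.\<close>

lemma similarity_bij:
  assumes "similarity r \<phi>"
  shows "bij \<phi>"
proof -
  define \<psi> where "\<psi> = (\<lambda>x. (\<phi> x - \<phi> 0) /\<^sub>R r)"
  have r: "r > 0" and d: "\<And>x y. dist (\<phi> x) (\<phi> y) = r * dist x y"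
    using assms by (auto simp: similarity_def)
  have "dist (\<psi> x) (\<psi> y) = dist x y" for x y
  proof -
    have "\<psi> x - \<psi> y = (\<phi> x - \<phi> y) /\<^sub>R r" by (simp add: \<psi>_def scaleR_diff_right)
    then show ?thesis using d[of x y] r by (simp add: dist_norm)
  qed
  then have "orthogonal_transformation \<psi>"
    unfolding orthogonal_transformation_isometry by (simp add: \<psi>_def)
  then have "bij \<psi>" by (rule orthogonal_transformation_bij)
  have "surj \<phi>"
  proof (rule surjI)
    fix y
    have "\<psi> (inv \<psi> ((y - \<phi> 0) /\<^sub>R r)) = (y - \<phi> 0) /\<^sub>R r"
      using \<open>bij \<psi>\<close> by (simp add: bij_is_surj surj_f_inv_f)
    then show "\<phi> (inv \<psi> ((y - \<phi> 0) /\<^sub>R r)) = y" using r by (simp add: \<psi>_def)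
  qed
  moreover have "inj \<phi>"
    using d r by (intro injI) (metis dist_eq_0_iff less_irrefl mult_eq_0_iff)
  ultimately show ?thesis by (simp add: bij_def)
qed

lemma similarity_image_ball:
  assumes "similarity r \<phi>"
  shows "\<phi> ` ball x s = ball (\<phi> x) (r * s)"
proof -
  have "y \<in> \<phi> ` ball x s" if "y \<in> ball (\<phi> x) (r * s)" for y
  proof -
    obtain z where "y = \<phi> z" using similarity_bij[OF assms] by (metis bij_pointE)
    then show ?thesis using that assms by (auto simp: similarity_def)
  qed
  then show ?thesis using assms by (auto simp: similarity_def)
qed

lemma similarity_continuous_on: "similarity r \<phi> \<Longrightarrow> continuous_on S \<phi>"
  by (rule lipschitz_on_continuous_on[of r]) (auto simp: lipschitz_on_def similarity_def)

lemma similarity_inv: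
  assumes "similarity r \<phi>"
  shows "similarity (1 / r) (inv \<phi>)"
proof -
  have "dist (inv \<phi> x) (inv \<phi> y) = 1 / r * dist x y" for x y
  proof -
    have "\<phi> (inv \<phi> x) = x" "\<phi> (inv \<phi> y) = y"
      using similarity_bij[OF assms] by (simp_all add: bij_is_surj surj_f_inv_f)
    then have "dist x y = r * dist (inv \<phi> x) (inv \<phi> y)" using assms by (metis similarity_def)
    then show ?thesis using assms by (simp add: similarity_def)
  qed
  then show ?thesis using assms by (simp add: similarity_def)
qed

lemma similarity_image_open:
  assumes "similarity r \<phi>" "open A"
  shows "open (\<phi> ` A)"
proof -
  have "\<phi> ` A = inv \<phi> -` A"
    using similarity_bij[OF assms(1)] by (metis bij_imp_bij_inv bij_vimage_eq_inv_image inv_inv_eq)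
  then show ?thesis
    using continuous_on_open_vimage[of UNIV "inv \<phi>"] similarity_continuous_on[OF similarity_inv[OF assms(1)]]
      assms(2) by (metis Int_UNIV_right open_UNIV)
qed

lemma similarity_image_closure:
  assumes "similarity r \<phi>"
  shows "\<phi> ` closure A = closure (\<phi> ` A)"
proof
  show "\<phi> ` closure A \<subseteq> closure (\<phi> ` A)"
    by (intro image_closure_subset similarity_continuous_on[OF assms]) (auto simp: closure_subset)
  have *: "\<phi> (inv \<phi> y) = y" "inv \<phi> (\<phi> x) = x" for x y
    using similarity_bij[OF assms] by (simp_all add: bij_is_surj surj_f_inv_f bij_is_inj)
  have "inv \<phi> ` closure (\<phi> ` A) \<subseteq> closure (inv \<phi> ` \<phi> ` A)"
    by (intro image_closure_subset similarity_continuous_on[OF similarity_inv[OF assms]]) (auto simp: closure_subset)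
  also have "inv \<phi> ` \<phi> ` A = A" by (simp add: image_image *)
  finally show "closure (\<phi> ` A) \<subseteq> \<phi> ` closure A" by (force simp: * intro: image_eqI[where x = "inv \<phi> _"])
qed

lemma similarity_image_frontier:
  assumes "similarity r \<phi>" "open A"
  shows "frontier (\<phi> ` A) = \<phi> ` frontier A"
  using assms similarity_image_open[OF assms] similarity_bij[OF assms(1)]
  by (simp add: frontier_def interior_open similarity_image_closure[symmetric] image_set_diff bij_is_inj)

text \<open>Both distances are attained because the sets are closed, so each inequality is a
  comparison at a minimiser.\<close>

lemma similarity_infdist:
  assumes "similarity r \<phi>" "closed F" "F \<noteq> {}"
  shows "infdist (\<phi> x) (\<phi> ` F) = r * infdist x F"
proof (rule antisym)
  have r: "r > 0" and d: "\<And>x y. dist (\<phi> x) (\<phi> y) = r * dist x y"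
    using assms by (auto simp: similarity_def)
  obtain a where a: "a \<in> F" "infdist x F = dist x a" 
    using infdist_attains_inf[OF assms(2,3)] by blast
  show "infdist (\<phi> x) (\<phi> ` F) \<le> r * infdist x F"
    using infdist_le[of "\<phi> a" "\<phi> ` F" "\<phi> x"] a d by simp
  have "closed (\<phi> ` F)"
    using similarity_image_closure[OF assms(1), of F] assms(2) by (metis closed_closure closure_closed)
  then obtain b where b: "b \<in> F" "infdist (\<phi> x) (\<phi> ` F) = dist (\<phi> x) (\<phi> b)" 
    using infdist_attains_inf[of "\<phi> ` F" "\<phi> x"] assms(3) by auto
  show "r * infdist x F \<le> infdist (\<phi> x) (\<phi> ` F)"
    using b d infdist_le[of b F x] r by simp
qed

section \<open>Scaling of volumes and of inner tubes\<close>

text \<open>By the Vitali covering theorem an open set is, up to a null set, a countable disjoint union of balls.\<close>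

lemma similarity_emeasure_image:
  fixes \<phi> :: "'a::euclidean_space \<Rightarrow> 'a"
  assumes \<phi>: "similarity r \<phi>" and A: "open A"
  shows "emeasure lebesgue (\<phi> ` A) = ennreal (r ^ DIM('a)) * emeasure lebesgue A"
proof -
  have r: "r > 0" and d: "\<And>x y. dist (\<phi> x) (\<phi> y) = r * dist x y"
    using assms by (auto simp: similarity_def)
  define K where "K = {(x, s). s > 0 \<and> ball x s \<subseteq> A}"
  have cov: "\<exists>i. i \<in> K \<and> x \<in> ball (fst i) (snd i) \<and> snd i < e" if "x \<in> A" "e > 0" for x e
  proof -
    obtain s where s: "s > 0" "ball x s \<subseteq> A" using A \<open>x \<in> A\<close> by (meson openE)
    have "min s (e/2) > 0" "ball x (min s (e/2)) \<subseteq> A" "min s (e/2) < e" using s that by auto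
    then show ?thesis by (intro exI[of _ "(x, min s (e/2))"]) (auto simp: K_def)
  qed
  obtain C where C: "countable C" "C \<subseteq> K"
     "pairwise (\<lambda>i j. disjnt (ball (fst i) (snd i)) (ball (fst j) (snd j))) C"
     "negligible (A - (\<Union>i \<in> C. ball (fst i) (snd i)))"
    by (rule Vitali_covering_theorem_balls[OF cov])
  define B where "B = (\<lambda>i. ball (fst i) (snd i) :: 'a set)"
  define R where "R = A - (\<Union>i\<in>C. B i)"
  have AR: "A = (\<Union>i\<in>C. B i) \<union> R" using C(2) by (fastforce simp: R_def B_def K_def)
  have negR: "negligible R" using C(4) by (simp add: R_def B_def)
  have negR': "negligible (\<phi> ` R)"
    by (rule negligible_locally_Lipschitz_image)
      (use negR d in \<open>auto intro!: exI[of _ UNIV] exI[of _ r] simp: dist_norm\<close>)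
  have disj: "disjoint_family_on B C"
    using C(3) by (auto simp: disjoint_family_on_def pairwise_def disjnt_def B_def)
  have inj: "inj \<phi>" using similarity_bij[OF \<phi>] by (rule bij_is_inj)
  have disj': "disjoint_family_on (\<lambda>i. \<phi> ` B i) C"
    using disj inj by (auto simp: disjoint_family_on_def image_Int[OF inj, symmetric])
  have Bm: "B i \<in> sets lebesgue" "\<phi> ` B i \<in> sets lebesgue" for i
    using similarity_image_open[OF \<phi>] by (auto simp: B_def)
  have "emeasure lebesgue A = emeasure lebesgue (\<Union>i\<in>C. B i)"
    using negR by (subst AR, intro emeasure_Un_null_set) (auto simp: negligible_iff_null_sets intro!: Bm C)
  also have "\<dots> = (\<integral>\<^sup>+i. emeasure lebesgue (B i) \<partial>count_space C)"
    by (intro emeasure_UN_countable Bm C disj)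
  finally have 1: "emeasure lebesgue A = (\<integral>\<^sup>+i. emeasure lebesgue (B i) \<partial>count_space C)" .
  have "\<phi> ` A = (\<Union>i\<in>C. \<phi> ` B i) \<union> \<phi> ` R" by (subst AR) auto
  then have "emeasure lebesgue (\<phi> ` A) = emeasure lebesgue (\<Union>i\<in>C. \<phi> ` B i)"
    using negR' by (simp only:, intro emeasure_Un_null_set) (auto simp: negligible_iff_null_sets intro!: Bm C)
  also have "\<dots> = (\<integral>\<^sup>+i. emeasure lebesgue (\<phi> ` B i) \<partial>count_space C)"
    by (intro emeasure_UN_countable Bm C disj')
  also have "\<dots> = (\<integral>\<^sup>+i. ennreal (r ^ DIM('a)) * emeasure lebesgue (B i) \<partial>count_space C)"
  proof (rule nn_integral_cong)
    fix i assume "i \<in> space (count_space C)"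
    then have "snd i > 0" using C(2) by (auto simp: K_def)
    then show "emeasure lebesgue (\<phi> ` B i) = ennreal (r ^ DIM('a)) * emeasure lebesgue (B i)"
      using r by (simp add: B_def similarity_image_ball[OF \<phi>] emeasure_ball power_mult_distrib
          ennreal_mult[symmetric] mult_ac)
  qed
  also have "\<dots> = ennreal (r ^ DIM('a)) * emeasure lebesgue A"
    by (subst nn_integral_cmult) (auto simp: 1)
  finally show ?thesis .
qed

lemma similarity_measure_image:
  fixes \<phi> :: "'a::euclidean_space \<Rightarrow> 'a"
  assumes "similarity r \<phi>" "open A"
  shows "measure lebesgue (\<phi> ` A) = r ^ DIM('a) * measure lebesgue A"
  using similarity_emeasure_image[OF assms] assms(1) by (simp add: measure_def enn2real_mult similarity_def)

lemma bounded_open_frontier_nonempty: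
  fixes A :: "'a::euclidean_space set"
  assumes "A \<noteq> {}" "bounded A"
  shows "frontier A \<noteq> {}"
  using assms not_bounded_UNIV by (auto simp: frontier_eq_empty)

lemma open_infdist_greater: "open {x \<in> A. infdist x F > e}" if "open A"
proof -
  have "{x \<in> A. infdist x F > e} = A \<inter> {x. e < infdist x F}" by auto
  then show ?thesis using that
    by (auto intro!: open_Int open_Collect_less continuous_intros)
qed

text \<open>Passing to the complement replaces the tube by an open set, and the scaling of Lebesgue
  measure is proved for open sets.\<close>

lemma inner_tube_volume_open:
  assumes "open A" "bounded A"
  shows "inner_tube_volume A e = measure lebesgue A - measure lebesgue {x \<in> A. infdist x (frontier A) > e}"
proof -
  have "{x \<in> A. infdist x (frontier A) \<le> e} = A - {x \<in> A. infdist x (frontier A) > e}" by auto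
  moreover have op: "open {x \<in> A. infdist x (frontier A) > e}" using open_infdist_greater[OF assms(1)] .
  have "{x \<in> A. infdist x (frontier A) > e} \<in> lmeasurable"
    by (rule lmeasurable_open[OF bounded_subset[OF assms(2)] op]) auto
  then have "measure lebesgue (A - {x \<in> A. infdist x (frontier A) > e})
      = measure lebesgue A - measure lebesgue {x \<in> A. infdist x (frontier A) > e}"
    by (intro measurable_measure_Diff) (use assms in \<open>auto intro!: lmeasurable_open\<close>)
  ultimately show ?thesis unfolding inner_tube_volume_def by metis
qed

lemma inner_tube_volume_similarity:
  fixes A :: "'a::euclidean_space set"
  assumes \<phi>: "similarity r \<phi>" and A: "open A" "bounded A" "A \<noteq> {}"
  shows "inner_tube_volume (\<phi> ` A) e = r ^ DIM('a) * inner_tube_volume A (e / r)"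
proof -
  have r: "r > 0" and d: "\<And>x y. dist (\<phi> x) (\<phi> y) = r * dist x y"
    using assms by (auto simp: similarity_def)
  have bdd: "bounded (\<phi> ` A)"
  proof -
    obtain x B where "\<forall>y\<in>A. dist x y \<le> B" using A(2) by (auto simp: bounded_def)
    then have "\<forall>y\<in>A. dist (\<phi> x) (\<phi> y) \<le> r * B" using r d by simp
    then show ?thesis by (auto simp: bounded_def)
  qed
  have fr: "frontier A \<noteq> {}" "closed (frontier A)"
    using bounded_open_frontier_nonempty A by auto
  have "{x \<in> \<phi> ` A. infdist x (frontier (\<phi> ` A)) > e} = \<phi> ` {x \<in> A. infdist x (frontier A) > e / r}"
    using similarity_infdist[OF \<phi> fr(2,1)] r
    by (auto simp: similarity_image_frontier[OF \<phi> A(1)] pos_divide_less_eq mult.commute)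
  then show ?thesis
    using similarity_measure_image[OF \<phi> A(1)]
      similarity_measure_image[OF \<phi> open_infdist_greater[OF A(1), of "e / r" "frontier A"]]
    by (simp only: inner_tube_volume_open[OF A(1,2)] right_diff_distrib
        inner_tube_volume_open[OF similarity_image_open[OF \<phi> A(1)] bdd])
qed

lemma inner_tube_volume_mono:
  assumes "open A" "bounded A" "e \<le> e'"
  shows "inner_tube_volume A e \<le> inner_tube_volume A e'"
proof -
  have "measure lebesgue {x \<in> A. infdist x (frontier A) > e'} \<le> measure lebesgue {x \<in> A. infdist x (frontier A) > e}"
  proof (rule measure_mono_fmeasurable)
    have op: "open {x \<in> A. infdist x (frontier A) > t}" for t using open_infdist_greater[OF assms(1)] .
    show "{x \<in> A. infdist x (frontier A) > e'} \<in> sets lebesgue" by (rule lebesgue_openin[of UNIV]) (auto simp: op)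
    show "{x \<in> A. infdist x (frontier A) > e} \<in> lmeasurable"
      by (rule lmeasurable_open[OF bounded_subset[OF assms(2)] op]) auto
  qed (use assms in auto)
  then show ?thesis using assms by (simp add: inner_tube_volume_open)
qed

lemma inner_tube_volume_nonneg: "inner_tube_volume A e \<ge> 0"
  by (simp add: inner_tube_volume_def)

text \<open>A point of \<open>G\<close> farther than \<open>e\<close> from the frontier would be the
  centre of a ball in \<open>G\<close> of radius larger than the inradius: the ball is connected,
  meets \<open>G\<close> and misses the frontier. So the tube exhausts \<open>G\<close>.\<close>

lemma inner_tube_volume_ge_inradius:
  fixes G :: "'a::euclidean_space set"
  assumes G: "generator G" and e: "inradius G \<le> e"
  shows "inner_tube_volume G e = measure lebesgue G"
proof -
  have "infdist x (frontier G) \<le> e" if "x \<in> G" for x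
  proof (rule ccontr)
    define s where "s = infdist x (frontier G)"
    assume "\<not> ?thesis"
    then have s: "s > e" by (simp add: s_def)
    obtain B where B: "G \<subseteq> ball 0 B" using G by (metis generator_def bounded_subset_ballD)
    \<comment> \<open>The supremum in \<open>inradius\<close> bounds its set only if that set is
      bounded above; a ball inside \<open>ball 0 B\<close> has radius at most
      \<open>B\<close>.\<close>
    have bdd: "bdd_above {\<epsilon>. \<epsilon> > 0 \<and> (\<exists>x. ball x \<epsilon> \<subseteq> G)}"
    proof (rule bdd_aboveI)
      fix t assume "t \<in> {\<epsilon>. \<epsilon> > 0 \<and> (\<exists>x. ball x \<epsilon> \<subseteq> G)}"
      then obtain x where x: "t > 0" "ball x t \<subseteq> G" by auto
      then have "ball x t \<subseteq> ball 0 B" using B by (rule_tac order_trans)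
      then show "t \<le> B" using x zero_le_dist[of x 0] unfolding ball_subset_ball_iff by linarith
    qed
    obtain u where u: "u > 0" "ball x u \<subseteq> G"
      using G \<open>x \<in> G\<close> by (metis generator_def openE)
    have "0 < inradius G"
      using cSup_upper[OF _ bdd, of u] u unfolding inradius_def by fastforce
    then have "s > 0" using s e by linarith
    have "ball x s \<subseteq> G"
    proof (rule ccontr)
      assume "\<not> ball x s \<subseteq> G"
      then have "ball x s \<inter> frontier G \<noteq> {}"
        using \<open>s > 0\<close> \<open>x \<in> G\<close> centre_in_ball[of x s] by (intro connected_Int_frontier) blast+
      then obtain y where "y \<in> frontier G" "dist x y < s" by auto
      then show False using infdist_le[of y "frontier G" x] by (simp add: s_def)
    qed
    then have "s \<le> inradius G"
      using cSup_upper[OF _ bdd, of s] \<open>s > 0\<close> unfolding inradius_def by blast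
    then show False using s e by linarith
  qed
  then have "{x \<in> G. infdist x (frontier G) \<le> e} = G" by auto
  then show ?thesis by (simp add: inner_tube_volume_def)
qed

lemma fractal_spray_similarity:
  assumes "fractal_spray G l \<Omega> \<T>"
  obtains \<phi> where "similarity (l n) \<phi>" "\<Omega> n = \<phi> ` G"
proof -
  obtain \<psi> where \<psi>: "\<forall>x y. dist (\<psi> x) (\<psi> y) = dist x y" "\<Omega> n = \<psi> ` (*\<^sub>R) (l n) ` G" and l: "l n > 0"
    using assms unfolding fractal_spray_def congruent_sets_def by metis
  show thesis
  proof (rule that[of "\<lambda>x. \<psi> (l n *\<^sub>R x)"])
    show "similarity (l n) (\<lambda>x. \<psi> (l n *\<^sub>R x))"
      using \<psi>(1) l by (auto simp: similarity_def dist_norm simp flip: scaleR_diff_right)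
  qed (use \<psi> in auto)
qed

lemma fractal_spray_tube:
  fixes G :: "'a::euclidean_space set"
  assumes "fractal_spray G l \<Omega> \<T>"
  shows "inner_tube_volume (\<Omega> n) e = l n ^ DIM('a) * inner_tube_volume G (e / l n)"
  using fractal_spray_similarity[OF assms, of n] assms
  by (metis inner_tube_volume_similarity fractal_spray_def generator_def)

text \<open>The pieces are disjoint and fill a bounded set, so their volumes have a finite sum;
  dividing by the volume of \<open>G\<close> is possible because a nonempty open set is not
  null.\<close>

lemma fractal_spray_summable:
  fixes G :: "'a::euclidean_space set"
  assumes "fractal_spray G l \<Omega> \<T>"
  shows "summable (\<lambda>n. l n ^ DIM('a))"
proof -
  have op: "\<And>n. open (\<Omega> n)" and disj: "disjoint_family \<Omega>" and T: "bounded \<T>" "\<T> = (\<Union>n. \<Omega> n)" "open \<T>"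
    and G: "open G" "G \<noteq> {}" "bounded G"
    using assms unfolding fractal_spray_def generator_def by auto
  have m: "measure lebesgue (\<Omega> n) = l n ^ DIM('a) * measure lebesgue G" for n
    using fractal_spray_similarity[OF assms, of n] G(1) by (metis similarity_measure_image)
  have "(\<lambda>n. measure lebesgue (\<Omega> n)) sums measure lebesgue \<T>"
    unfolding T(2)
  proof (rule measure_UNION[OF _ disj])
    show "range \<Omega> \<subseteq> sets lebesgue" using op by auto
    have "\<T> \<in> lmeasurable" using T by (intro bounded_set_imp_lmeasurable) auto
    then have "emeasure lebesgue \<T> \<noteq> \<infinity>" using fmeasurableD2 by fastforce
    then show "emeasure lebesgue (\<Union>n. \<Omega> n) \<noteq> \<infinity>" unfolding T(2)[symmetric] .
  qed
  then have "summable (\<lambda>n. l n ^ DIM('a) * measure lebesgue G)"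
    unfolding m by (rule sums_summable)
  moreover have "measure lebesgue G \<noteq> 0"
    using G open_not_negligible[of G] by (auto simp: negligible_iff_measure0 bounded_set_imp_lmeasurable)
  ultimately show ?thesis by (simp add: mult.commute summable_cmult_iff)
qed

section \<open>The Mellin transform of the tube volume\<close>

lemma complex_powr_measurable [measurable]:
  "(\<lambda>x::real. complex_of_real x powr z) \<in> borel_measurable borel"
  unfolding powr_def by measurable

lemma norm_of_real_powr: "x > 0 \<Longrightarrow> norm (complex_of_real x powr z) = x powr Re z"
  by (simp add: norm_powr_real_powr)

lemma has_vector_derivative_complex_powr:
  assumes "x > 0"
  shows "((\<lambda>x. complex_of_real x powr z) has_vector_derivative z * of_real x powr (z - 1)) (at x within S)"
proof -
  have "((\<lambda>w. w powr z) has_field_derivative z * complex_of_real x powr (z - 1)) (at (of_real x))"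
    using assms by (auto intro!: derivative_eq_intros simp: complex_nonpos_Reals_iff)
  then show ?thesis by (rule has_vector_derivative_real_field[THEN has_vector_derivative_at_within])
qed

lemma set_integrable_lborelI:
  fixes F :: "real \<Rightarrow> complex"
  assumes [measurable]: "F \<in> borel_measurable borel" "S \<in> sets borel"
    and "F integrable_on S" "(\<lambda>x. norm (F x)) integrable_on S"
  shows "set_integrable lborel S F"
proof -
  have "F absolutely_integrable_on S"
    using assms by (simp add: absolutely_integrable_on_def)
  then show ?thesis
    unfolding set_integrable_def by (subst (asm) integrable_completion) auto
qed

lemma has_bochner_integral_complex_powr_0:
  assumes "Re z > 0" "b > 0"
  shows "has_bochner_integral lborel (\<lambda>x. indicator {0<..<b} x *\<^sub>R complex_of_real x powr (z - 1)) (of_real b powr z / z)"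
proof -
  have "z \<noteq> 0" using assms by auto
  have "((\<lambda>x. x powr (Re z - 1)) has_integral b powr (Re z) / Re z) {0..b}"
    using has_integral_powr_from_0[of "Re z - 1" b] assms by simp
  then have "((\<lambda>x. x powr (Re z - 1)) has_integral b powr (Re z) / Re z) {0<..<b}"
    by (simp add: has_integral_Icc_iff_Ioo)
  then have 1: "((\<lambda>x. norm (complex_of_real x powr (z - 1))) has_integral b powr (Re z) / Re z) {0<..<b}"
    by (rule has_integral_eq[rotated]) (auto simp: norm_of_real_powr)
  have "((\<lambda>x. complex_of_real x powr (z - 1)) has_integral (of_real b powr z / z - of_real 0 powr z / z)) {0..b}"
  proof (rule fundamental_theorem_of_calculus_interior)
    show "continuous_on {0..b} (\<lambda>x. of_real x powr z / z)"
      using assms \<open>z \<noteq> 0\<close> by (intro continuous_intros) auto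
    show "((\<lambda>x. of_real x powr z / z) has_vector_derivative complex_of_real x powr (z - 1)) (at x)"
      if "x \<in> {0<..<b}" for x
      using has_vector_derivative_divide[OF has_vector_derivative_complex_powr[of x z UNIV], of z] that \<open>z \<noteq> 0\<close> by simp
  qed (use assms in auto)
  then have 2: "((\<lambda>x. complex_of_real x powr (z - 1)) has_integral (of_real b powr z / z)) {0<..<b}"
    by (simp add: has_integral_Icc_iff_Ioo)
  have *: "set_integrable lborel {0<..<b} (\<lambda>x. complex_of_real x powr (z - 1))"
    using 1 2 by (intro set_integrable_lborelI) auto
  from set_borel_integral_eq_integral(2)[OF *] integral_unique[OF 2] * show ?thesis
    by (simp add: has_bochner_integral_iff set_integrable_def set_lebesgue_integral_def)
qed

lemma has_bochner_integral_complex_powr_inf: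
  assumes "Re z < 0" "b > 0"
  shows "has_bochner_integral lborel (\<lambda>x. indicator {b<..} x *\<^sub>R complex_of_real x powr (z - 1)) (- (of_real b powr z) / z)"
proof -
  have "z \<noteq> 0" using assms by auto
  have "((\<lambda>x. x powr (Re z - 1)) has_integral -(b powr (Re z)) / Re z) {b..}"
    using has_integral_powr_to_inf[of "Re z - 1" b] assms by simp
  then have "(\<lambda>x. x powr (Re z - 1)) absolutely_integrable_on {b..}"
    using assms by (intro nonnegative_absolutely_integrable_1) auto
  then have "set_integrable lborel {b..} (\<lambda>x. x powr (Re z - 1))"
    unfolding set_integrable_def by (subst (asm) integrable_completion) auto
  then have "set_integrable lborel {b<..} (\<lambda>x. x powr (Re z - 1))"
    by (rule set_integrable_subset) auto
  then have *: "set_integrable lborel {b<..} (\<lambda>x. complex_of_real x powr (z - 1))"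
    unfolding set_integrable_def
    by (rule Bochner_Integration.integrable_bound) (use assms in \<open>auto simp: norm_of_real_powr indicator_def\<close>)
  have "(LBINT x=ereal b..\<infinity>. complex_of_real x powr (z - 1)) = 0 - (of_real b powr z) / z"
  proof (rule interval_integral_FTC_integrable)
    fix x assume x: "ereal b < ereal x"
    show "((\<lambda>x. of_real x powr z / z) has_vector_derivative complex_of_real x powr (z - 1)) (at x)"
      using has_vector_derivative_divide[OF has_vector_derivative_complex_powr[of x z UNIV], of z] assms x \<open>z \<noteq> 0\<close> by simp
    show "isCont (\<lambda>x. complex_of_real x powr (z - 1)) x"
      using assms x by (intro continuous_intros) (auto simp: complex_nonpos_Reals_iff)
  next
    show "set_integrable lborel (einterval (ereal b) \<infinity>) (\<lambda>x. complex_of_real x powr (z - 1))"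
      using * by (simp add: einterval_eq_Ici)
    have "isCont (\<lambda>x. complex_of_real x powr z / z) b"
      using assms \<open>z \<noteq> 0\<close> by (intro continuous_intros) (auto simp: complex_nonpos_Reals_iff)
    then have "((\<lambda>x. complex_of_real x powr z / z) \<longlongrightarrow> of_real b powr z / z) (at_right b)"
      unfolding isCont_def by (rule tendsto_mono[rotated]) (rule at_le, simp)
    then show "(((\<lambda>x. of_real x powr z / z) \<circ> real_of_ereal) \<longlongrightarrow> of_real b powr z / z) (at_right (ereal b))"
      by (simp add: ereal_tendsto_simps)
    have "((\<lambda>x. x powr (Re z)) \<longlongrightarrow> 0) at_top"
      using assms by (intro tendsto_neg_powr filterlim_ident)
    then have "((\<lambda>x. norm (complex_of_real x powr z)) \<longlongrightarrow> 0) at_top"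
      by (rule Lim_transform_eventually)
         (use eventually_gt_at_top[of 0] in eventually_elim, simp add: norm_of_real_powr)
    then have "((\<lambda>x. complex_of_real x powr z) \<longlongrightarrow> 0) at_top"
      by (rule tendsto_norm_zero_cancel)
    then have "((\<lambda>x. complex_of_real x powr z / z) \<longlongrightarrow> 0) at_top"
      by (rule tendsto_divide_zero)
    then show "(((\<lambda>x. of_real x powr z / z) \<circ> real_of_ereal) \<longlongrightarrow> 0) (at_left \<infinity>)"
      by (simp add: ereal_tendsto_simps)
  qed simp
  then show ?thesis using *
    by (simp add: has_bochner_integral_iff set_integrable_def set_lebesgue_integral_def
        interval_integral_to_infinity_eq)
qed

text \<open>Below \<open>g\<close> the tube volume is a polynomial whose terms converge at 0 because
  \<open>Re s > d - 1\<close>; beyond \<open>g\<close> it is the constant volume of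
  \<open>G\<close>, and the tail converges because \<open>Re s < d\<close>.\<close>

lemma monophase_mellin:
  fixes G :: "'a::euclidean_space set"
  assumes G: "generator G" and mono: "monophase_with G \<kappa>" and g: "g = inradius G" "g > 0"
    and s: "real DIM('a) - 1 < Re s" "Re s < real DIM('a)"
  shows "has_bochner_integral lborel
     (\<lambda>x. indicator {0<..} x *\<^sub>R (complex_of_real (inner_tube_volume G x) * of_real x powr (s - of_nat DIM('a) - 1)))
     (\<Sum>k\<le>DIM('a). of_real g powr (s - of_nat k) / (s - of_nat k) * of_real (\<kappa> k))"
proof -
  define d where "d = DIM('a)"
  define A where "A = (\<lambda>k x. indicator {0<..<g} x *\<^sub>R complex_of_real x powr (s - of_nat k - 1))"
  define B where "B = (\<lambda>x. indicator {g<..} x *\<^sub>R complex_of_real x powr (s - of_nat d - 1))"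
  have "has_bochner_integral lborel (\<lambda>x. (\<Sum>k<d. A k x * of_real (\<kappa> k)) + (B x * - of_real (\<kappa> d)))
     ((\<Sum>k<d. of_real g powr (s - of_nat k) / (s - of_nat k) * of_real (\<kappa> k))
        + (- (of_real g powr (s - of_nat d)) / (s - of_nat d)) * - of_real (\<kappa> d))"
  proof (intro has_bochner_integral_add has_bochner_integral_sum has_bochner_integral_mult_left)
    fix k assume "k \<in> {..<d}"
    then have "real k \<le> real d - 1" by simp
    then have "Re (s - of_nat k) > 0" using s by (simp add: d_def)
    then show "has_bochner_integral lborel (A k) (of_real g powr (s - of_nat k) / (s - of_nat k))"
      unfolding A_def by (intro has_bochner_integral_complex_powr_0 g)
  next
    show "has_bochner_integral lborel B (- (of_real g powr (s - of_nat d)) / (s - of_nat d))"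
      unfolding B_def using s by (intro has_bochner_integral_complex_powr_inf g) (auto simp: d_def)
  qed
  \<comment> \<open>Two minus signs cancel, one from the primitive at infinity and one from the
    convention that \<open>\<kappa> d\<close> is minus the volume. The tail thus becomes the term
    \<open>k = d\<close>.\<close>
  moreover have "(\<Sum>k<d. of_real g powr (s - of_nat k) / (s - of_nat k) * of_real (\<kappa> k))
        + (- (of_real g powr (s - of_nat d)) / (s - of_nat d)) * - of_real (\<kappa> d)
      = (\<Sum>k\<le>d. of_real g powr (s - of_nat k) / (s - of_nat k) * complex_of_real (\<kappa> k))"
    by (simp add: lessThan_Suc_atMost[symmetric])
  \<comment> \<open>The point \<open>g\<close> belongs to neither power integral and is discarded as
    a null set.\<close>
  moreover have "AE x in lborel. (\<Sum>k<d. A k x * of_real (\<kappa> k)) + (B x * - of_real (\<kappa> d)) =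
     indicator {0<..} x *\<^sub>R (complex_of_real (inner_tube_volume G x) * of_real x powr (s - of_nat d - 1))"
    using AE_lborel_singleton[of g]
  proof eventually_elim
    case (elim x)
    consider "x \<le> 0" | "0 < x" "x < g" | "x > g" using elim by linarith
    then show ?case
    proof cases
      case 2
      have "inner_tube_volume G x = (\<Sum>k<d. \<kappa> k * x ^ (d - k))"
        using mono 2 g unfolding monophase_with_def d_def by simp
      moreover have AK: "A k x * of_real (\<kappa> k) = of_real (\<kappa> k * x ^ (d - k)) * of_real x powr (s - of_nat d - 1)"
        if "k < d" for k
      proof -
        have "complex_of_real x powr (s - of_nat k - 1) = of_real x powr (of_nat (d - k) + (s - of_nat d - 1))"
          using that by (simp add: of_nat_diff algebra_simps)
        also have "\<dots> = of_real x ^ (d - k) * of_real x powr (s - of_nat d - 1)"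
          using 2 by (simp add: powr_add powr_nat)
        finally show ?thesis using 2 by (simp add: A_def)
      qed
      have "(\<Sum>k<d. A k x * of_real (\<kappa> k)) = (\<Sum>k<d. of_real (\<kappa> k * x ^ (d - k)) * of_real x powr (s - of_nat d - 1))"
        by (intro sum.cong AK) auto
      ultimately show ?thesis using 2 by (simp add: B_def sum_distrib_right)
    next
      case 3
      then have "inner_tube_volume G x = - \<kappa> d"
        using mono g inner_tube_volume_ge_inradius[OF G, of x] by (simp add: monophase_with_def d_def)
      then show ?thesis using 3 g by (simp add: A_def B_def)
    qed (use g in \<open>auto simp: A_def B_def\<close>)
  qed
  moreover have "(\<lambda>x. inner_tube_volume G x) \<in> borel_measurable borel"
    using G by (intro borel_measurable_mono monoI inner_tube_volume_mono) (auto simp: generator_def)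
  then have "(\<lambda>x. indicator {0<..} x *\<^sub>R (complex_of_real (inner_tube_volume G x) * of_real x powr (s - of_nat d - 1)))
      \<in> borel_measurable lborel" by measurable
  ultimately show ?thesis unfolding d_def[symmetric]
    by (subst has_bochner_integral_cong_AE[symmetric]) (auto simp: has_bochner_integral_iff)
qed

text \<open>Substitute x = l y. The volume factor gives l^d, the power gives l^(s-d-1) and dx gives
  l, which multiply to l^s.\<close>

lemma has_bochner_integral_scale_mellin:
  fixes v :: "real \<Rightarrow> real"
  assumes "has_bochner_integral lborel (\<lambda>x. indicator {0<..} x *\<^sub>R (complex_of_real (v x) * of_real x powr (s - of_nat d - 1))) I"
    and l: "l > 0"
  shows "has_bochner_integral lborel
     (\<lambda>x. indicator {0<..} x *\<^sub>R (complex_of_real (l ^ d * v (x / l)) * of_real x powr (s - of_nat d - 1)))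
     (of_real l powr s * I)"
proof -
  define h where "h = (\<lambda>x. indicator {0<..} x *\<^sub>R (complex_of_real (v x) * of_real x powr (s - of_nat d - 1)))"
  have "has_bochner_integral lborel (\<lambda>x. h (0 + (1 / l) * x)) (I /\<^sub>R \<bar>1 / l\<bar>)"
    using lborel_has_bochner_integral_real_affine_iff[of "1/l" h I 0] assms by (simp add: h_def)
  then have "has_bochner_integral lborel (\<lambda>x. (of_real l powr (s - 1)) * h (x / l)) (of_real l powr (s - 1) * (l *\<^sub>R I))"
    using l by (intro has_bochner_integral_mult_right) (simp add: divide_inverse mult.commute)
  moreover have "of_real l powr (s - 1) * (l *\<^sub>R I) = of_real l powr s * I"
    using l by (simp add: powr_diff scaleR_conv_of_real)
  moreover have "of_real l powr (s - 1) * h (x / l) = 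
      indicator {0<..} x *\<^sub>R (complex_of_real (l ^ d * v (x / l)) * of_real x powr (s - of_nat d - 1))" for x
  proof (cases "x > 0")
    case True
    have "complex_of_real (x / l) powr (s - of_nat d - 1) * of_real l powr (s - of_nat d - 1)
        = of_real x powr (s - of_nat d - 1)"
      using True l powr_times_real[of "complex_of_real (x / l)" "of_real l" "s - of_nat d - 1"] by simp
    moreover have "complex_of_real l powr (s - 1) = of_real l ^ d * of_real l powr (s - of_nat d - 1)"
      using l powr_add[of "complex_of_real l" "of_nat d" "s - of_nat d - 1"] by (simp add: powr_nat)
    ultimately show ?thesis using True l by (simp add: h_def mult.commute)
  qed (use l in \<open>auto simp: h_def indicator_def zero_less_divide_iff\<close>)
  ultimately show ?thesis by simp
qed


text \<open>Sum and integral are interchanged. This is allowed because the integral of the norm of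
  the n-th term is a constant times \<open>l n powr Re s\<close>.\<close>

lemma spray_mellin:
  fixes G :: "'a::euclidean_space set"
  assumes spray: "fractal_spray G l \<Omega> \<T>" and mono: "monophase_with G \<kappa>" and g: "g = inradius G" "g > 0"
    and s: "real DIM('a) - 1 < Re s" "Re s < real DIM('a)" and sm: "summable (\<lambda>n. l n powr Re s)"
  shows "has_bochner_integral lborel
     (\<lambda>x. indicator {0<..} x *\<^sub>R (complex_of_real (spray_tube_volume \<Omega> x) * of_real x powr (s - of_nat DIM('a) - 1)))
     (scaling_series l s * (\<Sum>k\<le>DIM('a). of_real g powr (s - of_nat k) / (s - of_nat k) * of_real (\<kappa> k)))"
proof -
  define d where "d = DIM('a)"
  define P where "P = (\<lambda>s. \<Sum>k\<le>d. of_real g powr (s - of_nat k) / (s - of_nat k) * complex_of_real (\<kappa> k))"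
  define V where "V = (\<lambda>n x. inner_tube_volume (\<Omega> n) x)"
  define F where "F = (\<lambda>s n x. indicator {0<..} x *\<^sub>R (complex_of_real (V n x) * of_real x powr (s - of_nat d - 1)))"
  have G: "generator G" and l: "l n > 0" for n using spray by (auto simp: fractal_spray_def)
  have Veq: "V n x = l n ^ d * inner_tube_volume G (x / l n)" for n x
    unfolding V_def d_def by (rule fractal_spray_tube[OF spray])
  have HF: "has_bochner_integral lborel (F w n) (of_real (l n) powr w * P w)"
    if "real d - 1 < Re w" "Re w < real d" for w n
    unfolding F_def Veq P_def d_def
    by (intro has_bochner_integral_scale_mellin l monophase_mellin G mono g that[unfolded d_def])
  \<comment> \<open>Tube volumes are nonnegative, so the norm of the integrand at \<open>s\<close>
    is the integrand at the real point \<open>r\<close>; the transform already computed then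
    evaluates the integrals of the norms.\<close>
  define r where "r = complex_of_real (Re s)"
  have normF: "complex_of_real (norm (F s n x)) = F r n x" for n x
    by (auto simp: F_def r_def norm_mult norm_of_real_powr indicator_def V_def inner_tube_volume_nonneg powr_of_real[symmetric])
  have int_norm: "(\<integral>x. norm (F s n x) \<partial>lborel) = l n powr Re s * norm (P r)" for n
  proof -
    have "complex_of_real (\<integral>x. norm (F s n x) \<partial>lborel) = of_real (l n) powr r * P r"
      using HF[of r n] s by (simp add: integral_complex_of_real[symmetric] normF has_bochner_integral_iff r_def d_def)
    then have "norm (complex_of_real (\<integral>x. norm (F s n x) \<partial>lborel)) = l n powr Re s * norm (P r)"
      by (simp only: norm_mult norm_of_real_powr[OF l]) (simp add: r_def)
    then show ?thesis by simp
  qed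
  have Vsum: "summable (\<lambda>n. V n x)" for x
  proof (rule summable_comparison_test')
    show "summable (\<lambda>n. l n ^ d * measure lebesgue G)"
      using fractal_spray_summable[OF spray] by (simp add: d_def summable_mult2)
    have "inner_tube_volume G t \<le> measure lebesgue G" for t
      using inner_tube_volume_mono[of G t "max t (inradius G)"] inner_tube_volume_ge_inradius[OF G, of "max t (inradius G)"] G
      by (simp add: generator_def)
    then show "norm (V n x) \<le> l n ^ d * measure lebesgue G" for n
      using l[of n] by (simp add: Veq inner_tube_volume_nonneg)
  qed
  have sumF: "(\<Sum>n. F s n x) = indicator {0<..} x *\<^sub>R (complex_of_real (spray_tube_volume \<Omega> x) * of_real x powr (s - of_nat d - 1))" for x
  proof -
    have "complex_of_real (spray_tube_volume \<Omega> x) = (\<Sum>n. of_real (V n x))"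
      unfolding spray_tube_volume_def using suminf_of_real[OF Vsum[of x]] by (simp add: V_def)
    then show ?thesis unfolding F_def
      by (simp only:, intro sums_unique[symmetric] sums_scaleR_right sums_mult2 summable_sums
          summable_of_real Vsum)
  qed
  have int: "integrable lborel (F s n)" for n using HF[of s n] s by (simp add: has_bochner_integral_iff d_def)
  have ae: "AE x in lborel. summable (\<lambda>n. norm (F s n x))"
  proof (rule AE_I2)
    fix x
    have "norm (F s n x) = V n x * norm (indicator {0<..} x *\<^sub>R of_real x powr (s - of_nat d - 1))" for n
      by (simp add: F_def norm_mult V_def inner_tube_volume_nonneg)
    then show "summable (\<lambda>n. norm (F s n x))" using Vsum[of x] by (simp add: summable_mult2)
  qed
  have sn: "summable (\<lambda>n. \<integral>x. norm (F s n x) \<partial>lborel)"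
    unfolding int_norm by (intro summable_mult2 sm)
  have "(\<integral>x. (\<Sum>n. F s n x) \<partial>lborel) = (\<Sum>n. integral\<^sup>L lborel (F s n))"
    by (rule integral_suminf[OF int ae sn])
  also have "\<dots> = (\<Sum>n. of_real (l n) powr s * P s)"
    using HF[of s] s by (simp add: has_bochner_integral_iff d_def)
  also have "\<dots> = scaling_series l s * P s"
  proof -
    have "summable (\<lambda>n. complex_of_real (l n) powr s)"
      by (rule summable_norm_cancel) (simp add: norm_of_real_powr l sm)
    then show ?thesis unfolding scaling_series_def by (rule suminf_mult2[symmetric])
  qed
  finally show ?thesis
    using integrable_suminf[OF int ae sn]
    by (simp add: has_bochner_integral_iff sumF P_def d_def)
qed

section \<open>Mellin inversion for test functions\<close>

text \<open>This is the Mellin transform of \<open>\<phi>\<close> at \<open>z + 1\<close>. The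
  unshifted exponent matches the power \<open>d - s\<close> in the tubular zeta function.\<close>

definition power_moment :: "(real \<Rightarrow> complex) \<Rightarrow> complex \<Rightarrow> complex" where
  "power_moment \<phi> z = integral {0<..} (\<lambda>x. complex_of_real x powr z * \<phi> x)"

lemma test_functionE:
  assumes "test_function \<psi>"
  obtains D p q where "D 0 = \<psi>" "\<And>n x. (D n has_vector_derivative D (Suc n) x) (at x)"
    "0 < p" "p < q" "\<And>n x. x \<notin> {p<..<q} \<Longrightarrow> D n x = 0"
proof -
  obtain D where D: "D 0 = \<psi>" "\<And>n x. (D n has_vector_derivative D (Suc n) x) (at x)"
    using assms unfolding test_function_def by blast
  define K where "K = closure {x. \<psi> x \<noteq> 0}"
  have K: "compact K" "K \<subseteq> {0<..}" using assms by (auto simp: test_function_def K_def)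
  have Dz: "D n x = 0" if "x \<notin> K" for n x
    using that
  proof (induction n arbitrary: x)
    case 0
    then show ?case using closure_subset[of "{x. \<psi> x \<noteq> 0}"] by (auto simp: D(1) K_def)
  next
    case (Suc n)
    have "open (- K)" using K(1) by (simp add: compact_imp_closed open_Compl)
    then have "(D n has_vector_derivative 0) (at x)"
      by (rule has_vector_derivative_transform_within_open[OF has_vector_derivative_const[of 0]])
         (use Suc in auto)
    then show ?case using D(2)[of n x] vector_derivative_unique_at by blast
  qed
  obtain p q where pq: "0 < p" "p < q" "K \<subseteq> {p<..<q}"
  proof (cases "K = {}")
    case True
    then show ?thesis using that[of 1 2] by simp
  next
    case False
    obtain m where m: "m \<in> K" "\<And>x. x \<in> K \<Longrightarrow> m \<le> x" using compact_attains_inf[OF K(1) False] by blast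
    obtain M where M: "M \<in> K" "\<And>x. x \<in> K \<Longrightarrow> x \<le> M" using compact_attains_sup[OF K(1) False] by blast
    have "0 < m" "m \<le> M" using m M K(2) by auto
    then show ?thesis using m M by (intro that[of "m / 2" "M + 1"]) force+
  qed
  show thesis
  proof (rule that[OF D pq(1,2)])
    show "D n x = 0" if "x \<notin> {p<..<q}" for n x using that pq(3) Dz by blast
  qed
qed

text \<open>A test function is carried together with all its derivatives, because every integration
  by parts moves one step up the sequence \<open>D\<close>. The lower end \<open>p\<close> is
  positive, which keeps all complex powers smooth on the support.\<close>

locale supported =
  fixes D :: "nat \<Rightarrow> real \<Rightarrow> complex" and p q :: real
  assumes D: "\<And>n x. (D n has_vector_derivative D (Suc n) x) (at x)"
    and pq: "0 < p" "p < q" and zero: "\<And>n x. x \<notin> {p<..<q} \<Longrightarrow> D n x = 0"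
begin

lemma continuous_D [continuous_intros]: "continuous_on S (D n)"
  using D by (meson continuous_at_imp_continuous_on has_vector_derivative_continuous)

lemma powr_continuous: "0 < a \<Longrightarrow> continuous_on {a..b} (\<lambda>x. complex_of_real x powr z)"
  by (intro continuous_intros) (auto simp: complex_nonpos_Reals_iff)

lemma moment_has_integral:
  assumes "0 < a" "a \<le> p" "q \<le> b"
  shows "((\<lambda>x. complex_of_real x powr z * D n x) has_integral power_moment (D n) z) {a..b}"
proof -
  have "(\<lambda>x. complex_of_real x powr z * D n x) integrable_on {a..b}"
    by (intro integrable_continuous_real continuous_intros powr_continuous assms)
  then obtain I where I: "((\<lambda>x. complex_of_real x powr z * D n x) has_integral I) {a..b}" by blast
  then have "((\<lambda>x. complex_of_real x powr z * D n x) has_integral I) {0<..}"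
    by (rule has_integral_on_superset) (use assms zero in auto)
  then have "power_moment (D n) z = I" unfolding power_moment_def by (rule integral_unique)
  then show ?thesis using I by simp
qed

text \<open>Integration by parts; the boundary terms vanish because \<open>D n\<close> is 0 at
  \<open>p\<close> and at \<open>q\<close>.\<close>

lemma moment_parts: "(z + 1) * power_moment (D n) z = - power_moment (D (Suc n)) (z + 1)"
proof -
  have "((\<lambda>x. complex_of_real x powr (z + 1) * D (Suc n) x + ((z + 1) * complex_of_real x powr z) * D n x) has_integral
      (of_real q powr (z + 1) * D n q - of_real p powr (z + 1) * D n p)) {p..q}"
  proof (rule fundamental_theorem_of_calculus)
    fix x assume x: "x \<in> {p..q}"
    then have "((\<lambda>x. complex_of_real x powr (z + 1)) has_vector_derivative ((z + 1) * complex_of_real x powr z)) (at x within {p..q})"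
      using has_vector_derivative_complex_powr[of x "z + 1"] pq by simp
    then show "((\<lambda>x. of_real x powr (z + 1) * D n x) has_vector_derivative
      of_real x powr (z + 1) * D (Suc n) x + ((z + 1) * complex_of_real x powr z) * D n x) (at x within {p..q})"
      by (intro has_vector_derivative_mult has_vector_derivative_at_within[OF D])
  qed (use pq in simp)
  moreover have "((\<lambda>x. complex_of_real x powr (z + 1) * D (Suc n) x + (z + 1) * (complex_of_real x powr z * D n x)) has_integral
      (power_moment (D (Suc n)) (z + 1) + (z + 1) * power_moment (D n) z)) {p..q}"
    using pq by (intro has_integral_add has_integral_mult_right moment_has_integral) auto
  ultimately have "power_moment (D (Suc n)) (z + 1) + (z + 1) * power_moment (D n) z = 0"
    by (simp add: mult.assoc zero has_integral_unique)
  then show ?thesis by (simp add: add_eq_0_iff)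
qed

lemma moment_bounded: "\<exists>C. \<forall>z. \<bar>Re z\<bar> \<le> R \<longrightarrow> norm (power_moment (D n) z) \<le> C"
proof -
  have "compact (D n ` {p..q})" by (intro compact_continuous_image continuous_intros) auto
  then obtain B where B: "\<And>x. x \<in> {p..q} \<Longrightarrow> norm (D n x) \<le> B"
    by (meson compact_imp_bounded bounded_iff image_eqI)
  have "B \<ge> 0" using B[of p] pq norm_ge_zero[of "D n p"] by (simp, linarith)
  define L where "L = max \<bar>ln p\<bar> \<bar>ln q\<bar>"
  have "norm (power_moment (D n) z) \<le> exp (R * L) * B * (q - p)" if R: "\<bar>Re z\<bar> \<le> R" for z
  proof -
    have "norm (complex_of_real x powr z * D n x) \<le> exp (R * L) * B" if x: "x \<in> {p..q}" for x
    proof -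
      have "x > 0" using x pq by auto
      then have "ln p \<le> ln x" "ln x \<le> ln q" using x pq by auto
      then have "\<bar>ln x\<bar> \<le> L" by (auto simp: L_def)
      then have "\<bar>Re z\<bar> * \<bar>ln x\<bar> \<le> R * L" using R by (intro mult_mono) auto
      then have "Re z * ln x \<le> R * L" using abs_ge_self[of "Re z * ln x"] by (simp add: abs_mult)
      then have "x powr Re z \<le> exp (R * L)" using \<open>x > 0\<close> by (simp add: powr_def)
      then show ?thesis using B[OF x] \<open>x > 0\<close> by (simp add: norm_mult norm_of_real_powr mult_mono)
    qed
    then have "norm (power_moment (D n) z) \<le> exp (R * L) * B * Henstock_Kurzweil_Integration.content {p..q}"
      by (intro has_integral_bound_real[OF _ _ moment_has_integral, of _ "{}"]) (use pq \<open>B \<ge> 0\<close> in auto)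
    then show ?thesis using pq by simp
  qed
  then show ?thesis by blast
qed

text \<open>Each integration by parts gains a factor \<open>\<bar>z + 1\<bar>\<close>, at least
  \<open>\<bar>Im z\<bar>\<close>, at the price of one more derivative and a shift of the real part
  by 1. The induction is therefore over all \<open>n\<close> and \<open>R\<close> at once.\<close>

lemma moment_decay: "\<exists>C. \<forall>z. \<bar>Re z\<bar> \<le> R \<longrightarrow> norm (power_moment (D n) z) * \<bar>Im z\<bar> ^ N \<le> C"
proof (induction N arbitrary: n R)
  case 0
  then show ?case using moment_bounded by simp
next
  case (Suc N)
  obtain C where C: "\<And>z. \<bar>Re z\<bar> \<le> R + 1 \<Longrightarrow> norm (power_moment (D (Suc n)) z) * \<bar>Im z\<bar> ^ N \<le> C"
    using Suc[of "R + 1" "Suc n"] by blast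
  have "norm (power_moment (D n) z) * \<bar>Im z\<bar> ^ Suc N \<le> C" if "\<bar>Re z\<bar> \<le> R" for z
  proof -
    have "norm (power_moment (D n) z) * \<bar>Im z\<bar> \<le> norm (power_moment (D n) z) * norm (z + 1)"
      using abs_Im_le_cmod[of "z + 1"] by (intro mult_left_mono) auto
    also have "\<dots> = norm (power_moment (D (Suc n)) (z + 1))"
      using moment_parts[of z n] by (metis mult.commute norm_minus_cancel norm_mult)
    finally have "norm (power_moment (D n) z) * \<bar>Im z\<bar> * \<bar>Im z\<bar> ^ N \<le> norm (power_moment (D (Suc n)) (z + 1)) * \<bar>Im (z + 1)\<bar> ^ N"
      by (simp add: mult_right_mono)
    also have "\<dots> \<le> C" using that by (intro C) auto
    finally show ?thesis by (simp add: mult_ac)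
  qed
  then show ?case by blast
qed

lemma moment_decay_square:
  obtains C where "\<And>z. \<bar>Re z\<bar> \<le> R \<Longrightarrow> norm (power_moment (D n) z) \<le> C / (1 + (Im z)\<^sup>2)"
proof -
  obtain C1 where C1: "\<And>z. \<bar>Re z\<bar> \<le> R \<Longrightarrow> norm (power_moment (D n) z) * \<bar>Im z\<bar> ^ 0 \<le> C1"
    using moment_decay[of R n 0] by blast
  obtain C2 where C2: "\<And>z. \<bar>Re z\<bar> \<le> R \<Longrightarrow> norm (power_moment (D n) z) * \<bar>Im z\<bar> ^ 2 \<le> C2"
    using moment_decay[of R n 2] by blast
  show thesis
  proof (rule that[of "C1 + C2"])
    fix z :: complex assume "\<bar>Re z\<bar> \<le> R"
    then have "norm (power_moment (D n) z) * (1 + (Im z)\<^sup>2) \<le> C1 + C2"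
      using C1[of z] C2[of z] by (simp add: algebra_simps)
    then show "norm (power_moment (D n) z) \<le> (C1 + C2) / (1 + (Im z)\<^sup>2)"
      by (subst pos_le_divide_eq) (auto intro: add_pos_nonneg)
  qed
qed

lemma moment_holomorphic: "power_moment (D n) holomorphic_on S"
proof -
  have "(\<lambda>z. integral (cbox p q) (\<lambda>x. complex_of_real x powr z * D n x)) holomorphic_on UNIV"
  proof (rule leibniz_rule_holomorphic[where fx = "\<lambda>z x. complex_of_real x powr z * Ln (of_real x) * D n x"])
    show "((\<lambda>z. complex_of_real x powr z * D n x) has_field_derivative complex_of_real x powr z * Ln (of_real x) * D n x) (at z within UNIV)"
      if "x \<in> cbox p q" for x z
      using that pq by (auto intro!: derivative_eq_intros)
    show "(\<lambda>x. complex_of_real x powr z * D n x) integrable_on cbox p q" for z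
      using moment_has_integral[of p q] pq by auto
    show "continuous_on (UNIV \<times> cbox p q) (\<lambda>(z, x). complex_of_real x powr z * Ln (of_real x) * D n x)"
      using pq unfolding case_prod_beta
      by (intro continuous_intros continuous_on_compose2[OF continuous_D[of UNIV]]) (auto simp: complex_nonpos_Reals_iff)
  qed auto
  moreover have "integral (cbox p q) (\<lambda>x. complex_of_real x powr z * D n x) = power_moment (D n) z" for z
    using moment_has_integral[of p q z n] pq by (simp add: integral_unique)
  ultimately show ?thesis by (auto intro: holomorphic_on_subset)
qed

section \<open>Dirichlet kernel in the logarithmic variable\<close>

lemma cis_has_integral:
  assumes "T \<ge> 0"
  shows "((\<lambda>t. cis (- t * u)) has_integral of_real (2 * T * sinc (T * u))) {-T..T}"
proof (cases "u = 0")
  case True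
  then show ?thesis
    using has_integral_const_real[of "1::complex" "-T" T] assms
    by (simp add: scaleR_conv_of_real)
next
  case False
  have eq: "exp (\<i> * (- complex_of_real u * complex_of_real t)) = cis (- t * u)" for t
    unfolding cis_conv_exp by (rule arg_cong[where f = exp]) simp
  have "((\<lambda>t. cis (- t * u)) has_integral (\<i> / u * cis (- T * u) - \<i> / u * cis (- (- T) * u))) {-T..T}"
  proof (rule fundamental_theorem_of_calculus)
    fix t assume "t \<in> {-T..T}"
    have "((\<lambda>w. \<i> / u * exp (\<i> * (- complex_of_real u * w))) has_field_derivative exp (\<i> * (- complex_of_real u * complex_of_real t))) (at (of_real t))"
      using False by (auto intro!: derivative_eq_intros)
    then have "((\<lambda>t. \<i> / u * exp (\<i> * (- complex_of_real u * complex_of_real t))) has_vector_derivative exp (\<i> * (- complex_of_real u * complex_of_real t))) (at t)"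
      by (rule has_vector_derivative_real_field)
    then show "((\<lambda>t. \<i> / u * cis (- t * u)) has_vector_derivative cis (- t * u)) (at t within {-T..T})"
      unfolding eq by (rule has_vector_derivative_at_within)
  qed (use assms in simp)
  moreover have "\<i> / u * cis (- T * u) - \<i> / u * cis (- (- T) * u) = of_real (2 * T * sinc (T * u))"
    using False by (cases "T = 0") (simp_all add: complex_eq_iff)
  ultimately show ?thesis by simp
qed

text \<open>Divided by \<open>e\<close> and multiplied by the oscillation
  \<open>cis (- t * ln (e / x))\<close>, this is the integrand of the inversion integral. At
  \<open>e = x\<close> it takes the value \<open>D 0 x\<close> that is to be recovered.\<close>

definition weighted :: "real \<Rightarrow> real \<Rightarrow> real \<Rightarrow> complex" where
  "weighted \<sigma> x e = D 0 e * of_real ((e / x) powr (\<sigma> + 1))"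

definition weighted_deriv :: "real \<Rightarrow> real \<Rightarrow> real \<Rightarrow> complex" where
  "weighted_deriv \<sigma> x e = D 0 e * of_real ((\<sigma> + 1) / x * (e / x) powr \<sigma>) + D 1 e * of_real ((e / x) powr (\<sigma> + 1))"

lemma weighted_has_vector_derivative:
  assumes "x > 0" "e > 0"
  shows "(weighted \<sigma> x has_vector_derivative weighted_deriv \<sigma> x e) (at e within S)"
proof -
  have "((\<lambda>e. (e / x) powr (\<sigma> + 1)) has_real_derivative ((\<sigma> + 1) / x * (e / x) powr \<sigma>)) (at e)"
    using assms by (auto intro!: derivative_eq_intros)
  then have "((\<lambda>e. complex_of_real ((e / x) powr (\<sigma> + 1))) has_vector_derivative of_real ((\<sigma> + 1) / x * (e / x) powr \<sigma>)) (at e)"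
    by (simp only: has_vector_derivative_of_real has_real_derivative_iff_has_vector_derivative)
  then have "(weighted \<sigma> x has_vector_derivative weighted_deriv \<sigma> x e) (at e)"
    unfolding weighted_def[abs_def] weighted_deriv_def using has_vector_derivative_mult[OF D[of 0 e]] by fastforce
  then show ?thesis by (rule has_vector_derivative_at_within)
qed

text \<open>Over a compact rectangle the two integrations may be swapped, and the integral over t is
  a Dirichlet kernel. That kernel is the derivative of \<open>2 * Si (T * ln (e / x))\<close> in
  \<open>e\<close>; integration by parts replaces it by the bounded function \<open>Si\<close>,
  which makes the limit in \<open>T\<close> accessible to dominated convergence.\<close>

lemma truncated_mellin_inversion:
  fixes \<sigma> :: real
  assumes x: "x > 0" and ab: "0 < a" "a \<le> p" "q \<le> b" "a < x" "x < b" and "T \<ge> 0"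
  defines "w \<equiv> weighted \<sigma> x" and "w' \<equiv> weighted_deriv \<sigma> x"
  shows "((\<lambda>t. of_real x powr Complex (- \<sigma> - 1) t * power_moment (D 0) (Complex \<sigma> (- t)))
      has_integral - integral {a..b} (\<lambda>e. w' e * of_real (2 * Si (T * ln (e / x))))) {-T..T}"
proof -
  define k where "k = (\<lambda>t e. of_real x powr Complex (- \<sigma> - 1) t * (complex_of_real e powr Complex \<sigma> (- t) * D 0 e))"
  have k: "k t e = w e / of_real e * cis (- t * ln (e / x))" if "e > 0" for t e
  proof -
    have A: "of_real x powr Complex (- \<sigma> - 1) t = of_real (x powr (- \<sigma> - 1)) * cis (t * ln x)"
      using x by (simp add: powr_def Ln_of_real Complex_eq exp_add[symmetric] exp_of_real[symmetric] cis_conv_exp algebra_simps)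
    have B: "of_real e powr Complex \<sigma> (- t) = of_real (e powr \<sigma>) * cis (- t * ln e)"
      using that by (simp add: powr_def Ln_of_real Complex_eq exp_add[symmetric] exp_of_real[symmetric] cis_conv_exp algebra_simps)
    have C: "x powr (- \<sigma> - 1) * e powr \<sigma> = (e / x) powr (\<sigma> + 1) / e"
      using that x by (simp add: powr_divide powr_add powr_diff powr_minus field_simps)
    have E: "cis (t * ln x) * cis (- t * ln e) = cis (- t * ln (e / x))"
      using that x by (simp add: cis_mult ln_div algebra_simps)
    have "k t e = of_real (x powr (- \<sigma> - 1) * e powr \<sigma>) * (cis (t * ln x) * cis (- t * ln e)) * D 0 e"
      unfolding k_def A B of_real_mult by (simp only: mult_ac)
    then show ?thesis unfolding C E w_def weighted_def by (simp add: mult_ac)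
  qed
  have kcont: "continuous_on (cbox (- T, a) (T, b)) (\<lambda>(t, e). k t e)"
  proof -
    have "cbox (- T, a) (T, b) = {-T..T} \<times> {a..b}" by (simp add: cbox_Pair_eq)
    then show ?thesis using x ab unfolding k_def case_prod_beta Complex_eq
      by (intro continuous_intros continuous_on_compose2[OF continuous_D[of UNIV]])
         (auto simp: complex_nonpos_Reals_iff)
  qed
  have "integral {-T..T} (\<lambda>t. integral {a..b} (k t)) = integral {a..b} (\<lambda>e. integral {-T..T} (\<lambda>t. k t e))"
    using integral_swap_continuous[OF kcont] by simp
  also have "integral {a..b} (\<lambda>e. integral {-T..T} (\<lambda>t. k t e)) 
      = integral {a..b} (\<lambda>e. w e * of_real (2 * (sinc (T * ln (e / x)) * (T / e))))"
  proof (rule Henstock_Kurzweil_Integration.integral_cong)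
    fix e assume e: "e \<in> {a..b}"
    then have "e > 0" using ab by auto
    have "((\<lambda>t. k t e) has_integral (w e / of_real e * of_real (2 * T * sinc (T * ln (e / x))))) {-T..T}"
      unfolding k[OF \<open>e > 0\<close>] by (intro has_integral_mult_right cis_has_integral assms)
    then show "integral {-T..T} (\<lambda>t. k t e) = w e * of_real (2 * (sinc (T * ln (e / x)) * (T / e)))"
      by (simp only: integral_unique) (simp add: mult_ac)
  qed
  also have "\<dots> = - integral {a..b} (\<lambda>e. w' e * of_real (2 * Si (T * ln (e / x))))"
  proof -
    have S1: "((\<lambda>e. w e * of_real (2 * (sinc (T * ln (e / x)) * (T / e))) + w' e * of_real (2 * Si (T * ln (e / x)))) has_integral
       (w b * of_real (2 * Si (T * ln (b / x))) - w a * of_real (2 * Si (T * ln (a / x))))) {a..b}"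
    proof (rule fundamental_theorem_of_calculus)
      fix e assume "e \<in> {a..b}"
      then have "e > 0" using ab by auto
      have 1: "(w has_vector_derivative w' e) (at e within {a..b})"
        unfolding w_def w'_def by (rule weighted_has_vector_derivative[OF x \<open>e > 0\<close>])
      have "((\<lambda>e. 2 * Si (T * ln (e / x))) has_real_derivative 2 * (sinc (T * ln (e / x)) * (T / e))) (at e)"
        using \<open>e > 0\<close> x by (auto intro!: derivative_eq_intros DERIV_chain2[OF DERIV_Si])
      then have 2: "((\<lambda>e. complex_of_real (2 * Si (T * ln (e / x)))) has_vector_derivative of_real (2 * (sinc (T * ln (e / x)) * (T / e)))) (at e)"
        by (simp only: has_vector_derivative_of_real has_real_derivative_iff_has_vector_derivative)
      show "((\<lambda>e. w e * of_real (2 * Si (T * ln (e / x)))) has_vector_derivative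
         w e * of_real (2 * (sinc (T * ln (e / x)) * (T / e))) + w' e * of_real (2 * Si (T * ln (e / x)))) (at e within {a..b})"
        by (rule has_vector_derivative_mult[OF 1 has_vector_derivative_at_within[OF 2]])
    qed (use ab in auto)
    have wab: "w a = 0" "w b = 0" using ab zero[of a 0] zero[of b 0] by (auto simp: w_def weighted_def)
    have S2: "((\<lambda>e. w' e * of_real (2 * Si (T * ln (e / x)))) has_integral
         integral {a..b} (\<lambda>e. w' e * of_real (2 * Si (T * ln (e / x))))) {a..b}"
      using ab x unfolding w'_def weighted_deriv_def
      by (intro integrable_integral integrable_continuous_real continuous_intros continuous_on_compose2[OF continuous_at_imp_continuous_on[of UNIV Si]])
         (auto simp: isCont_Si)
    from has_integral_diff[OF S1 S2] show ?thesis
      unfolding add_diff_cancel_right' wab by (simp only: integral_unique) simp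
  qed
  finally have I: "integral {-T..T} (\<lambda>t. integral {a..b} (k t)) = \<dots>" .
  have kint: "integral {a..b} (k t) = of_real x powr Complex (- \<sigma> - 1) t * power_moment (D 0) (Complex \<sigma> (- t))" for t
    unfolding k_def by (intro integral_unique has_integral_mult_right moment_has_integral ab)
  have "continuous_on {-T..T} (\<lambda>t. of_real x powr Complex (- \<sigma> - 1) t * power_moment (D 0) (Complex \<sigma> (- t)))"
    using x unfolding Complex_eq
    by (intro continuous_intros continuous_on_compose2[OF holomorphic_on_imp_continuous_on[OF moment_holomorphic[of 0 UNIV]]])
       auto
  from integrable_integral[OF integrable_continuous_real[OF this]] show ?thesis
    unfolding I[unfolded kint] .
qed

end

section \<open>Mellin inversion and Parseval's identity\<close>

context supported begin

lemma moment_line_integrable: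
  "integrable lborel (\<lambda>t. power_moment (D n) (Complex \<sigma> (- t)))"
proof -
  obtain C where C: "\<And>z. \<bar>Re z\<bar> \<le> \<bar>\<sigma>\<bar> \<Longrightarrow> norm (power_moment (D n) z) \<le> C / (1 + (Im z)\<^sup>2)"
    using moment_decay_square by blast
  have "integrable lborel (\<lambda>t. C * inverse (1 + t\<^sup>2))"
    using integrable_inverse_1_plus_square by (intro integrable_mult_right) (simp add: set_integrable_def)
  then show ?thesis
  proof (rule Bochner_Integration.integrable_bound)
    have "continuous_on UNIV (\<lambda>t. power_moment (D n) (Complex \<sigma> (- t)))"
      unfolding Complex_eq
      by (intro continuous_intros continuous_on_compose2[OF holomorphic_on_imp_continuous_on[OF moment_holomorphic[of n UNIV]]]) auto
    then show "(\<lambda>t. power_moment (D n) (Complex \<sigma> (- t))) \<in> borel_measurable lborel"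
      by (simp add: borel_measurable_continuous_onI)
    show "AE t in lborel. norm (power_moment (D n) (Complex \<sigma> (- t))) \<le> norm (C * inverse (1 + t\<^sup>2))"
    proof (rule AE_I2)
      fix t
      show "norm (power_moment (D n) (Complex \<sigma> (- t))) \<le> norm (C * inverse (1 + t\<^sup>2))"
        using C[of "Complex \<sigma> (- t)"] abs_ge_self[of "C / (1 + t\<^sup>2)"] by (simp add: divide_inverse)
    qed
  qed
qed

lemma powr_line_measurable [measurable]:
  "(\<lambda>(x, t). complex_of_real x powr Complex \<tau> t) \<in> borel_measurable (borel \<Otimes>\<^sub>M borel)"
  unfolding powr_def Complex_eq case_prod_beta by measurable

text \<open>As \<open>T\<close> grows, \<open>2 * Si (T * ln (e / x))\<close> tends boundedly to
  \<open>pi * sgn (e - x)\<close>. Integrating the derivative of \<open>w\<close> against this sign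
  recovers \<open>w x\<close>, which is \<open>D 0 x\<close>.\<close>

lemma mellin_inversion:
  assumes x: "x > 0"
  shows "has_bochner_integral lborel
    (\<lambda>t. of_real x powr Complex (- \<sigma> - 1) t * power_moment (D 0) (Complex \<sigma> (- t))) (2 * pi * D 0 x)"
proof -
  define F where "F = (\<lambda>t. of_real x powr Complex (- \<sigma> - 1) t * power_moment (D 0) (Complex \<sigma> (- t)))"
  have meas[measurable]: "(\<lambda>t. complex_of_real x powr Complex (- \<sigma> - 1) t) \<in> borel_measurable lborel"
    unfolding powr_def Complex_eq by measurable
  have Fint: "integrable lborel F"
  proof (rule Bochner_Integration.integrable_bound)
    show "integrable lborel (\<lambda>t. x powr (- \<sigma> - 1) * norm (power_moment (D 0) (Complex \<sigma> (- t))))"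
      by (intro integrable_mult_right integrable_norm moment_line_integrable)
    show "F \<in> borel_measurable lborel" unfolding F_def
      using moment_line_integrable by (intro borel_measurable_times meas) auto
  qed (use x in \<open>auto simp: F_def norm_mult norm_of_real_powr\<close>)
  \<comment> \<open>The interval must contain the support and have \<open>x\<close> in its interior,
    even when \<open>x\<close> lies outside the support.\<close>
  define a b where "a = min p (x / 2)" and "b = max q (x + 1)"
  have ab: "0 < a" "a \<le> p" "q \<le> b" "a < x" "x < b" using x pq by (auto simp: a_def b_def)
  define w w' where "w = weighted \<sigma> x" and "w' = weighted_deriv \<sigma> x"
  have trunc: "(F has_integral - integral {a..b} (\<lambda>e. w' e * of_real (2 * Si (T * ln (e / x))))) {-T..T}" if "T \<ge> 0" for T
    unfolding F_def w'_def by (rule truncated_mellin_inversion[OF x ab that])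
  have 1: "(\<lambda>n. integral {- real n..real n} F) \<longlonglongrightarrow> integral\<^sup>L lborel F"
  proof -
    have "(\<lambda>n. \<integral>t. indicator {- real n..real n} t *\<^sub>R F t \<partial>lborel) \<longlonglongrightarrow> integral\<^sup>L lborel F"
    proof (rule integral_dominated_convergence[where w = "\<lambda>t. norm (F t)"])
      show "AE t in lborel. (\<lambda>n. indicator {- real n..real n} t *\<^sub>R F t) \<longlonglongrightarrow> F t"
      proof (rule AE_I2, rule tendsto_eventually)
        fix t
        obtain N where "\<bar>t\<bar> \<le> real N" using real_arch_simple by blast
        then show "\<forall>\<^sub>F n in sequentially. indicator {- real n..real n} t *\<^sub>R F t = F t"
          by (intro eventually_sequentiallyI[of N]) (auto simp: indicator_def)
      qed
    qed (use Fint in \<open>auto simp: indicator_def\<close>)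
    moreover have "(\<integral>t. indicator {- real n..real n} t *\<^sub>R F t \<partial>lborel) = integral {- real n..real n} F" for n
    proof -
      have "set_integrable lborel {- real n..real n} F"
        unfolding set_integrable_def using Fint by (intro integrable_mult_indicator) auto
      then show ?thesis using set_borel_integral_eq_integral(2) by (simp add: set_lebesgue_integral_def)
    qed
    ultimately show ?thesis by simp
  qed
  have w_deriv: "(w has_vector_derivative w' e) (at e within S)" if "e > 0" for e S
    unfolding w_def w'_def by (rule weighted_has_vector_derivative[OF x that])
  have w'cont: "continuous_on {a..b} w'"
    unfolding w'_def weighted_deriv_def[abs_def] using ab x by (intro continuous_intros) auto
  obtain B where B: "\<And>T. \<bar>Si T\<bar> \<le> B" using bounded_Si by blast
  have 2: "(\<lambda>n. integral {a..b} (\<lambda>e. w' e * of_real (2 * Si (real n * ln (e / x)))))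
     \<longlonglongrightarrow> integral {a..b} (\<lambda>e. w' e * of_real (pi * sgn (e - x)))"
  proof (rule dominated_convergence(2)[where h = "\<lambda>e. norm (w' e) * (2 * B)"])
    show "(\<lambda>e. w' e * of_real (2 * Si (real n * ln (e / x)))) integrable_on {a..b}" for n
      using ab x by (intro integrable_continuous_real continuous_intros w'cont
          continuous_on_compose2[OF continuous_at_imp_continuous_on[of UNIV Si]]) (auto simp: isCont_Si)
    show "(\<lambda>e. norm (w' e) * (2 * B)) integrable_on {a..b}"
      by (intro integrable_continuous_real continuous_intros w'cont)
    show "norm (w' e * of_real (2 * Si (real n * ln (e / x)))) \<le> norm (w' e) * (2 * B)" for n e
      unfolding norm_mult using B[of "real n * ln (e / x)"] by (intro mult_left_mono) auto
    show "(\<lambda>n. w' e * of_real (2 * Si (real n * ln (e / x)))) \<longlonglongrightarrow> w' e * of_real (pi * sgn (e - x))" if "e \<in> {a..b}" for e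
    proof (rule tendsto_mult[OF tendsto_const tendsto_of_real])
      have e: "e > 0" using that ab by auto
      consider "e = x" | "e > x" | "e < x" by linarith
      then show "(\<lambda>n. 2 * Si (real n * ln (e / x))) \<longlonglongrightarrow> pi * sgn (e - x)"
      proof cases
        case 2
        then have "ln (e / x) > 0" using x by simp
        then have "filterlim (\<lambda>n. real n * ln (e / x)) at_top sequentially"
          by (intro filterlim_at_top_mult_tendsto_pos[OF tendsto_const _ filterlim_real_sequentially])
        then have "(\<lambda>n. Si (real n * ln (e / x))) \<longlonglongrightarrow> pi / 2" by (rule filterlim_compose[OF Si_at_top])
        then show ?thesis using tendsto_mult[OF tendsto_const[of 2]] 2 by fastforce
      next
        case 3
        then have "ln (x / e) > 0" using e by simp
        then have "filterlim (\<lambda>n. real n * ln (x / e)) at_top sequentially"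
          by (intro filterlim_at_top_mult_tendsto_pos[OF tendsto_const _ filterlim_real_sequentially])
        then have "(\<lambda>n. Si (real n * ln (x / e))) \<longlonglongrightarrow> pi / 2" by (rule filterlim_compose[OF Si_at_top])
        then have lim: "(\<lambda>n. - 2 * Si (real n * ln (x / e))) \<longlonglongrightarrow> - 2 * (pi / 2)" by (intro tendsto_mult tendsto_const)
        have eq: "- 2 * Si (real n * ln (x / e)) = 2 * Si (real n * ln (e / x))" for n
        proof -
          have "real n * ln (e / x) = - (real n * ln (x / e))" using e x by (simp add: ln_div algebra_simps)
          then show ?thesis using \<open>ln (x / e) > 0\<close> by (simp add: Si_neg)
        qed
        show ?thesis using lim 3 unfolding eq by simp
      qed (use x Si_neg[of 0] in simp)
    qed
  qed
  \<comment> \<open>Split at the jump of the sign. Each half contributes \<open>- pi * w x\<close>,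
    since \<open>w\<close> vanishes at the outer end.\<close>
  have "((\<lambda>e. w' e * of_real (pi * sgn (e - x))) has_integral (- pi * w x + - pi * w x)) {a..b}"
  proof (rule has_integral_combine[of _ x])
    have wab: "w a = 0" "w b = 0" using ab zero[of a 0] zero[of b 0] by (auto simp: w_def weighted_def)
    have "(w' has_integral (w x - w a)) {a..x}"
      using ab by (intro fundamental_theorem_of_calculus w_deriv) auto
    then have "((\<lambda>e. - pi * w' e) has_integral - pi * w x) {a..x}" 
      using has_integral_mult_right[of w' "w x" _ "- pi"] by (simp add: wab)
    then show "((\<lambda>e. w' e * of_real (pi * sgn (e - x))) has_integral - pi * w x) {a..x}"
      by (rule has_integral_spike_finite[of "{x}", rotated -1]) auto
    have "(w' has_integral (w b - w x)) {x..b}"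
      using ab by (intro fundamental_theorem_of_calculus w_deriv) auto
    then have "((\<lambda>e. pi * w' e) has_integral - pi * w x) {x..b}" 
      using has_integral_mult_right[of w' "- w x" _ "pi"] by (simp add: wab)
    then show "((\<lambda>e. w' e * of_real (pi * sgn (e - x))) has_integral - pi * w x) {x..b}"
      by (rule has_integral_spike_finite[of "{x}", rotated -1]) auto
  qed (use ab in auto)
  then have "integral {a..b} (\<lambda>e. w' e * of_real (pi * sgn (e - x))) = - (2 * pi * w x)"
    by (simp add: integral_unique)
  then have "(\<lambda>n. integral {- real n..real n} F) \<longlonglongrightarrow> 2 * pi * w x"
    using tendsto_minus[OF 2] integral_unique[OF trunc] by simp
  then have "integral\<^sup>L lborel F = 2 * pi * w x" using 1 LIMSEQ_unique by blast
  then show ?thesis using Fint x by (simp add: has_bochner_integral_iff F_def w_def weighted_def)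
qed

text \<open>Replace the test function by its inversion integral and apply Fubini: one order of
  integration gives the pairing, the other the product of the two transforms.\<close>

lemma mellin_parseval:
  assumes [measurable]: "W \<in> borel_measurable borel"
    and M: "\<And>t. has_bochner_integral lborel
       (\<lambda>x. indicator {0<..} x *\<^sub>R (complex_of_real (W x) * of_real x powr Complex (- \<sigma> - 1) t)) (M t)"
  shows "has_bochner_integral lborel (\<lambda>t. M t * power_moment (D 0) (Complex \<sigma> (- t)))
     (2 * pi * pairing (\<lambda>x. of_real (W x)) (D 0))"
proof -
  define h where "h = (\<lambda>t. power_moment (D 0) (Complex \<sigma> (- t)))"
  define f where "f = (\<lambda>x t. (indicator {0<..} x *\<^sub>R (complex_of_real (W x) * of_real x powr Complex (- \<sigma> - 1) t)) * h t)"
  have hint: "integrable lborel h" unfolding h_def by (rule moment_line_integrable)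
  then have [measurable]: "h \<in> borel_measurable borel" by auto
  \<comment> \<open>On a vertical line the modulus of \<open>x powr s\<close> is independent of t,
    so the norm of the double integrand is a product of a function of x and a function of t. This
    gives integrability on the product.\<close>
  have normf: "norm (f x t) = norm (indicator {0<..} x *\<^sub>R (complex_of_real (W x) * of_real x powr Complex (- \<sigma> - 1) 0)) * norm (h t)" for x t
    by (auto simp: f_def norm_mult norm_of_real_powr indicator_def)
  have fm: "case_prod f \<in> borel_measurable (lborel \<Otimes>\<^sub>M lborel)"
    unfolding f_def by measurable
  have int: "integrable (lborel \<Otimes>\<^sub>M lborel) (case_prod f)"
  proof (rule lborel_pair.Fubini_integrable)
    show "case_prod f \<in> borel_measurable (lborel \<Otimes>\<^sub>M lborel)" by (rule fm)
    show "integrable lborel (\<lambda>x. \<integral>t. norm (case (x, t) of (x, t) \<Rightarrow> f x t) \<partial>lborel)"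
      unfolding prod.case normf integral_mult_right_zero
      using M[of 0] by (intro integrable_mult_left integrable_norm) (auto simp: has_bochner_integral_iff)
    show "AE x in lborel. integrable lborel (\<lambda>t. case (x, t) of (x, t) \<Rightarrow> f x t)"
    proof (rule AE_I2)
      fix x
      show "integrable lborel (\<lambda>t. case (x, t) of (x, t) \<Rightarrow> f x t)"
      proof (rule Bochner_Integration.integrable_bound)
        show "integrable lborel (\<lambda>t. norm (indicator {0<..} x *\<^sub>R (complex_of_real (W x) * of_real x powr Complex (- \<sigma> - 1) 0)) * norm (h t))"
          using hint by simp
        show "(\<lambda>t. case (x, t) of (x, t) \<Rightarrow> f x t) \<in> borel_measurable lborel"
          using measurable_compose_Pair1[OF _ fm, of x] by simp
      qed (simp add: normf)
    qed
  qed
  have inner: "(\<integral>t. f x t \<partial>lborel) = indicator {0<..} x *\<^sub>R (2 * pi * (of_real (W x) * D 0 x))" for x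
  proof (cases "x > 0")
    case True
    have "(\<integral>t. f x t \<partial>lborel) = (\<integral>t. of_real (W x) * (of_real x powr Complex (- \<sigma> - 1) t * h t) \<partial>lborel)"
      using True by (simp add: f_def mult.assoc)
    also have "\<dots> = of_real (W x) * (2 * pi * D 0 x)"
      using mellin_inversion[OF True, of \<sigma>] by (simp add: has_bochner_integral_iff h_def)
    finally show ?thesis using True by simp
  qed (simp add: f_def)
  have "integrable lborel (\<lambda>x. \<integral>t. f x t \<partial>lborel)"
    using lborel_pair.integrable_fst'[OF int] by simp
  then have si: "set_integrable lborel {0<..} (\<lambda>x. 2 * pi * (of_real (W x) * D 0 x))"
    by (simp add: inner set_integrable_def)
  have "(\<integral>x. (\<integral>t. f x t \<partial>lborel) \<partial>lborel) = integral {0<..} (\<lambda>x. 2 * pi * (of_real (W x) * D 0 x))"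
    unfolding inner using set_borel_integral_eq_integral(2)[OF si] unfolding set_lebesgue_integral_def .
  also have "\<dots> = 2 * pi * pairing (\<lambda>x. of_real (W x)) (D 0)"
    unfolding pairing_def by simp
  finally have 1: "(\<integral>x. (\<integral>t. f x t \<partial>lborel) \<partial>lborel) = 2 * pi * pairing (\<lambda>x. of_real (W x)) (D 0)" .
  have 2: "(\<integral>x. f x t \<partial>lborel) = M t * h t" for t
    unfolding f_def integral_mult_left_zero using M[of t] by (simp add: has_bochner_integral_iff)
  have "integrable lborel (\<lambda>t. \<integral>x. f x t \<partial>lborel)"
    using lborel_pair.integrable_snd[OF int] by simp
  moreover have "(\<integral>t. (\<integral>x. f x t \<partial>lborel) \<partial>lborel) = (\<integral>x. (\<integral>t. f x t \<partial>lborel) \<partial>lborel)"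
    by (rule lborel_pair.Fubini_integral[OF int])
  ultimately show ?thesis unfolding 2 1 h_def by (simp add: has_bochner_integral_iff)
qed

end

section \<open>Shifting contours to a Lipschitz screen\<close>

lemma screen_path_lipschitz:
  assumes "C-lipschitz_on UNIV f"
  shows "(C + 1)-lipschitz_on S (screen_path f)"
proof (rule lipschitz_onI)
  have C: "C \<ge> 0" using assms by (rule lipschitz_on_nonneg)
  then show "0 \<le> C + 1" by simp
  fix s t
  have "dist (screen_path f s) (screen_path f t) \<le> \<bar>f s - f t\<bar> + \<bar>s - t\<bar>"
    using cmod_le[of "screen_path f s - screen_path f t"] by (simp add: dist_norm screen_path_def)
  also have "\<dots> \<le> C * \<bar>s - t\<bar> + \<bar>s - t\<bar>"
    using lipschitz_onD[OF assms, of s t] by (simp add: dist_real_def)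
  finally show "dist (screen_path f s) (screen_path f t) \<le> (C + 1) * dist s t"
    by (simp add: dist_real_def algebra_simps)
qed

lemma screen_path_has_vector_derivative:
  assumes "C-lipschitz_on UNIV f"
  obtains N where "negligible N"
    "\<And>t. t \<notin> N \<Longrightarrow> (screen_path f has_vector_derivative vector_derivative (screen_path f) (at t)) (at t)"
proof -
  obtain N where N: "negligible N" "\<And>x. x \<notin> N \<Longrightarrow> f differentiable (at x)"
    using lipschitz_differentiable_ae[OF assms] by blast
  have sp: "screen_path f = (\<lambda>t. of_real (f t) + \<i> * of_real t)"
    by (auto simp: screen_path_def Complex_eq)
  have "(screen_path f has_vector_derivative vector_derivative (screen_path f) (at t)) (at t)" if "t \<notin> N" for t
  proof -
    have "f differentiable (at t)" using N(2) that by blast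
    then obtain f' where f': "(f has_real_derivative f') (at t)"
      by (auto simp: real_differentiable_def)
    then have "(screen_path f has_vector_derivative (of_real f' + \<i> * of_real 1)) (at t)"
      unfolding sp
      by (intro has_vector_derivative_add has_vector_derivative_mult_right has_vector_derivative_of_real
          DERIV_ident)
    then show ?thesis by (simp add: vector_derivative_at)
  qed
  then show thesis using N that by blast
qed

text \<open>The composition of \<open>H\<close> with the screen path is Lipschitz, and by the chain
  rule its derivative is the screen integrand almost everywhere.\<close>

lemma screen_integrand_has_integral_primitive:
  assumes lip: "C-lipschitz_on UNIV f" and "a \<le> b" and B: "convex B" "open B"
    and H: "\<And>z. z \<in> B \<Longrightarrow> (H has_field_derivative F z) (at z)"
    and cont: "continuous_on B F" and path: "\<And>t. t \<in> {a..b} \<Longrightarrow> screen_path f t \<in> B"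
  shows "(screen_integrand f F has_integral (H (screen_path f b) - H (screen_path f a))) {a..b}"
proof -
  obtain N where N: "negligible N"
    "\<And>t. t \<notin> N \<Longrightarrow> (screen_path f has_vector_derivative vector_derivative (screen_path f) (at t)) (at t)"
    by (rule screen_path_has_vector_derivative[OF lip]) (rule that)
  \<comment> \<open>\<open>F\<close> need not be bounded on \<open>B\<close>. The hull of the arc is
    compact, so \<open>F\<close> is bounded on it, and convex, so this bound controls the increments
    of \<open>H\<close> between any two points of the arc.\<close>
  define K where "K = convex hull (screen_path f ` {a..b})"
  have "compact K"
    unfolding K_def by (intro compact_convex_hull compact_continuous_image
        lipschitz_on_continuous_on[OF screen_path_lipschitz[OF lip]]) auto
  have KB: "K \<subseteq> B" unfolding K_def using path B by (intro hull_minimal) auto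
  have "compact (F ` K)" using cont KB \<open>compact K\<close> by (intro compact_continuous_image) (auto intro: continuous_on_subset)
  then obtain M where M: "\<And>z. z \<in> K \<Longrightarrow> norm (F z) \<le> M"
    by (meson compact_imp_bounded bounded_iff image_eqI)
  have inK: "screen_path f t \<in> K" if "t \<in> {a..b}" for t
    unfolding K_def using that by (intro hull_inc) auto
  have "M \<ge> 0" using M[OF inK[of a]] \<open>a \<le> b\<close> norm_ge_zero[of "F (screen_path f a)"] by (simp, linarith)
  have HK: "norm (H w - H z) \<le> M * norm (w - z)" if "w \<in> K" "z \<in> K" for w z
    using that M by (intro field_differentiable_bound[of K]) 
      (auto simp: K_def convex_convex_hull intro: DERIV_subset[OF H] subsetD[OF KB[unfolded K_def]])
  have "(M * (C + 1))-lipschitz_on {a..b} (\<lambda>t. H (screen_path f t))"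
  proof (rule lipschitz_onI)
    show "0 \<le> M * (C + 1)" using \<open>M \<ge> 0\<close> lipschitz_on_nonneg[OF lip] by simp
    fix s t assume st: "s \<in> {a..b}" "t \<in> {a..b}"
    have "norm (H (screen_path f s) - H (screen_path f t)) \<le> M * norm (screen_path f s - screen_path f t)"
      using st by (intro HK inK)
    also have "\<dots> \<le> M * ((C + 1) * dist s t)"
      using lipschitz_onD[OF screen_path_lipschitz[OF lip, of UNIV], of s t] \<open>M \<ge> 0\<close>
      by (intro mult_left_mono) (auto simp: dist_norm)
    finally show "dist (H (screen_path f s)) (H (screen_path f t)) \<le> M * (C + 1) * dist s t"
      by (simp add: dist_norm mult.assoc)
  qed
  then show ?thesis
  proof (rule lipschitz_has_integral_derivative[OF _ \<open>a \<le> b\<close> N(1)])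
    fix t assume t: "t \<in> {a<..<b} - N"
    have "((H \<circ> screen_path f) has_vector_derivative vector_derivative (screen_path f) (at t) * F (screen_path f t)) (at t)"
      using t by (intro field_vector_diff_chain_at N(2) H path) auto
    then show "((\<lambda>t. H (screen_path f t)) has_vector_derivative screen_integrand f F t) (at t)"
      by (simp add: screen_integrand_def o_def mult.commute)
  qed
qed

text \<open>The residue theorem is applied in a larger open box, which leaves room around the
  boundary of the rectangle. Points of \<open>A\<close> in the box but outside the rectangle have
  winding number 0.\<close>

lemma rectangle_residues:
  assumes ab: "x1 < x2" "a < b" and S: "cbox (Complex x1 a) (Complex x2 b) \<subseteq> box p q"
    and holo: "F holomorphic_on box p q - A" and fin: "finite (A \<inter> box p q)"
    and bd: "\<And>z. z \<in> A \<Longrightarrow> z \<in> cbox (Complex x1 a) (Complex x2 b) \<Longrightarrow> z \<in> box (Complex x1 a) (Complex x2 b)"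
  shows "contour_integral (linepath (Complex x1 a) (Complex x2 a)) F + contour_integral (linepath (Complex x2 a) (Complex x2 b)) F
      - contour_integral (linepath (Complex x1 b) (Complex x2 b)) F - contour_integral (linepath (Complex x1 a) (Complex x1 b)) F
      = 2 * pi * \<i> * (\<Sum>\<omega>\<in>A \<inter> box (Complex x1 a) (Complex x2 b). residue F \<omega>)"
proof -
  define R where "R = rectpath (Complex x1 a) (Complex x2 b)"
  define X where "X = A \<inter> box p q"
  have im: "path_image R = cbox (Complex x1 a) (Complex x2 b) - box (Complex x1 a) (Complex x2 b)"
    unfolding R_def using ab by (intro path_image_rectpath_cbox_minus_box) auto
  then have imS: "path_image R \<subseteq> box p q - X" using S bd by (auto simp: X_def)
  have eqSX: "box p q - A = box p q - X" by (auto simp: X_def)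
  have "contour_integral R F = 2 * pi * \<i> * (\<Sum>\<omega>\<in>X. winding_number R \<omega> * residue F \<omega>)"
  proof (rule Residue_theorem[of "box p q"])
    show "connected (box p q)" by (intro convex_connected convex_box)
    show "\<forall>z. z \<notin> box p q \<longrightarrow> winding_number R z = 0"
      unfolding R_def using S ab by (intro allI impI winding_number_rectpath_outside) auto
  qed (use fin holo imS eqSX in \<open>auto simp: X_def R_def\<close>)
  also have "(\<Sum>\<omega>\<in>X. winding_number R \<omega> * residue F \<omega>) = (\<Sum>\<omega>\<in>A \<inter> box (Complex x1 a) (Complex x2 b). residue F \<omega>)"
  proof (rule sum.mono_neutral_cong_right)
    show "finite X" using fin by (simp add: X_def)
    show "A \<inter> box (Complex x1 a) (Complex x2 b) \<subseteq> X"
      using S box_subset_cbox[of "Complex x1 a" "Complex x2 b"] by (auto simp: X_def)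
    show "\<forall>\<omega>\<in>X - A \<inter> box (Complex x1 a) (Complex x2 b). winding_number R \<omega> * residue F \<omega> = 0"
    proof
      fix \<omega> assume "\<omega> \<in> X - A \<inter> box (Complex x1 a) (Complex x2 b)"
      then have "\<omega> \<notin> cbox (Complex x1 a) (Complex x2 b)" using bd by (auto simp: X_def)
      then have "winding_number R \<omega> = 0"
        unfolding R_def using ab by (intro winding_number_rectpath_outside) auto
      then show "winding_number R \<omega> * residue F \<omega> = 0" by simp
    qed
    show "winding_number R \<omega> * residue F \<omega> = residue F \<omega>" if "\<omega> \<in> A \<inter> box (Complex x1 a) (Complex x2 b)" for \<omega>
      using that by (simp add: R_def winding_number_rectpath)
  qed
  also have "contour_integral R F = contour_integral (linepath (Complex x1 a) (Complex x2 a)) F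
      + (contour_integral (linepath (Complex x2 a) (Complex x2 b)) F
      + (contour_integral (linepath (Complex x2 b) (Complex x1 b)) F + contour_integral (linepath (Complex x1 b) (Complex x1 a)) F))"
  proof -
    have cont: "continuous_on (path_image R) F"
      using holo imS eqSX by (metis holomorphic_on_imp_continuous_on continuous_on_subset)
    have parts: "path_image R = closed_segment (Complex x1 a) (Complex x2 a) \<union> (closed_segment (Complex x2 a) (Complex x2 b)
        \<union> (closed_segment (Complex x2 b) (Complex x1 b) \<union> closed_segment (Complex x1 b) (Complex x1 a)))"
      by (simp add: R_def rectpath_def Let_def path_image_join)
    have ci: "F contour_integrable_on linepath (Complex x1 a) (Complex x2 a)"
      "F contour_integrable_on linepath (Complex x2 a) (Complex x2 b)"
      "F contour_integrable_on linepath (Complex x2 b) (Complex x1 b)"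
      "F contour_integrable_on linepath (Complex x1 b) (Complex x1 a)"
      by (intro contour_integrable_continuous_linepath continuous_on_subset[OF cont]; auto simp: parts)+
    then show ?thesis by (simp add: R_def rectpath_def Let_def contour_integrable_join)
  qed
  also have "contour_integral (linepath (Complex x2 b) (Complex x1 b)) F = - contour_integral (linepath (Complex x1 b) (Complex x2 b)) F"
    using contour_integral_reversepath[OF valid_path_linepath, of "Complex x1 b" "Complex x2 b" F] by simp
  also have "contour_integral (linepath (Complex x1 b) (Complex x1 a)) F = - contour_integral (linepath (Complex x1 a) (Complex x1 b)) F"
    using contour_integral_reversepath[OF valid_path_linepath, of "Complex x1 a" "Complex x1 b" F] by simp
  finally show ?thesis by (simp add: algebra_simps)
qed

section \<open>Residue identity for horizontal slabs\<close>

lemma cbox_Complex: "z \<in> cbox (Complex a b) (Complex c d) \<longleftrightarrow> a \<le> Re z \<and> Re z \<le> c \<and> b \<le> Im z \<and> Im z \<le> d"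
  by (auto simp: in_cbox_complex_iff)

lemma box_Complex: "z \<in> box (Complex a b) (Complex c d) \<longleftrightarrow> a < Re z \<and> Re z < c \<and> b < Im z \<and> Im z < d"
  by (auto simp: in_box_complex_iff)

lemma closed_segment_horizontal:
  "z \<in> closed_segment (Complex x1 y) (Complex x2 y) \<longleftrightarrow> Im z = y \<and> min x1 x2 \<le> Re z \<and> Re z \<le> max x1 x2"
  by (auto simp: closed_segment_same_Im closed_segment_eq_real_ivl min_def max_def)

lemma closed_segment_vertical:
  "z \<in> closed_segment (Complex x y1) (Complex x y2) \<longleftrightarrow> Re z = x \<and> min y1 y2 \<le> Im z \<and> Im z \<le> max y1 y2"
  by (auto simp: closed_segment_same_Re closed_segment_eq_real_ivl min_def max_def)

text \<open>The integrand is holomorphic on \<open>N\<close> off the discrete set \<open>A\<close>.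
  The domain covers the region between the screen and the line Re = \<open>c\<close> on whichever
  side the screen runs; the margin up to \<open>c'\<close> lets a rectangle with its right side on
  the line fit into an open box.\<close>

locale contour_shift =
  fixes f :: "real \<Rightarrow> real" and C :: real and F :: "complex \<Rightarrow> complex" and N A :: "complex set" and c c' :: real
  assumes lip: "C-lipschitz_on UNIV f" and open_N: "open N" and holo: "F holomorphic_on N - A"
    and locally_finite: "\<And>z. z \<in> N \<Longrightarrow> \<exists>e>0. ball z e \<subseteq> N \<and> ball z e \<inter> A \<subseteq> {z}"
    and c: "c < c'"
    and right_of_screen: "\<And>z. f (Im z) \<le> Re z \<Longrightarrow> Re z \<le> c' \<Longrightarrow> z \<in> N"
    and left_of_screen: "\<And>z. c \<le> Re z \<Longrightarrow> Re z \<le> f (Im z) \<Longrightarrow> z \<in> N"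
    and A_left: "\<And>z. z \<in> A \<Longrightarrow> Re z < c"
    and A_screen: "\<And>t. screen_path f t \<notin> A"
begin

text \<open>At such a height the horizontal segment joining screen and line meets no point of
  \<open>A\<close>; points strictly left of the screen are harmless.\<close>

definition admissible :: "real \<Rightarrow> bool" where
  "admissible y \<longleftrightarrow> (\<forall>\<omega>\<in>A. Im \<omega> = y \<longrightarrow> Re \<omega> < f y)"

text \<open>No right-hand bound is imposed because \<open>A\<close> lies left of \<open>c\<close>
  anyway. For the same reason nothing is enclosed at heights where the screen is right of the
  line.\<close>

definition enclosed :: "real \<Rightarrow> real \<Rightarrow> complex set" where
  "enclosed a b = {\<omega> \<in> A. a < Im \<omega> \<and> Im \<omega> < b \<and> f (Im \<omega>) \<le> Re \<omega>}"

abbreviation horizontal :: "real \<Rightarrow> real \<Rightarrow> real \<Rightarrow> complex" where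
  "horizontal y x1 x2 \<equiv> contour_integral (linepath (Complex x1 y) (Complex x2 y)) F"

abbreviation vertical :: "real \<Rightarrow> real \<Rightarrow> real \<Rightarrow> complex" where
  "vertical x y1 y2 \<equiv> contour_integral (linepath (Complex x y1) (Complex x y2)) F"

text \<open>The boundary is traversed from the screen to the line at height \<open>a\<close>, up the
  line, back at height \<open>b\<close> and down the screen. Finiteness and integrability are
  recorded because otherwise the sum or the integral could be a default 0.\<close>

definition slab :: "real \<Rightarrow> real \<Rightarrow> bool" where
  "slab a b \<longleftrightarrow> finite (enclosed a b) \<and> screen_integrand f F integrable_on {a..b} \<and>
     horizontal a (f a) c + vertical c a b - horizontal b (f b) c - integral {a..b} (screen_integrand f F)
       = 2 * pi * \<i> * (\<Sum>\<omega>\<in>enclosed a b. residue F \<omega>)"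

text \<open>The height \<open>x\<close> itself may be that of a singularity, so admissibility is
  claimed only on the punctured neighbourhood, while slabs may reach across
  \<open>x\<close>.\<close>

definition locally_slab :: "real \<Rightarrow> bool" where
  "locally_slab x \<longleftrightarrow> (\<exists>d>0. (\<forall>y. \<bar>y - x\<bar> < d \<and> y \<noteq> x \<longrightarrow> admissible y) \<and>
     (\<forall>a b. x - d < a \<and> a \<le> b \<and> b < x + d \<and> admissible a \<and> admissible b \<longrightarrow> slab a b))"

lemma f_lip: "\<bar>f s - f t\<bar> \<le> C * \<bar>s - t\<bar>"
  using lipschitz_onD[OF lip, of s t] by (simp add: dist_real_def)

lemma C_nonneg: "C \<ge> 0" using lip by (rule lipschitz_on_nonneg)

lemma open_regular: "open (N - A)"
proof (rule openI)
  fix z assume z: "z \<in> N - A"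
  then obtain e where e: "e > 0" "ball z e \<subseteq> N" "ball z e \<inter> A \<subseteq> {z}" using locally_finite by blast
  then have "ball z e \<subseteq> N - A" using z by blast
  then show "\<exists>e>0. ball z e \<subseteq> N - A" using e by blast
qed

lemma finite_compact:
  assumes "compact K" "K \<subseteq> N"
  shows "finite (A \<inter> K)"
proof (rule ccontr)
  assume "infinite (A \<inter> K)"
  then obtain l where l: "l \<in> K" "l islimpt (A \<inter> K)"
    using assms(1) unfolding compact_eq_Bolzano_Weierstrass by (meson inf_le2)
  obtain e where e: "e > 0" "ball l e \<inter> A \<subseteq> {l}" using locally_finite l assms by blast
  have "infinite (ball l e \<inter> (A \<inter> K))" using l e by (simp add: islimpt_eq_infinite_ball Int_commute)
  then show False using e(2) by (meson finite.emptyI finite_insert finite_subset inf_mono inf_le1 order_trans order_refl)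
qed

lemma F_continuous: "S \<subseteq> N - A \<Longrightarrow> continuous_on S F"
  using holo holomorphic_on_imp_continuous_on continuous_on_subset by blast

lemma primitive:
  assumes "convex B" "open B" "B \<subseteq> N - A"
  obtains H where "\<And>z. z \<in> B \<Longrightarrow> (H has_field_derivative F z) (at z)"
proof -
  obtain H where "\<And>z. z \<in> B \<Longrightarrow> (H has_field_derivative F z) (at z within B)"
    using holomorphic_convex_primitive'[OF assms(1,2) holomorphic_on_subset[OF holo assms(3)]] by blast
  then show thesis using that assms(2) by (metis at_within_open)
qed

lemma contour_integral_linepath_primitive:
  assumes "convex B" "\<And>z. z \<in> B \<Longrightarrow> (H has_field_derivative F z) (at z)" "w \<in> B" "z \<in> B"
  shows "contour_integral (linepath w z) F = H z - H w"
proof -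
  have "(F has_contour_integral (H (pathfinish (linepath w z)) - H (pathstart (linepath w z)))) (linepath w z)"
    by (rule contour_integral_primitive[where S = B])
       (use assms closed_segment_subset[of w B z] in \<open>auto intro: has_field_derivative_at_within\<close>)
  then show ?thesis by (simp add: contour_integral_unique)
qed

text \<open>In a convex region free of singularities every term is an increment of one primitive,
  and the increments around the closed boundary cancel.\<close>

lemma local_primitive:
  assumes B: "convex B" "open B" "B \<subseteq> N - A" and "a \<le> b" and path: "\<And>t. t \<in> {a..b} \<Longrightarrow> screen_path f t \<in> B"
    and "Complex x a \<in> B" "Complex x b \<in> B"
  shows "screen_integrand f F integrable_on {a..b}"
    and "horizontal a (f a) x + vertical x a b - horizontal b (f b) x - integral {a..b} (screen_integrand f F) = 0"
proof -
  obtain H where H: "\<And>z. z \<in> B \<Longrightarrow> (H has_field_derivative F z) (at z)" using primitive[OF B] by blast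
  have I: "(screen_integrand f F has_integral (H (Complex (f b) b) - H (Complex (f a) a))) {a..b}"
    using screen_integrand_has_integral_primitive[OF lip \<open>a \<le> b\<close> B(1,2) H F_continuous[OF B(3)] path]
    by (simp add: screen_path_def)
  then show "screen_integrand f F integrable_on {a..b}" by blast
  have fab: "Complex (f a) a \<in> B" "Complex (f b) b \<in> B" 
    using path[of a] path[of b] \<open>a \<le> b\<close> by (auto simp: screen_path_def)
  show "horizontal a (f a) x + vertical x a b - horizontal b (f b) x - integral {a..b} (screen_integrand f F) = 0"
    unfolding integral_unique[OF I] using assms(6,7) fab
    by (simp add: contour_integral_linepath_primitive[OF B(1) H])
qed

text \<open>With the screen on or to the right of the line, the segment between them avoids
  \<open>A\<close>. By compactness a convex box around it also does, so there is a primitive and no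
  residue appears.\<close>

lemma slab_local_left:
  assumes "c \<le> f x"
  shows "locally_slab x"
proof -
  define K where "K = closed_segment (Complex c x) (Complex (f x) x)"
  have "K \<subseteq> N - A"
  proof
    fix z assume "z \<in> K"
    then have "Im z = x" "c \<le> Re z" "Re z \<le> f x" using assms by (auto simp: K_def closed_segment_horizontal)
    then show "z \<in> N - A" using left_of_screen[of z] A_left[of z] by auto
  qed
  then obtain e where e: "e > 0" "(\<Union>z\<in>K. ball z e) \<subseteq> N - A"
    using compact_subset_open_imp_ball_epsilon_subset[of K "N - A"] open_regular by (auto simp: K_def)
  define B where "B = box (Complex (c - e / 2) (x - e / 2)) (Complex (f x + e / 2) (x + e / 2))"
  have B: "convex B" "open B" by (auto simp: B_def)
  have BN: "B \<subseteq> N - A"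
  proof
    fix z assume z: "z \<in> B"
    \<comment> \<open>The real part of \<open>z\<close> is clamped to the segment, giving a nearby
      point of \<open>K\<close>.\<close>
    define w where "w = Complex (max c (min (f x) (Re z))) x"
    have "w \<in> K" using assms by (auto simp: w_def K_def closed_segment_horizontal)
    moreover have "norm (w - z) < e"
      using cmod_le[of "w - z"] z assms by (auto simp: w_def B_def box_Complex)
    then have "z \<in> ball w e" by (simp add: dist_norm)
    ultimately show "z \<in> N - A" using e(2) by blast
  qed
  \<comment> \<open>The second term makes the Lipschitz bound on the variation of \<open>f\<close>
    smaller than \<open>e / 2\<close>, so the arc stays in \<open>B\<close>.\<close>
  define d where "d = min (e / 2) (e / (2 * (C + 1)))"
  have "d > 0" using e C_nonneg by (simp add: d_def)
  have fd: "f x - e / 2 < f y" "f y < f x + e / 2" if "\<bar>y - x\<bar> < d" for y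
  proof -
    have "C * \<bar>y - x\<bar> \<le> C * d" using that C_nonneg by (intro mult_left_mono) auto
    also have "C * d \<le> C * (e / (2 * (C + 1)))" using C_nonneg by (intro mult_left_mono) (auto simp: d_def)
    also have "\<dots> < e / 2" using C_nonneg e by (simp add: field_simps)
    finally have "\<bar>f y - f x\<bar> < e / 2" using f_lip[of y x] by linarith
    then show "f x - e / 2 < f y" "f y < f x + e / 2" unfolding abs_less_iff by linarith+
  qed
  have notA: "\<omega> \<notin> A" if "\<bar>Im \<omega> - x\<bar> < d" "f (Im \<omega>) \<le> Re \<omega>" for \<omega>
  proof
    assume "\<omega> \<in> A"
    have "Re \<omega> < c" using A_left \<open>\<omega> \<in> A\<close> by blast
    moreover have "d \<le> e / 2" unfolding d_def by (rule min.cobounded1)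
    ultimately have "\<omega> \<in> B" using that fd[OF that(1)] assms e by (auto simp: B_def box_Complex abs_less_iff)
    then show False using BN \<open>\<omega> \<in> A\<close> by blast
  qed
  have "d \<le> e / 2" unfolding d_def by (rule min.cobounded1)
  show ?thesis
    unfolding locally_slab_def
  proof (intro exI[of _ d] conjI allI impI)
    show "d > 0" by fact
    show "admissible y" if "\<bar>y - x\<bar> < d \<and> y \<noteq> x" for y
      unfolding admissible_def using notA that by force
    fix a b assume ab: "x - d < a \<and> a \<le> b \<and> b < x + d \<and> admissible a \<and> admissible b"
    have "enclosed a b = {}" using notA ab by (force simp: enclosed_def abs_less_iff)
    moreover have "screen_path f t \<in> B" if "t \<in> {a..b}" for t
    proof -
      have "\<bar>t - x\<bar> < d" using that ab by (auto simp: abs_less_iff)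
      then show ?thesis using fd[of t] \<open>d \<le> e / 2\<close> assms by (auto simp: B_def box_Complex screen_path_def abs_less_iff)
    qed
    moreover have "Complex c a \<in> B" "Complex c b \<in> B"
      using ab \<open>d \<le> e / 2\<close> assms e by (auto simp: B_def box_Complex)
    ultimately show "slab a b" unfolding slab_def using local_primitive[OF B BN, of a b c] ab by simp
  qed
qed

text \<open>An auxiliary vertical line at \<open>x\<^sub>m\<close>, just right of the screen, splits
  the slab. Left of it a primitive in a small box handles the Lipschitz arc; right of it an honest
  rectangle collects the residues. The two integrals over the auxiliary line cancel.\<close>

lemma slab_local_right:
  assumes "f x < c"
  shows "locally_slab x"
proof -
  have "screen_path f x \<in> N - A"
    using right_of_screen[of "screen_path f x"] assms c A_screen by (auto simp: screen_path_def)
  then obtain r where r: "r > 0" "ball (screen_path f x) r \<subseteq> N - A" using open_regular by (meson openE)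
  \<comment> \<open>The first term puts the box \<open>B\<close> of half-width
    \<open>\<delta>\<close> inside the ball of radius \<open>r\<close>; the second keeps
    \<open>x\<^sub>m\<close> left of \<open>c\<close>.\<close>
  define \<delta> where "\<delta> = min (r / 2) ((c - f x) / 2)"
  have "\<delta> \<le> (c - f x) / 2" unfolding \<delta>_def by (rule min.cobounded2)
  then have \<delta>: "\<delta> > 0" "\<delta> \<le> r / 2" "\<delta> < c - f x" using r assms by (auto simp: \<delta>_def)
  define B where "B = box (Complex (f x - \<delta>) (x - \<delta>)) (Complex (f x + \<delta>) (x + \<delta>))"
  have B: "convex B" "open B" by (auto simp: B_def)
  have BN: "B \<subseteq> N - A"
  proof
    fix z assume z: "z \<in> B"
    have "norm (screen_path f x - z) < r"
      using cmod_le[of "screen_path f x - z"] z \<delta> by (auto simp: screen_path_def B_def box_Complex)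
    then show "z \<in> N - A" using r(2) by (auto simp: dist_norm)
  qed
  define x\<^sub>m where "x\<^sub>m = f x + \<delta> / 2"
  \<comment> \<open>This confines the arc to within \<open>\<delta> / 4\<close> of
    \<open>f x\<close> horizontally, hence strictly left of
    \<open>x\<^sub>m = f x + \<delta> / 2\<close>.\<close>
  define d1 where "d1 = min (\<delta> / 2) (\<delta> / (4 * (C + 1)))"
  have "d1 > 0" using \<delta> C_nonneg by (simp add: d1_def)
  have fd: "f x - \<delta> / 4 \<le> f y" "f y \<le> f x + \<delta> / 4" if "\<bar>y - x\<bar> \<le> d1" for y
  proof -
    have "C * \<bar>y - x\<bar> \<le> C * d1" using that C_nonneg by (intro mult_left_mono) auto
    also have "C * d1 \<le> C * (\<delta> / (4 * (C + 1)))" using C_nonneg by (intro mult_left_mono) (auto simp: d1_def)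
    also have "\<dots> \<le> \<delta> / 4" using C_nonneg \<delta> by (simp add: field_simps)
    finally have "\<bar>f y - f x\<bar> \<le> \<delta> / 4" using f_lip[of y x] by linarith
    then show "f x - \<delta> / 4 \<le> f y" "f y \<le> f x + \<delta> / 4" unfolding abs_le_iff by linarith+
  qed
  define K where "K = cbox (Complex (f x + \<delta> / 4) (x - d1)) (Complex c' (x + d1))"
  have KN: "K \<subseteq> N"
  proof
    fix z assume z: "z \<in> K"
    then have "\<bar>Im z - x\<bar> \<le> d1" by (auto simp: K_def cbox_Complex abs_le_iff)
    then show "z \<in> N" using fd[of "Im z"] z right_of_screen[of z] by (auto simp: K_def cbox_Complex)
  qed
  have finK: "finite (A \<inter> K)" by (rule finite_compact[OF _ KN]) (simp add: K_def)
  \<comment> \<open>Only finitely many singularities lie in the compact \<open>K\<close>, so the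
    heights other than \<open>x\<close> that they occupy keep a positive distance from
    \<open>x\<close>; \<open>d1\<close> serves when there are none.\<close>
  obtain d where d: "0 < d" "d \<le> d1" "\<And>\<omega>. \<omega> \<in> A \<inter> K \<Longrightarrow> Im \<omega> \<noteq> x \<Longrightarrow> d \<le> \<bar>Im \<omega> - x\<bar>"
  proof -
    define Y where "Y = insert d1 ((\<lambda>\<omega>. \<bar>Im \<omega> - x\<bar>) ` {\<omega> \<in> A \<inter> K. Im \<omega> \<noteq> x})"
    have "finite {\<omega> \<in> A \<inter> K. Im \<omega> \<noteq> x}" by (rule finite_subset[OF _ finK]) auto
    then have "finite Y" "Y \<noteq> {}" by (auto simp only: Y_def finite_insert finite_imageI)
    then have "Min Y \<in> Y" "\<And>y. y \<in> Y \<Longrightarrow> Min Y \<le> y" by (auto intro: Min_in)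
    then show thesis using \<open>d1 > 0\<close> by (intro that[of "Min Y"]) (auto simp: Y_def)
  qed
  have d1\<delta>: "d1 \<le> \<delta> / 2" unfolding d1_def by (rule min.cobounded1)
  \<comment> \<open>A singularity right of the screen near height \<open>x\<close> is not in
    \<open>B\<close>, and it is not left of \<open>B\<close> either, so it lies beyond the right
    edge of \<open>B\<close>, past \<open>x\<^sub>m\<close>.\<close>
  have AK: "\<omega> \<in> K \<and> x\<^sub>m < Re \<omega>" if "\<omega> \<in> A" "\<bar>Im \<omega> - x\<bar> < d1" "f (Im \<omega>) \<le> Re \<omega>" for \<omega>
  proof -
    have "Re \<omega> < c" using A_left that by blast
    have "f x - \<delta> / 4 \<le> Re \<omega>" using fd(1)[of "Im \<omega>"] that by linarith
    moreover have "\<omega> \<notin> B" using BN that by blast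
    ultimately have "f x + \<delta> \<le> Re \<omega>" using that(2) d1\<delta> \<delta> by (auto simp: B_def box_Complex abs_less_iff)
    then show ?thesis using \<open>Re \<omega> < c\<close> c that(2) \<delta> by (auto simp: K_def cbox_Complex x\<^sub>m_def abs_less_iff)
  qed
  show ?thesis
    unfolding locally_slab_def
  proof (intro exI[of _ d] conjI allI impI)
    show "d > 0" by fact
    show "admissible y" if y: "\<bar>y - x\<bar> < d \<and> y \<noteq> x" for y
      unfolding admissible_def
    proof (intro ballI impI, rule ccontr)
      fix \<omega> assume w: "\<omega> \<in> A" "Im \<omega> = y" "\<not> Re \<omega> < f y"
      then have "\<omega> \<in> K" using AK[of \<omega>] y d by auto
      then show False using d(3)[of \<omega>] w y by auto
    qed
    fix a b assume ab: "x - d < a \<and> a \<le> b \<and> b < x + d \<and> admissible a \<and> admissible b"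
    show "slab a b"
    proof (cases "a = b")
      case True
      then have "enclosed a b = {}" by (auto simp: enclosed_def)
      then show ?thesis using True integrable_on_refl[of _ b] by (simp add: slab_def)
    next
      case False
      then have "a < b" using ab by simp
      have near: "\<bar>t - x\<bar> < d" if "t \<in> {a..b}" for t using that ab by (auto simp: abs_less_iff)
      have ft: "f x - \<delta> / 4 \<le> f t" "f t \<le> f x + \<delta> / 4" if "t \<in> {a..b}" for t
        using fd[of t] near[OF that] d(2) by linarith+
      have pathB: "screen_path f t \<in> B" if "t \<in> {a..b}" for t
        using ft[OF that] near[OF that] d d1\<delta> \<delta> by (auto simp: B_def box_Complex screen_path_def abs_less_iff)
      have mB: "Complex x\<^sub>m t \<in> B" if "t \<in> {a..b}" for t
        using near[OF that] d d1\<delta> \<delta> by (auto simp: B_def box_Complex x\<^sub>m_def abs_less_iff)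
      have lp: "screen_integrand f F integrable_on {a..b}"
        "horizontal a (f a) x\<^sub>m + vertical x\<^sub>m a b - horizontal b (f b) x\<^sub>m - integral {a..b} (screen_integrand f F) = 0"
        using local_primitive[OF B BN, of a b x\<^sub>m] pathB mB \<open>a < b\<close> by auto
      have fm: "f t < x\<^sub>m" "x\<^sub>m < c" if "t \<in> {a..b}" for t
        using ft[OF that] \<delta> by (auto simp: x\<^sub>m_def)
      have split: "horizontal t (f t) c = horizontal t (f t) x\<^sub>m + horizontal t x\<^sub>m c"
        if t: "t \<in> {a..b}" "admissible t" for t
      proof (rule contour_integral_split_linepath)
        show "continuous_on (closed_segment (Complex (f t) t) (Complex c t)) F"
        proof (rule F_continuous, rule subsetI)
          fix z assume "z \<in> closed_segment (Complex (f t) t) (Complex c t)"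
          then have "Im z = t" "f t \<le> Re z" "Re z \<le> c" using fm[OF t(1)] by (auto simp: closed_segment_horizontal)
          then show "z \<in> N - A" using right_of_screen[of z] c t(2) by (auto simp: admissible_def)
        qed
        show "Complex x\<^sub>m t \<in> closed_segment (Complex (f t) t) (Complex c t)"
          using fm[OF t(1)] by (auto simp: closed_segment_horizontal)
      qed
      define S where "S = box (Complex (f x + \<delta> / 4) (x - d1)) (Complex c' (x + d1))"
      have SK: "S \<subseteq> K" unfolding S_def K_def by (rule box_subset_cbox)
      have xm: "x\<^sub>m < c" using fm[of a] \<open>a < b\<close> by simp
      have rect: "horizontal a x\<^sub>m c + vertical c a b - horizontal b x\<^sub>m c - vertical x\<^sub>m a b
          = 2 * pi * \<i> * (\<Sum>\<omega>\<in>A \<inter> box (Complex x\<^sub>m a) (Complex c b). residue F \<omega>)"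
      proof (rule rectangle_residues[OF xm \<open>a < b\<close>])
        show "cbox (Complex x\<^sub>m a) (Complex c b) \<subseteq> box (Complex (f x + \<delta> / 4) (x - d1)) (Complex c' (x + d1))"
          using ab d c \<delta> \<open>a < b\<close> by (auto simp: cbox_Complex box_Complex x\<^sub>m_def)
        show "F holomorphic_on box (Complex (f x + \<delta> / 4) (x - d1)) (Complex c' (x + d1)) - A"
          using holo SK KN by (auto simp: S_def intro: holomorphic_on_subset)
        show "finite (A \<inter> box (Complex (f x + \<delta> / 4) (x - d1)) (Complex c' (x + d1)))"
          by (rule finite_subset[OF _ finK]) (use SK in \<open>auto simp: S_def\<close>)
        show "z \<in> box (Complex x\<^sub>m a) (Complex c b)" if z: "z \<in> A" "z \<in> cbox (Complex x\<^sub>m a) (Complex c b)" for z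
        proof -
          have t: "Im z \<in> {a..b}" "x\<^sub>m \<le> Re z" using z by (auto simp: cbox_Complex)
          have "Im z \<noteq> a" "Im z \<noteq> b" using fm[OF t(1)] t(2) ab z(1) by (force simp: admissible_def)+
          moreover have "Re z \<noteq> x\<^sub>m"
          proof
            assume "Re z = x\<^sub>m"
            then have "z = Complex x\<^sub>m (Im z)" by (simp add: complex_eq_iff)
            then show False using mB[OF t(1)] BN z(1) by (metis Diff_iff subsetD)
          qed
          ultimately show ?thesis using A_left[OF z(1)] z(2) by (auto simp: cbox_Complex box_Complex)
        qed
      qed
      have enc: "A \<inter> box (Complex x\<^sub>m a) (Complex c b) = enclosed a b"
      proof (intro set_eqI iffI)
        fix \<omega> assume "\<omega> \<in> A \<inter> box (Complex x\<^sub>m a) (Complex c b)"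
        then show "\<omega> \<in> enclosed a b" using fm[of "Im \<omega>"] by (auto simp: enclosed_def box_Complex)
      next
        fix \<omega> assume w: "\<omega> \<in> enclosed a b"
        then have "x\<^sub>m < Re \<omega>" using AK[of \<omega>] near[of "Im \<omega>"] d by (auto simp: enclosed_def)
        then show "\<omega> \<in> A \<inter> box (Complex x\<^sub>m a) (Complex c b)"
          using w A_left[of \<omega>] by (auto simp: enclosed_def box_Complex)
      qed
      have "finite (enclosed a b)"
        unfolding enc[symmetric] using \<open>a < b\<close> ab d \<delta> c
        by (intro finite_subset[OF _ finK]) (auto simp: K_def cbox_Complex box_Complex x\<^sub>m_def)
      moreover have "horizontal a (f a) c + vertical c a b - horizontal b (f b) c - integral {a..b} (screen_integrand f F)
         = 2 * pi * \<i> * (\<Sum>\<omega>\<in>enclosed a b. residue F \<omega>)"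
      proof -
        have "horizontal a (f a) c = horizontal a (f a) x\<^sub>m + horizontal a x\<^sub>m c"
          "horizontal b (f b) c = horizontal b (f b) x\<^sub>m + horizontal b x\<^sub>m c"
          using split[of a] split[of b] ab by auto
        then have "horizontal a (f a) c + vertical c a b - horizontal b (f b) c - integral {a..b} (screen_integrand f F)
            = (horizontal a (f a) x\<^sub>m + vertical x\<^sub>m a b - horizontal b (f b) x\<^sub>m - integral {a..b} (screen_integrand f F))
            + (horizontal a x\<^sub>m c + vertical c a b - horizontal b x\<^sub>m c - vertical x\<^sub>m a b)"
          by simp
        then show ?thesis unfolding lp(2) rect enc by simp
      qed
      ultimately show ?thesis using lp(1) by (simp add: slab_def)
    qed
  qed
qed

lemma slab_local:
  obtains d where "d > 0" "\<And>y. \<bar>y - x\<bar> < d \<Longrightarrow> y \<noteq> x \<Longrightarrow> admissible y"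
     "\<And>a b. x - d < a \<Longrightarrow> a \<le> b \<Longrightarrow> b < x + d \<Longrightarrow> admissible a \<Longrightarrow> admissible b \<Longrightarrow> slab a b"
  using slab_local_left[of x] slab_local_right[of x] that
  unfolding locally_slab_def by (cases "c \<le> f x") (auto simp: not_le)

text \<open>The two integrals at height \<open>b\<close> cancel. No enclosed singularity sits at
  that height because it is admissible, so the residues of the two slabs are exactly those of the
  union.\<close>

lemma slab_trans:
  assumes "slab a b" "slab b e" "a \<le> b" "b \<le> e" "admissible b"
  shows "slab a e"
proof -
  have eq: "enclosed a e = enclosed a b \<union> enclosed b e"
  proof (intro set_eqI iffI)
    fix \<omega> assume w: "\<omega> \<in> enclosed a e"
    then have "Im \<omega> \<noteq> b" using assms(5) by (auto simp: enclosed_def admissible_def)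
    then show "\<omega> \<in> enclosed a b \<union> enclosed b e" using w by (auto simp: enclosed_def)
  qed (use assms(3,4) in \<open>auto simp: enclosed_def\<close>)
  have fin: "finite (enclosed a b)" "finite (enclosed b e)" using assms by (auto simp: slab_def)
  have disj: "enclosed a b \<inter> enclosed b e = {}" by (auto simp: enclosed_def)
  have sum: "(\<Sum>\<omega>\<in>enclosed a e. residue F \<omega>) = (\<Sum>\<omega>\<in>enclosed a b. residue F \<omega>) + (\<Sum>\<omega>\<in>enclosed b e. residue F \<omega>)"
    unfolding eq by (rule sum.union_disjoint[OF fin disj])
  have int: "screen_integrand f F integrable_on {a..e}"
    using assms by (intro Henstock_Kurzweil_Integration.integrable_combine[of a b e]) (auto simp: slab_def)
  have I: "integral {a..b} (screen_integrand f F) + integral {b..e} (screen_integrand f F) = integral {a..e} (screen_integrand f F)"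
    using assms int by (intro Henstock_Kurzweil_Integration.integral_combine)
  have V: "vertical c a e = vertical c a b + vertical c b e"
  proof (rule contour_integral_split_linepath)
    show "continuous_on (closed_segment (Complex c a) (Complex c e)) F"
    proof (rule F_continuous, rule subsetI)
      fix z assume "z \<in> closed_segment (Complex c a) (Complex c e)"
      then have "Re z = c" by (auto simp: closed_segment_vertical)
      then show "z \<in> N - A" using left_of_screen[of z] right_of_screen[of z] c A_left[of z] by fastforce
    qed
    show "Complex c b \<in> closed_segment (Complex c a) (Complex c e)"
      using assms by (auto simp: closed_segment_vertical)
  qed
  have "horizontal a (f a) c + vertical c a e - horizontal e (f e) c - integral {a..e} (screen_integrand f F)
      = (horizontal a (f a) c + vertical c a b - horizontal b (f b) c - integral {a..b} (screen_integrand f F))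
      + (horizontal b (f b) c + vertical c b e - horizontal e (f e) c - integral {b..e} (screen_integrand f F))"
    unfolding V I[symmetric] by simp
  also have "\<dots> = 2 * pi * \<i> * (\<Sum>\<omega>\<in>enclosed a b. residue F \<omega>) + 2 * pi * \<i> * (\<Sum>\<omega>\<in>enclosed b e. residue F \<omega>)"
    using assms(1,2) unfolding slab_def by (simp only:)
  also have "\<dots> = 2 * pi * \<i> * (\<Sum>\<omega>\<in>enclosed a e. residue F \<omega>)"
    unfolding sum by (simp only: distrib_left)
  finally show ?thesis using fin int by (simp add: slab_def eq)
qed

text \<open>Bisection produces arbitrary heights, whereas slabs can be joined only at admissible
  ones. The claim is therefore proved for all admissible subintervals simultaneously.\<close>

theorem slab_admissible:
  assumes "a \<le> b" "admissible a" "admissible b"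
  shows "slab a b"
proof -
  have "a \<le> b \<longrightarrow> (\<forall>u v. a \<le> u \<and> u \<le> v \<and> v \<le> b \<and> admissible u \<and> admissible v \<longrightarrow> slab u v)"
  using \<open>a \<le> b\<close>
  proof (induction a b rule: Bolzano)
    case (trans a m b)
    show ?case
    proof (intro impI allI)
      fix u v assume uv: "a \<le> u \<and> u \<le> v \<and> v \<le> b \<and> admissible u \<and> admissible v"
      consider "v \<le> m" | "m \<le> u" | "u < m" "m < v" by linarith
      then show "slab u v"
      proof cases
        case 3
        obtain d where d: "d > 0" "\<And>y. \<bar>y - m\<bar> < d \<Longrightarrow> y \<noteq> m \<Longrightarrow> admissible y"
          "\<And>a b. m - d < a \<Longrightarrow> a \<le> b \<Longrightarrow> b < m + d \<Longrightarrow> admissible a \<Longrightarrow> admissible b \<Longrightarrow> slab a b"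
          using slab_local by blast
        \<comment> \<open>The bisection point \<open>m\<close> may be inadmissible, but heights near
          it on either side are not; \<open>y1\<close> and \<open>y2\<close> are such heights, kept
          between \<open>u\<close> and \<open>v\<close>, and the middle slab crosses
          \<open>m\<close>.\<close>
        define y1 where "y1 = max u (m - d / 2)"
        define y2 where "y2 = min v (m + d / 2)"
        have y: "y1 < m" "m - d < y1" "u \<le> y1" "m < y2" "y2 < m + d" "y2 \<le> v"
          using 3 d(1) by (auto simp: y1_def y2_def)
        have adm: "admissible y1" "admissible y2" using d(2)[of y1] d(2)[of y2] y by (auto simp: abs_less_iff)
        have "slab u y1" using trans(1) uv y adm 3 by auto
        moreover have "slab y1 y2" using d(3)[of y1 y2] y adm by auto
        moreover have "slab y2 v" using trans(2) uv y adm 3 by auto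
        ultimately show ?thesis using slab_trans y adm by (meson less_imp_le order_trans)
      qed (use trans uv in auto)
    qed
  next
    case (local x)
    obtain d where d: "d > 0" 
      "\<And>a b. x - d < a \<Longrightarrow> a \<le> b \<Longrightarrow> b < x + d \<Longrightarrow> admissible a \<Longrightarrow> admissible b \<Longrightarrow> slab a b"
      using slab_local[of x] by metis
    then show ?case by (intro exI[of _ d]) auto
  qed
  then show ?thesis using assms by blast
qed

end

section \<open>Abscissa of convergence\<close>

lemma powr_le_powr_bound:
  fixes x B :: real
  assumes "0 < x" "x \<le> B" "1 \<le> B" "\<sigma> \<le> \<tau>" "\<tau> - \<sigma> \<le> R"
  shows "x powr \<tau> \<le> B powr R * x powr \<sigma>"
proof -
  have "x powr \<tau> = x powr (\<tau> - \<sigma>) * x powr \<sigma>" by (simp flip: powr_add)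
  also have "x powr (\<tau> - \<sigma>) \<le> B powr (\<tau> - \<sigma>)" using assms by (intro powr_mono2) auto
  also have "B powr (\<tau> - \<sigma>) \<le> B powr R" using assms by (intro powr_mono) auto
  finally show ?thesis by (simp add: mult_right_mono)
qed

lemma summable_powr_mono:
  fixes l :: "nat \<Rightarrow> real"
  assumes l: "\<And>n. 0 < l n" "\<And>n. l n \<le> B" "1 \<le> B" and "summable (\<lambda>n. l n powr \<sigma>)" "\<sigma> \<le> \<tau>"
  shows "summable (\<lambda>n. l n powr \<tau>)"
proof (rule summable_comparison_test')
  show "summable (\<lambda>n. B powr (\<tau> - \<sigma>) * l n powr \<sigma>)" using assms by (intro summable_mult)
  show "norm (l n powr \<tau>) \<le> B powr (\<tau> - \<sigma>) * l n powr \<sigma>" for n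
    using powr_le_powr_bound[OF l(1) l(2) l(3) \<open>\<sigma> \<le> \<tau>\<close> order_refl] by simp
qed

lemma scaling_series_uniform_limit:
  fixes l :: "nat \<Rightarrow> real"
  assumes l: "\<And>n. 0 < l n" "\<And>n. l n \<le> B" "1 \<le> B" and sm: "summable (\<lambda>n. l n powr \<sigma>)"
    and S: "\<And>s. s \<in> S \<Longrightarrow> \<sigma> \<le> Re s" "\<And>s. s \<in> S \<Longrightarrow> Re s \<le> R"
  shows "uniform_limit S (\<lambda>N s. \<Sum>n<N. complex_of_real (l n) powr s) (scaling_series l) sequentially"
  unfolding scaling_series_def
proof (rule Weierstrass_m_test)
  show "summable (\<lambda>n. B powr (R - \<sigma>) * l n powr \<sigma>)" using sm by (intro summable_mult)
  show "norm (complex_of_real (l n) powr s) \<le> B powr (R - \<sigma>) * l n powr \<sigma>" if "s \<in> S" for n s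
    using powr_le_powr_bound[OF l(1) l(2) l(3), of \<sigma> "Re s" "R - \<sigma>"] S[OF that] l(1) by (simp add: norm_of_real_powr)
qed

lemma scaling_series_holomorphic:
  fixes l :: "nat \<Rightarrow> real"
  assumes l: "\<And>n. 0 < l n" "\<And>n. l n \<le> B" "1 \<le> B" and sm: "summable (\<lambda>n. l n powr \<sigma>)"
  shows "scaling_series l holomorphic_on {s. \<sigma> < Re s}"
proof (rule holomorphic_uniform_sequence[where f = "\<lambda>N s. \<Sum>n<N. complex_of_real (l n) powr s"])
  show op: "open {s. \<sigma> < Re s}" by (rule open_halfspace_Re_gt)
  show "(\<lambda>s. \<Sum>n<N. complex_of_real (l n) powr s) holomorphic_on {s. \<sigma> < Re s}" for N
    by (intro holomorphic_intros)
  fix x assume "x \<in> {s. \<sigma> < Re s}"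
  then obtain e where e: "e > 0" "cball x e \<subseteq> {s. \<sigma> < Re s}" using op by (meson open_contains_cball)
  have "uniform_limit (cball x e) (\<lambda>N s. \<Sum>n<N. complex_of_real (l n) powr s) (scaling_series l) sequentially"
  proof (rule scaling_series_uniform_limit[OF l sm])
    fix s assume s: "s \<in> cball x e"
    then show "\<sigma> \<le> Re s" using e by auto
    show "Re s \<le> Re x + e" using abs_Re_le_cmod[of "s - x"] s by (auto simp: dist_norm norm_minus_commute)
  qed
  then show "\<exists>d>0. cball x d \<subseteq> {s. \<sigma> < Re s} \<and>
    uniform_limit (cball x d) (\<lambda>N s. \<Sum>n<N. complex_of_real (l n) powr s) (scaling_series l) sequentially"
    using e by blast
qed

section \<open>Landau's theorem for the scaling series\<close>

lemma higher_deriv_powr_sum: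
  fixes l :: "nat \<Rightarrow> real"
  assumes "\<And>n. 0 < l n"
  shows "(deriv ^^ k) (\<lambda>s. \<Sum>n<N. complex_of_real (l n) powr s)
     = (\<lambda>s. \<Sum>n<N. of_real (ln (l n) ^ k) * complex_of_real (l n) powr s)"
proof (induction k)
  case (Suc k)
  have "deriv (\<lambda>s. \<Sum>n<N. of_real (ln (l n) ^ k) * complex_of_real (l n) powr s) s
      = (\<Sum>n<N. of_real (ln (l n) ^ Suc k) * complex_of_real (l n) powr s)" for s
  proof (rule DERIV_imp_deriv)
    have "((\<lambda>s. of_real (ln (l n) ^ k) * complex_of_real (l n) powr s) has_field_derivative
        of_real (ln (l n) ^ Suc k) * complex_of_real (l n) powr s) (at s)" for n
      using assms[of n] by (auto intro!: derivative_eq_intros simp: Ln_of_real)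
    then show "((\<lambda>s. \<Sum>n<N. of_real (ln (l n) ^ k) * complex_of_real (l n) powr s) has_field_derivative
        (\<Sum>n<N. of_real (ln (l n) ^ Suc k) * complex_of_real (l n) powr s)) (at s)"
      by (intro DERIV_sum)
  qed
  then show ?case unfolding funpow.simps o_apply Suc.IH by (rule ext)
qed simp

text \<open>The Taylor coefficients of the sum at a point to the right of the abscissa dominate those of all
  partial sums, up to the common sign \<open>(-1) ^ k\<close>, so the series converges wherever the Taylor series does.\<close>

lemma landau_le_1:
  fixes l :: "nat \<Rightarrow> real"
  assumes l: "\<And>n. 0 < l n" "\<And>n. l n \<le> 1" and sm: "summable (\<lambda>n. l n powr \<sigma>)"
    and h: "h holomorphic_on ball (of_real \<sigma>) r" "r > 0"
    and eq: "\<And>s. s \<in> ball (of_real \<sigma>) r \<Longrightarrow> \<sigma> < Re s \<Longrightarrow> h s = scaling_series l s"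
  shows "summable (\<lambda>n. l n powr (\<sigma> - r / 4))"
proof -
  \<comment> \<open>The Taylor expansion is centred right of \<open>\<sigma>\<close>, where the
    series converges. The ball of radius \<open>3 * r / 4\<close> about \<open>a\<close> still lies
    in the given ball, and a step of \<open>r / 2\<close> to the left ends at
    \<open>\<sigma> - r / 4\<close>.\<close>
  define a where "a = \<sigma> + r / 4"
  define S where "S = (\<lambda>N s. \<Sum>n<N. complex_of_real (l n) powr s)"
  define A where "A = ball (complex_of_real \<sigma>) r \<inter> {s. \<sigma> < Re s}"
  define H where "H = (\<lambda>k. (deriv ^^ k) h (of_real a))"
  define T where "T = (\<lambda>N k. \<Sum>n<N. (- ln (l n)) ^ k * l n powr a)"
  have "open A" unfolding A_def by (intro open_Int open_ball open_halfspace_Re_gt)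
  have aA: "of_real a \<in> A" using \<open>r > 0\<close> by (simp add: A_def a_def dist_norm)
  have "uniform_limit A S (scaling_series l) sequentially"
    unfolding S_def
  proof (rule scaling_series_uniform_limit[OF l _ sm])
    fix s assume s: "s \<in> A"
    then show "\<sigma> \<le> Re s" by (simp add: A_def)
    show "Re s \<le> \<sigma> + r" using abs_Re_le_cmod[of "s - of_real \<sigma>"] s by (auto simp: A_def dist_norm norm_minus_commute)
  qed simp
  then have ul: "uniform_limit A S h sequentially"
    by (rule uniform_limit_cong'[THEN iffD1, rotated 2]) (auto simp: A_def eq)
  have lim: "(\<lambda>N. (deriv ^^ k) (S N) (of_real a)) \<longlonglongrightarrow> H k" for k
    unfolding H_def
    by (rule higher_deriv_complex_uniform_limit[OF ul _ _ \<open>open A\<close> aA])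
       (auto simp: S_def intro!: always_eventually holomorphic_intros)
  have "(deriv ^^ k) (S N) (of_real a) = (-1) ^ k * of_real (T N k)" for N k
  proof -
    have "(\<Sum>n<N. of_real (ln (l n) ^ k) * complex_of_real (l n) powr of_real a) = (\<Sum>n<N. (-1) ^ k * of_real ((- ln (l n)) ^ k * l n powr a))"
    proof (rule sum.cong[OF refl])
      fix n
      have "(-1) ^ k * (- ln (l n)) ^ k = ln (l n) ^ k" by (simp flip: power_mult_distrib)
      then have "(-1) ^ k * ((- ln (l n)) ^ k * l n powr a) = ln (l n) ^ k * l n powr a" by (metis mult.assoc)
      then have "complex_of_real ((-1) ^ k * ((- ln (l n)) ^ k * l n powr a)) = of_real (ln (l n) ^ k * l n powr a)" by (rule arg_cong)
      then show "of_real (ln (l n) ^ k) * complex_of_real (l n) powr of_real a = (-1) ^ k * of_real ((- ln (l n)) ^ k * l n powr a)"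
        using l(1)[of n] by (simp add: powr_of_real)
    qed
    then show ?thesis unfolding S_def higher_deriv_powr_sum[OF l(1)] T_def by (simp add: sum_distrib_left)
  qed
  then have "norm ((deriv ^^ k) (S N) (of_real a)) = \<bar>T N k\<bar>" for N k by (simp add: norm_mult norm_power)
  moreover have nn: "0 \<le> (- ln (l n)) ^ k * l n powr a" for n k
    using l[of n] by (intro mult_nonneg_nonneg zero_le_power) auto
  then have T0: "0 \<le> T N k" for N k unfolding T_def by (intro sum_nonneg) auto
  ultimately have limT: "(\<lambda>N. T N k) \<longlonglongrightarrow> norm (H k)" for k
    using tendsto_norm[OF lim[of k]] by simp
  have T_le: "T N k \<le> norm (H k)" for N k
  proof (rule incseq_le[OF _ limT])
    show "incseq (\<lambda>N. T N k)" unfolding T_def by (intro incseq_SucI) (simp add: nn)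
  qed
  define M where "M = (\<Sum>k. norm (H k) / fact k * (r / 2) ^ k)"
  have smH: "summable (\<lambda>k. norm (H k) / fact k * (r / 2) ^ k)"
  proof -
    have sub: "ball (complex_of_real a) (3 * r / 4) \<subseteq> ball (of_real \<sigma>) r"
    proof
      fix z assume "z \<in> ball (complex_of_real a) (3 * r / 4)"
      then have "dist (of_real a) z < 3 * r / 4" by simp
      moreover have "dist (of_real \<sigma>) (complex_of_real a) = r / 4" using \<open>r > 0\<close> by (simp add: a_def dist_norm)
      ultimately show "z \<in> ball (of_real \<sigma>) r"
        using dist_triangle[of "of_real \<sigma>" z "complex_of_real a"] by simp
    qed
    \<comment> \<open>The distance \<open>5 * r / 8\<close> lies strictly between
      \<open>r / 2\<close> and \<open>3 * r / 4\<close>: convergence there gives absolute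
      convergence at \<open>r / 2\<close>.\<close>
    have "(\<lambda>k. H k / fact k * (of_real (a + 5 * r / 8) - of_real a) ^ k) sums h (of_real (a + 5 * r / 8))"
      unfolding H_def
    proof (rule holomorphic_power_series)
      show "h holomorphic_on ball (of_real a) (3 * r / 4)" using h(1) sub by (rule holomorphic_on_subset)
      show "complex_of_real (a + 5 * r / 8) \<in> ball (of_real a) (3 * r / 4)"
        using \<open>r > 0\<close> by (simp add: dist_norm flip: of_real_mult of_real_divide)
    qed
    then have "summable (\<lambda>k. H k / fact k * (complex_of_real (5 * r / 8)) ^ k)"
      by (simp add: sums_iff)
    then have "summable (\<lambda>k. norm (H k / fact k * (complex_of_real (r / 2)) ^ k))"
      by (rule powser_insidea) (use \<open>r > 0\<close> in \<open>simp add: norm_divide norm_mult\<close>)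
    moreover have "norm (H k / fact k * (complex_of_real (r / 2)) ^ k) = norm (H k) / fact k * (r / 2) ^ k" for k
      using \<open>r > 0\<close> by (simp only: norm_mult norm_divide norm_power norm_of_real norm_fact)
    ultimately show ?thesis by simp
  qed
  have "(\<Sum>n<N. l n powr (\<sigma> - r / 4)) \<le> M" for N
  proof -
    \<comment> \<open>The exponential series has nonnegative terms because
      \<open>l n \<le> 1\<close>; summed over n, these terms are the Taylor terms of the partial sum
      at distance \<open>r / 2\<close>.\<close>
    have "(\<lambda>k. l n powr a * ((r / 2 * - ln (l n)) ^ k / fact k)) sums (l n powr (\<sigma> - r / 4))" for n
    proof -
      have "(\<lambda>k. y ^ k / fact k) sums exp y" for y :: real
        using exp_converges[of y] by (simp add: divide_inverse mult.commute)
      then have "(\<lambda>k. l n powr a * ((r / 2 * - ln (l n)) ^ k / fact k)) sums (l n powr a * exp (r / 2 * - ln (l n)))"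
        by (rule sums_mult)
      moreover have "l n powr a * exp (r / 2 * - ln (l n)) = l n powr (\<sigma> - r / 4)"
        using l(1)[of n] by (simp add: powr_def a_def algebra_simps flip: exp_add)
      ultimately show ?thesis by (simp only:)
    qed
    then have "(\<lambda>k. \<Sum>n<N. l n powr a * ((r / 2 * - ln (l n)) ^ k / fact k)) sums (\<Sum>n<N. l n powr (\<sigma> - r / 4))"
      by (intro sums_sum)
    moreover have "(\<Sum>n<N. l n powr a * ((r / 2 * - ln (l n)) ^ k / fact k)) = T N k / fact k * (r / 2) ^ k" for k
      unfolding T_def sum_divide_distrib sum_distrib_right power_mult_distrib by (intro sum.cong) auto
    ultimately have *: "(\<lambda>k. T N k / fact k * (r / 2) ^ k) sums (\<Sum>n<N. l n powr (\<sigma> - r / 4))" by simp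
    have "T N k / fact k * (r / 2) ^ k \<le> norm (H k) / fact k * (r / 2) ^ k" for k
      using T_le[of N k] \<open>r > 0\<close> by (intro mult_right_mono divide_right_mono) auto
    then show ?thesis unfolding M_def
      using suminf_le[OF _ sums_summable[OF *] smH] * by (simp add: sums_iff)
  qed
  then show ?thesis by (intro summableI_nonneg_bounded[where x = M]) auto
qed

lemma convergent_bounded_above:
  fixes l :: "nat \<Rightarrow> real"
  assumes "l \<longlonglongrightarrow> L"
  obtains B where "\<And>n. l n \<le> B" "1 \<le> B"
proof -
  have "Bseq l" using assms convergentI convergent_imp_Bseq by blast
  then obtain K where "\<And>n. \<bar>l n\<bar> \<le> K" unfolding Bseq_def real_norm_def by blast
  then show thesis by (intro that[of "max 1 K"]) (auto simp: abs_le_iff le_max_iff_disj)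
qed

text \<open>Nonnegativity of \<open>- ln (l n)\<close> requires ratios at most 1. The ratios tend to
  0, so it suffices to drop finitely many terms, and the dropped ones are entire functions that can
  be subtracted from \<open>h\<close>.\<close>

theorem landau:
  fixes l :: "nat \<Rightarrow> real"
  assumes l: "\<And>n. 0 < l n" and l0: "l \<longlonglongrightarrow> 0" and sm: "summable (\<lambda>n. l n powr \<sigma>)"
    and h: "h holomorphic_on ball (of_real \<sigma>) r" "r > 0"
    and eq: "\<And>s. s \<in> ball (of_real \<sigma>) r \<Longrightarrow> \<sigma> < Re s \<Longrightarrow> h s = scaling_series l s"
  shows "summable (\<lambda>n. l n powr (\<sigma> - r / 4))"
proof -
  obtain N where N: "\<And>n. n \<ge> N \<Longrightarrow> l n < 1"
    using order_tendstoD(2)[OF l0, of 1] by (auto simp: eventually_sequentially)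
  obtain B where B: "\<And>n. l n \<le> B" "1 \<le> B"
    by (rule convergent_bounded_above[OF l0]) (rule that)
  define h' where "h' = (\<lambda>s. h s - (\<Sum>n<N. complex_of_real (l n) powr s))"
  have "summable (\<lambda>n. l (n + N) powr (\<sigma> - r / 4))"
  proof (rule landau_le_1)
    show "l (n + N) \<le> 1" for n using N[of "n + N"] by simp
    show "summable (\<lambda>n. l (n + N) powr \<sigma>)" using sm summable_iff_shift[of "\<lambda>n. l n powr \<sigma>" N] by simp
    show "h' holomorphic_on ball (of_real \<sigma>) r" unfolding h'_def by (intro holomorphic_intros h)
    fix s assume s: "s \<in> ball (of_real \<sigma>) r" "\<sigma> < Re s"
    have "summable (\<lambda>n. l n powr Re s)" by (rule summable_powr_mono[OF l B sm]) (use s in simp)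
    then have "summable (\<lambda>n. complex_of_real (l n) powr s)"
      by (intro summable_norm_cancel[of "\<lambda>n. complex_of_real (l n) powr s"]) (simp add: norm_of_real_powr l)
    from suminf_split_initial_segment[OF this, of N] show "h' s = scaling_series (\<lambda>n. l (n + N)) s"
      unfolding h'_def eq[OF s] scaling_series_def by simp
  qed (use l h in auto)
  then show ?thesis using summable_iff_shift[of "\<lambda>n. l n powr (\<sigma> - r / 4)" N] by simp
qed

lemma tendsto_add_inverse_Suc: "(\<lambda>n. w + complex_of_real (1 / real (Suc n))) \<longlonglongrightarrow> w"
proof -
  have "(\<lambda>n. complex_of_real (1 / real (Suc n))) \<longlonglongrightarrow> of_real 0"
    by (intro tendsto_of_real lim_1_over_n[THEN LIMSEQ_Suc])
  from tendsto_add[OF tendsto_const[of w] this] show ?thesis by simp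
qed

text \<open>The pole is approached horizontally from the right because both uses have bounds only on
  that side: from the convergent series, and from languidity right of the screen.\<close>

lemma pole_unbounded_right:
  assumes "is_pole h w"
  shows "eventually (\<lambda>n. K < norm (h (w + complex_of_real (1 / real (Suc n))))) sequentially"
proof -
  have "filterlim (\<lambda>n. w + complex_of_real (1 / real (Suc n))) (at w) sequentially"
    using tendsto_add_inverse_Suc[of w] by (auto simp: filterlim_at simp del: of_nat_Suc)
  with assms have "filterlim (\<lambda>n. h (w + complex_of_real (1 / real (Suc n)))) at_infinity sequentially"
    unfolding is_pole_def by (rule filterlim_compose)
  then have "filterlim (\<lambda>n. norm (h (w + complex_of_real (1 / real (Suc n))))) at_top sequentially"
    by (rule filterlim_at_infinity_imp_norm_at_top)
  then show ?thesis by (simp add: filterlim_at_top_dense)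
qed

text \<open>If the series converges at \<open>\<sigma>\<close> then its extension has no pole there, so by Landau's theorem
  \<open>\<sigma>\<close> cannot be the abscissa of convergence.\<close>

lemma summable_left_of_regular_point:
  fixes l :: "nat \<Rightarrow> real"
  assumes l: "\<And>n. 0 < l n" and l0: "l \<longlonglongrightarrow> 0" and sm: "summable (\<lambda>n. l n powr \<sigma>)"
    and zeta: "scaling_zeta_on l U \<zeta>" and U: "of_real \<sigma> \<in> U"
  obtains \<tau> where "\<tau> < \<sigma>" "summable (\<lambda>n. l n powr \<tau>)"
proof -
  obtain B where B: "\<And>n. l n \<le> B" "1 \<le> B"
    by (rule convergent_bounded_above[OF l0]) (rule that)
  have sm': "summable (\<lambda>n. l n powr t)" if "\<sigma> \<le> t" for t
    by (rule summable_powr_mono[OF l B sm that])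
  have op: "open U" and nice: "\<zeta> nicely_meromorphic_on U"
    and eq: "\<And>s. s \<in> U \<Longrightarrow> \<sigma> \<le> Re s \<Longrightarrow> \<zeta> s = scaling_series l s"
    using zeta sm' by (auto simp: scaling_zeta_on_def)
  define x where "x = (\<lambda>n. complex_of_real (\<sigma> + 1 / real (Suc n)))"
  have xlim: "x \<longlonglongrightarrow> of_real \<sigma>"
    unfolding x_def of_real_add by (rule tendsto_add_inverse_Suc)
  \<comment> \<open>The points \<open>x n\<close> are at most 1 to the right of
    \<open>\<sigma>\<close>, so \<open>B powr 1\<close> absorbs the excess exponent and
    \<open>K\<close> bounds the series at all of them.\<close>
  define K where "K = (\<Sum>n. B powr 1 * l n powr \<sigma>)"
  have bd: "norm (\<zeta> (x n)) \<le> K" if "x n \<in> U" for n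
  proof -
    have "norm (\<zeta> (x n)) = norm (\<Sum>k. complex_of_real (l k) powr x n)"
      using eq[OF that] by (simp add: x_def scaling_series_def del: of_real_add of_nat_Suc)
    also have "\<dots> \<le> (\<Sum>k. B powr 1 * l k powr \<sigma>)"
    proof (rule norm_suminf_le)
      show "summable (\<lambda>k. B powr 1 * l k powr \<sigma>)" using sm by (intro summable_mult)
      show "norm (complex_of_real (l k) powr x n) \<le> B powr 1 * l k powr \<sigma>" for k
        unfolding norm_of_real_powr[OF l]
        by (rule powr_le_powr_bound[OF l B]) (auto simp: x_def simp del: of_real_add of_nat_Suc)
    qed
    finally show ?thesis by (simp add: K_def)
  qed
  have "\<not> is_pole \<zeta> (of_real \<sigma>)"
  proof
    assume "is_pole \<zeta> (of_real \<sigma>)"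
    from pole_unbounded_right[OF this, of K] have "eventually (\<lambda>n. K < norm (\<zeta> (x n))) sequentially"
      by (simp add: x_def)
    moreover have "eventually (\<lambda>n. x n \<in> U) sequentially" using xlim op U by (rule topological_tendstoD)
    ultimately have "eventually (\<lambda>n. False) sequentially"
      by eventually_elim (use bd in \<open>auto simp: not_le[symmetric]\<close>)
    then show False by simp
  qed
  then have "\<zeta> analytic_on {of_real \<sigma>}" using nicely_meromorphic_on_imp_analytic_at[OF nice U] by blast
  then obtain r1 where r1: "r1 > 0" "\<zeta> holomorphic_on ball (of_real \<sigma>) r1" by (auto simp: analytic_on_def)
  obtain r2 where r2: "r2 > 0" "ball (of_real \<sigma>) r2 \<subseteq> U" using op U by (meson openE)
  have "summable (\<lambda>n. l n powr (\<sigma> - min r1 r2 / 4))"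
  proof (rule landau[OF l l0 sm])
    show "\<zeta> holomorphic_on ball (of_real \<sigma>) (min r1 r2)" using r1(2) by (rule holomorphic_on_subset) auto
    show "\<zeta> s = scaling_series l s" if "s \<in> ball (of_real \<sigma>) (min r1 r2)" "\<sigma> < Re s" for s
      using that r2(2) by (intro eq) auto
  qed (use r1 r2 in simp)
  then show thesis using r1 r2 by (intro that[of "\<sigma> - min r1 r2 / 4"]) auto
qed

section \<open>Estimates on the screen and the tube formula\<close>

text \<open>Integrability of the screen integrand is known only between admissible heights. Together
  with an integrable majorant this gives integrability on the whole line and convergence along the
  heights.\<close>

lemma integral_exhaustion:
  fixes h :: "real \<Rightarrow> complex"
  assumes int: "\<And>n. h integrable_on {a n..b n}" and bound: "\<And>x. norm (h x) \<le> w x" and w: "w integrable_on UNIV"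
    and a: "filterlim a at_bot sequentially" and b: "filterlim b at_top sequentially"
  shows "h absolutely_integrable_on UNIV" "(\<lambda>n. integral {a n..b n} h) \<longlonglongrightarrow> integral UNIV h"
proof -
  define k where "k = (\<lambda>n x. if x \<in> {a n..b n} then h x else 0)"
  have kint: "k n integrable_on UNIV" for n
    unfolding k_def integrable_restrict_UNIV by (rule int)
  have kb: "norm (k n x) \<le> w x" for n x
    using bound[of x] norm_ge_zero[of "h x"] by (auto simp: k_def simp del: norm_ge_zero)
  have lim: "(\<lambda>n. k n x) \<longlonglongrightarrow> h x" for x
  proof (rule tendsto_eventually)
    have "eventually (\<lambda>n. a n \<le> x) sequentially" "eventually (\<lambda>n. x \<le> b n) sequentially"
      using a b by (auto simp: filterlim_at_bot filterlim_at_top)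
    then show "eventually (\<lambda>n. k n x = h x) sequentially" by eventually_elim (simp add: k_def)
  qed
  have hi: "h integrable_on UNIV" by (rule dominated_convergence(1)[OF kint w kb lim])
  then show "h absolutely_integrable_on UNIV" using bound w by (intro absolutely_integrable_integrable_bound)
  show "(\<lambda>n. integral {a n..b n} h) \<longlonglongrightarrow> integral UNIV h"
    using dominated_convergence(2)[OF kint w kb lim] unfolding k_def integral_restrict_UNIV .
qed

lemma inverse_square_integrable: "(\<lambda>t::real. K / (1 + t\<^sup>2)) integrable_on UNIV"
proof -
  have "set_integrable lborel UNIV (\<lambda>t::real. inverse (1 + t\<^sup>2))"
    using integrable_inverse_1_plus_square by simp
  then have "(\<lambda>t::real. inverse (1 + t\<^sup>2)) integrable_on UNIV" by (rule set_borel_integral_eq_integral(1))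
  then show ?thesis unfolding divide_inverse by (rule integrable_on_mult_right)
qed

text \<open>Where the screen function is not differentiable, the derivative of the screen path is one fixed
  choice value, so the bound holds everywhere.\<close>

lemma screen_path_vector_derivative_bounded:
  assumes "C-lipschitz_on UNIV f"
  obtains V where "\<And>t. norm (vector_derivative (screen_path f) (at t)) \<le> V"
proof -
  have lip: "(C + 1)-lipschitz_on UNIV (screen_path f)" by (rule screen_path_lipschitz[OF assms])
  define e where "e = (SOME v::complex. False)"
  have "norm (vector_derivative (screen_path f) (at t)) \<le> max (C + 1) (norm e)" for t
  proof (cases "\<exists>v. (screen_path f has_vector_derivative v) (at t)")
    case True
    then have v: "(screen_path f has_vector_derivative vector_derivative (screen_path f) (at t)) (at t)"
      (is "(_ has_vector_derivative ?v) _")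
      using vector_derivative_works differentiableI_vector by blast
    let ?Y = "\<lambda>y. screen_path f (t + y) - screen_path f t - y *\<^sub>R ?v"
    have "((\<lambda>y. norm (?Y y /\<^sub>R norm y)) \<longlongrightarrow> 0) (at 0)"
      using v by (simp add: has_vector_derivative_def has_derivative_at divide_inverse mult.commute)
    moreover have "\<forall>\<^sub>F y in at 0. norm ?v - (C + 1) \<le> norm (?Y y /\<^sub>R norm y)"
      unfolding eventually_at_filter
    proof (intro always_eventually allI impI)
      fix y :: real assume "y \<noteq> 0"
      have "\<bar>y\<bar> * norm ?v \<le> norm (screen_path f (t + y) - screen_path f t) + norm (?Y y)"
        using norm_triangle_ineq4[of "screen_path f (t + y) - screen_path f t" "?Y y"]
        by simp
      also have "norm (screen_path f (t + y) - screen_path f t) \<le> (C + 1) * \<bar>y\<bar>"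
        using lipschitz_onD[OF lip, of "t + y" t] by (simp add: dist_norm)
      finally have "norm ?v \<le> (C + 1) + norm (?Y y) / \<bar>y\<bar>" using \<open>y \<noteq> 0\<close> by (simp add: field_simps)
      moreover have "norm (?Y y /\<^sub>R norm y) = norm (?Y y) / \<bar>y\<bar>"
        unfolding norm_scaleR by (simp add: divide_inverse mult.commute)
      ultimately show "norm ?v - (C + 1) \<le> norm (?Y y /\<^sub>R norm y)" by linarith
    qed
    ultimately have "norm ?v - (C + 1) \<le> 0" by (rule tendsto_lowerbound) simp
    then show ?thesis by simp
  next
    case False
    then have "vector_derivative (screen_path f) (at t) = e"
      by (simp add: vector_derivative_def e_def)
    then show ?thesis by simp
  qed
  then show thesis by (rule that)
qed

section \<open>Rescaled test functions and decay of the kernel\<close>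

lemma power_moment_rescale:
  assumes "supported D p q" "a > 0"
  shows "power_moment (rescale a (D 0)) z = of_real a powr z * power_moment (D 0) z"
proof -
  interpret supported D p q by fact
  have I: "((\<lambda>x. complex_of_real x powr z * D 0 x) has_integral power_moment (D 0) z) {p..q}"
    using pq by (intro moment_has_integral) auto
  have "(\<lambda>x. x / (1 / a)) = (*) a" by auto
  then have "(\<lambda>x. x / (1 / a)) ` {p..q} = {a * p..a * q}"
    using \<open>a > 0\<close> pq by (simp only: image_mult_atLeastAtMost)
  with has_integral_stretch_real[OF I, of "1 / a"] \<open>a > 0\<close>
  have "((\<lambda>x. complex_of_real (x / a) powr z * D 0 (x / a)) has_integral a *\<^sub>R power_moment (D 0) z) {a * p..a * q}"
    by simp
  from has_integral_mult_right[OF this, of "of_real a powr z / of_real a"]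
  have "((\<lambda>x. of_real a powr z / of_real a * (complex_of_real (x / a) powr z * D 0 (x / a)))
      has_integral of_real a powr z * power_moment (D 0) z) {a * p..a * q}"
    using \<open>a > 0\<close> by (simp add: scaleR_conv_of_real)
  then have "((\<lambda>x. complex_of_real x powr z * rescale a (D 0) x) has_integral of_real a powr z * power_moment (D 0) z) {a * p..a * q}"
  proof (rule has_integral_eq[rotated])
    fix x assume "x \<in> {a * p..a * q}"
    then have "x > 0" using \<open>a > 0\<close> pq by (smt (verit) atLeastAtMost_iff mult_pos_pos)
    then have "complex_of_real (x / a) powr z * of_real a powr z = of_real x powr z"
      using \<open>a > 0\<close> powr_times_real[of "complex_of_real (x / a)" "of_real a" z] by simp
    then show "of_real a powr z / of_real a * (complex_of_real (x / a) powr z * D 0 (x / a)) = complex_of_real x powr z * rescale a (D 0) x"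
      by (simp add: rescale_def field_simps)
  qed
  then have "((\<lambda>x. complex_of_real x powr z * rescale a (D 0) x) has_integral of_real a powr z * power_moment (D 0) z) {0<..}"
  proof (rule has_integral_on_superset)
    show "complex_of_real x powr z * rescale a (D 0) x = 0" if "x \<notin> {a * p..a * q}" for x
      using that zero[of "x / a" 0] \<open>a > 0\<close> by (auto simp: rescale_def field_simps)
    show "{a * p..a * q} \<subseteq> {0<..}" using \<open>a > 0\<close> pq by (smt (verit) atLeastAtMost_iff greaterThan_iff mult_pos_pos subsetI)
  qed
  then show ?thesis unfolding power_moment_def by (rule integral_unique)
qed

text \<open>The Mellin transform of the generator's tube volume for \<open>d - 1 < Re s < d\<close>,
  and its meromorphic continuation elsewhere.\<close>

definition monophase_factor :: "nat \<Rightarrow> real \<Rightarrow> (nat \<Rightarrow> real) \<Rightarrow> complex \<Rightarrow> complex" where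
  "monophase_factor d g \<kappa> s = (\<Sum>k\<le>d. complex_of_real g powr (s - of_nat k) / (s - of_nat k) * complex_of_real (\<kappa> k))"

lemma paired_tubular_zeta_eq:
  "paired_tubular_zeta d g \<kappa> \<zeta> \<psi> s = \<zeta> s * monophase_factor d g \<kappa> s * power_moment \<psi> (of_nat d - s)"
proof -
  have "(\<lambda>x. tubular_zeta d g \<kappa> \<zeta> x s * \<psi> x) = (\<lambda>x. (\<zeta> s * monophase_factor d g \<kappa> s) * (complex_of_real x powr (of_nat d - s) * \<psi> x))"
    by (simp add: fun_eq_iff tubular_zeta_def monophase_factor_def mult_ac)
  then show ?thesis
    unfolding paired_tubular_zeta_def pairing_def power_moment_def by (simp only: integral_mult_right)
qed

lemma monophase_factor_holomorphic:
  assumes "g > 0" "\<And>k. k \<le> d \<Longrightarrow> of_nat k \<notin> S"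
  shows "monophase_factor d g \<kappa> holomorphic_on S"
  unfolding monophase_factor_def using assms by (intro holomorphic_intros) auto

text \<open>The poles are real, so at distance at least 1 from the real axis every denominator has
  modulus at least 1.\<close>

lemma monophase_factor_bounded:
  assumes "g > 0"
  obtains K where "K \<ge> 0" "\<And>s. 1 \<le> \<bar>Im s\<bar> \<Longrightarrow> \<bar>Re s\<bar> \<le> R \<Longrightarrow> norm (monophase_factor d g \<kappa> s) \<le> K"
proof
  define K where "K = (\<Sum>k\<le>d. exp ((R + real d) * \<bar>ln g\<bar>) * \<bar>\<kappa> k\<bar>)"
  show "K \<ge> 0" unfolding K_def by (intro sum_nonneg) auto
  fix s :: complex assume s: "1 \<le> \<bar>Im s\<bar>" "\<bar>Re s\<bar> \<le> R"
  show "norm (monophase_factor d g \<kappa> s) \<le> K"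
    unfolding monophase_factor_def K_def
  proof (rule sum_norm_le)
    fix k assume "k \<in> {..d}"
    have "(Re s - real k) * ln g \<le> \<bar>Re s - real k\<bar> * \<bar>ln g\<bar>" using abs_ge_self[of "(Re s - real k) * ln g"] by (simp add: abs_mult)
    also have "\<dots> \<le> (R + real d) * \<bar>ln g\<bar>" using s(2) \<open>k \<in> {..d}\<close> by (intro mult_right_mono) auto
    finally have "norm (complex_of_real g powr (s - of_nat k)) \<le> exp ((R + real d) * \<bar>ln g\<bar>)"
      using assms by (simp add: norm_of_real_powr powr_def)
    moreover have "1 \<le> norm (s - of_nat k)" using s(1) abs_Im_le_cmod[of "s - of_nat k"] by simp
    ultimately have "norm (complex_of_real g powr (s - of_nat k)) / norm (s - of_nat k) \<le> exp ((R + real d) * \<bar>ln g\<bar>) / 1"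
      by (intro frac_le) auto
    then show "norm (complex_of_real g powr (s - of_nat k) / (s - of_nat k) * complex_of_real (\<kappa> k)) \<le> exp ((R + real d) * \<bar>ln g\<bar>) * \<bar>\<kappa> k\<bar>"
      using mult_right_mono[of _ _ "\<bar>\<kappa> k\<bar>"] by (simp only: norm_mult norm_divide norm_of_real)
  qed
qed

lemma (in supported) paired_decay:
  assumes "g > 0"
  obtains K where "K \<ge> 0" "\<And>s. 1 \<le> \<bar>Im s\<bar> \<Longrightarrow> \<bar>Re s\<bar> \<le> R \<Longrightarrow>
    (\<bar>Im s\<bar> + 1) powr M * norm (monophase_factor d g \<kappa> s * power_moment (D 0) (of_nat d - s)) \<le> K / (1 + (Im s)\<^sup>2)"
proof -
  obtain K1 where K1: "K1 \<ge> 0" "\<And>s. 1 \<le> \<bar>Im s\<bar> \<Longrightarrow> \<bar>Re s\<bar> \<le> R \<Longrightarrow> norm (monophase_factor d g \<kappa> s) \<le> K1"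
    using monophase_factor_bounded[OF assms] by metis
  \<comment> \<open>\<open>M\<close> is rounded up to a natural number, since the decay of the
    moment is stated with natural powers. Two further powers are spent on the integrable factor,
    using \<open>1 + t\<^sup>2 \<le> 2 * t\<^sup>2\<close> for \<open>t \<ge> 1\<close>.\<close>
  define m where "m = nat \<lceil>max M 0\<rceil>"
  have m: "M \<le> real m" by (simp add: m_def) linarith
  obtain K2 where K2: "\<And>z. \<bar>Re z\<bar> \<le> R + real d \<Longrightarrow> norm (power_moment (D 0) z) * \<bar>Im z\<bar> ^ (m + 2) \<le> K2"
    using moment_decay[of "R + real d" 0 "m + 2"] by blast
  have est: "(\<bar>Im s\<bar> + 1) powr M * norm (monophase_factor d g \<kappa> s * power_moment (D 0) (of_nat d - s)) \<le> (2 ^ m * 2 * K1 * max K2 0) / (1 + (Im s)\<^sup>2)"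
    if s: "1 \<le> \<bar>Im s\<bar>" "\<bar>Re s\<bar> \<le> R" for s
  proof -
    define t where "t = \<bar>Im s\<bar>"
    have t: "t \<ge> 1" using s by (simp add: t_def)
    have P: "norm (power_moment (D 0) (of_nat d - s)) * t ^ (m + 2) \<le> max K2 0"
    proof -
      have "\<bar>Re (of_nat d - s)\<bar> \<le> R + real d" using s(2) by simp
      from K2[OF this] show ?thesis unfolding le_max_iff_disj by (simp add: t_def)
    qed
    have "(t + 1) powr M \<le> (t + 1) powr real m" using t m by (intro powr_mono) auto
    also have "\<dots> = (t + 1) ^ m" using t by (simp add: powr_realpow)
    also have "\<dots> \<le> (2 * t) ^ m" using t by (intro power_mono) auto
    finally have "(t + 1) powr M * norm (monophase_factor d g \<kappa> s * power_moment (D 0) (of_nat d - s))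
        \<le> (2 * t) ^ m * (K1 * norm (power_moment (D 0) (of_nat d - s)))"
      unfolding norm_mult using K1(1) K1(2)[OF s] t by (intro mult_mono) (auto intro: mult_right_mono)
    also have "\<dots> * (1 + t\<^sup>2) \<le> \<dots> * (2 * t\<^sup>2)"
      using t K1(1) by (intro mult_left_mono mult_nonneg_nonneg) (auto intro: one_le_power)
    then have "(2 * t) ^ m * (K1 * norm (power_moment (D 0) (of_nat d - s))) \<le>
        (2 * t) ^ m * (K1 * norm (power_moment (D 0) (of_nat d - s))) * (2 * t\<^sup>2) / (1 + t\<^sup>2)"
      by (subst pos_le_divide_eq) (auto intro: add_pos_nonneg)
    also have "\<dots> = (2 ^ m * 2 * K1 * (norm (power_moment (D 0) (of_nat d - s)) * t ^ (m + 2))) / (1 + t\<^sup>2)"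
      by (simp add: power_mult_distrib power_add power2_eq_square mult_ac)
    also have "\<dots> \<le> (2 ^ m * 2 * K1 * max K2 0) / (1 + t\<^sup>2)"
      using P K1(1) by (intro divide_right_mono mult_left_mono) auto
    finally show ?thesis by (simp add: t_def)
  qed
  show thesis by (rule that[OF _ est]) (use K1 in auto)
qed

text \<open>The analytic data once Landau's theorem has done its work: the series converges at some
  \<open>\<tau>\<close> with \<open>d - 1 \<le> \<tau> < d\<close>, and \<open>L\<close> and
  \<open>M\<close> are the languidity constants. The condition on \<open>f 0\<close> puts the point
  \<open>d\<close> strictly right of the screen.\<close>

locale screened_zeta =
  fixes l :: "nat \<Rightarrow> real" and \<zeta> :: "complex \<Rightarrow> complex" and U :: "complex set" and f :: "real \<Rightarrow> real"
    and T :: "int \<Rightarrow> real" and \<kappa> :: "nat \<Rightarrow> real" and g :: real and d :: nat and \<tau> C B L M R :: real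
  assumes l: "\<And>n. 0 < l n" "\<And>n. l n \<le> B" "1 \<le> B"
    and sm: "summable (\<lambda>n. l n powr \<tau>)" and \<tau>: "real d - 1 \<le> \<tau>" "\<tau> < real d" and d: "0 < d" and g: "0 < g"
    and f_lip: "C-lipschitz_on UNIV f" and f_bound: "\<And>t. \<bar>f t\<bar> \<le> R"
    and U: "open U" "\<zeta> nicely_meromorphic_on U" and zeta: "\<And>s. s \<in> U \<Longrightarrow> \<tau> \<le> Re s \<Longrightarrow> \<zeta> s = scaling_series l s"
    and window: "window f \<subseteq> U"
    and T_sign: "\<And>n. 1 \<le> n \<Longrightarrow> T (- n) < 0 \<and> 0 < T n"
    and T_lim: "filterlim (\<lambda>n. T (int n)) at_top sequentially" "filterlim (\<lambda>n. T (- int n)) at_bot sequentially"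
    and L: "0 \<le> L" "0 \<le> M"
    and languid1: "\<And>n \<sigma>. f (T n) \<le> \<sigma> \<Longrightarrow> norm (\<zeta> (Complex \<sigma> (T n))) \<le> L * (\<bar>T n\<bar> + 1) powr M"
    and languid2: "\<And>t. 1 \<le> \<bar>t\<bar> \<Longrightarrow> norm (\<zeta> (screen_path f t)) \<le> L * \<bar>t\<bar> powr M"
    and avoids: "screen f \<inter> complex_dimensions d \<zeta> (window f) = {}"
    and f0: "f 0 < real d"
begin

text \<open>The line and its margin \<open>c'\<close> are midpoints, so both lie right of the point
  of convergence and left of the pole at \<open>d\<close>.\<close>

definition "c = (\<tau> + real d) / 2"
definition "c' = (c + real d) / 2"

text \<open>Where the screen runs right of the line, the region between them is outside the window
  and may leave \<open>U\<close>. It lies right of \<open>\<tau>\<close>, so the series is available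
  there.\<close>

definition "Z s = (if s \<in> U then \<zeta> s else scaling_series l s)"

definition "N = (U \<union> {s. \<tau> < Re s}) - {of_nat d}"

text \<open>Poles are taken inside \<open>U\<close> only, since the values of \<open>\<zeta>\<close>
  elsewhere are arbitrary. The pole of the monophase factor at \<open>d\<close> is absent because
  \<open>N\<close> excludes that point.\<close>

definition "A = {\<omega> \<in> U. is_pole \<zeta> \<omega>} \<union> of_nat ` {..<d}"

lemma c: "\<tau> < c" "c < c'" "c' < real d" "real d - 1 < c" "\<bar>c\<bar> \<le> real d"
  using \<tau> d by (auto simp: c_def c'_def)

lemma Z_series: "\<tau> \<le> Re s \<Longrightarrow> Z s = scaling_series l s"
  using zeta by (simp add: Z_def)

lemma series_analytic: "\<tau> < Re s \<Longrightarrow> scaling_series l analytic_on {s}"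
  using scaling_series_holomorphic[OF l sm] open_halfspace_Re_gt[of \<tau>]
  by (auto intro: analytic_on_subset simp: analytic_on_open[symmetric])

lemma series_bounded:
  obtains K where "K \<ge> 0" "\<And>s. \<tau> \<le> Re s \<Longrightarrow> Re s \<le> b \<Longrightarrow> norm (scaling_series l s) \<le> K"
proof
  define K where "K = (\<Sum>n. B powr (b - \<tau>) * l n powr \<tau>)"
  have smK: "summable (\<lambda>n. B powr (b - \<tau>) * l n powr \<tau>)" using sm by (rule summable_mult)
  show "K \<ge> 0" unfolding K_def by (intro suminf_nonneg smK) auto
  fix s assume s: "\<tau> \<le> Re s" "Re s \<le> b"
  show "norm (scaling_series l s) \<le> K"
    unfolding scaling_series_def K_def
  proof (rule norm_suminf_le[OF _ smK])
    show "norm (complex_of_real (l n) powr s) \<le> B powr (b - \<tau>) * l n powr \<tau>" for n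
      unfolding norm_of_real_powr[OF l(1)] using s by (intro powr_le_powr_bound l) auto
  qed
qed

text \<open>Right of \<open>\<tau>\<close> the extension coincides with the series, which is
  analytic there.\<close>

lemma pole_left:
  assumes "\<omega> \<in> U" "is_pole \<zeta> \<omega>"
  shows "Re \<omega> \<le> \<tau>"
proof (rule ccontr)
  assume "\<not> Re \<omega> \<le> \<tau>"
  then have "scaling_series l analytic_on {\<omega>}" by (intro series_analytic) simp
  moreover have "eventually (\<lambda>z. z \<in> U \<inter> {s. \<tau> < Re s}) (at \<omega>)"
    using \<open>\<not> Re \<omega> \<le> \<tau>\<close> assms U(1) open_halfspace_Re_gt[of \<tau>] by (intro eventually_at_in_open') auto
  then have "eventually (\<lambda>z. \<zeta> z = scaling_series l z) (at \<omega>)"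
    by eventually_elim (auto simp: zeta)
  ultimately show False
    using assms(2) is_pole_cong[of \<zeta> "scaling_series l" \<omega> \<omega>] analytic_at_imp_no_pole by blast
qed

lemma A_le: "\<omega> \<in> A \<Longrightarrow> Re \<omega> \<le> \<tau>"
  using pole_left \<tau> by (auto simp: A_def)

lemma screen_path_window: "screen_path f t \<in> window f"
  by (simp add: screen_path_def window_def)

lemma A_window: "\<omega> \<in> window f \<Longrightarrow> \<omega> \<in> A \<longleftrightarrow> \<omega> \<in> complex_dimensions d \<zeta> (window f)"
  using window by (auto simp: A_def complex_dimensions_def)

lemma screen_not_A: "screen_path f t \<notin> A"
  using avoids A_window[OF screen_path_window[of t]] by (auto simp: screen_def)

lemma Z_eventually: "z \<in> U \<Longrightarrow> eventually (\<lambda>w. Z w = \<zeta> w) (nhds z)"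
  using eventually_nhds_in_open[OF U(1), of z] by (rule eventually_mono) (auto simp: Z_def)

lemma Z_analytic:
  assumes "z \<in> N - A"
  shows "Z analytic_on {z}"
proof (cases "z \<in> U")
  case True
  then have "\<not> is_pole \<zeta> z" using assms by (auto simp: A_def)
  then have "\<zeta> analytic_on {z}" using nicely_meromorphic_on_imp_analytic_at[OF U(2) True] by blast
  then show ?thesis using analytic_at_cong[OF Z_eventually[OF True] refl] by blast
next
  case False
  then have z: "\<tau> < Re z" using assms by (auto simp: N_def)
  have "eventually (\<lambda>w. Z w = scaling_series l w) (nhds z)"
    using eventually_nhds_in_open[OF open_halfspace_Re_gt[of \<tau>], of z] z
    by (auto elim!: eventually_mono simp: Z_series)
  then show ?thesis using analytic_at_cong[OF _ refl] series_analytic[OF z] by blast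
qed

text \<open>In \<open>U\<close>, meromorphy isolates the poles. A point of \<open>N\<close> outside
  \<open>U\<close> lies right of \<open>\<tau>\<close>, and its distance to that abscissa is a
  pole-free radius.\<close>

lemma locally_finite_A:
  assumes "z \<in> N"
  shows "\<exists>e>0. ball z e \<subseteq> N \<and> ball z e \<inter> A \<subseteq> {z}"
proof -
  have "open N" unfolding N_def using U(1) open_halfspace_Re_gt[of \<tau>] by (intro open_Diff open_Un) auto
  then obtain e1 where e1: "e1 > 0" "ball z e1 \<subseteq> N" using assms by (meson openE)
  obtain e2 where e2: "e2 > 0" "\<And>w. w \<in> of_nat ` {..<d} \<Longrightarrow> w \<noteq> z \<Longrightarrow> e2 \<le> dist z w"
    using finite_set_avoid[of "of_nat ` {..<d}" z] by (metis finite_imageI finite_lessThan)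
  obtain e3 where e3: "e3 > 0" "\<And>w. w \<in> ball z e3 \<Longrightarrow> w \<in> U \<Longrightarrow> is_pole \<zeta> w \<Longrightarrow> w = z"
  proof (cases "z \<in> U")
    case True
    then have "isolated_singularity_at \<zeta> z"
      using U(2) meromorphic_on_isolated_singularity meromorphic_on_subset
      unfolding nicely_meromorphic_on_def by blast
    then obtain r where r: "r > 0" "\<zeta> analytic_on ball z r - {z}" by (auto simp: isolated_singularity_at_def)
    show thesis
    proof (rule that[OF r(1)])
      fix w assume "w \<in> ball z r" "is_pole \<zeta> w"
      then show "w = z" using r(2) analytic_at_imp_no_pole by (metis Diff_iff analytic_on_analytic_at singletonD)
    qed
  next
    case False
    then have "\<tau> < Re z" using assms by (auto simp: N_def)
    show thesis
    proof (rule that[of "Re z - \<tau>"])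
      fix w assume w: "w \<in> ball z (Re z - \<tau>)" "w \<in> U" "is_pole \<zeta> w"
      then have "Re z - Re w < Re z - \<tau>"
        using abs_Re_le_cmod[of "z - w"] by (simp add: dist_norm)
      then show "w = z" using pole_left[OF w(2,3)] by simp
    qed (use \<open>\<tau> < Re z\<close> in simp)
  qed
  show ?thesis
  proof (intro exI[of _ "min e1 (min e2 e3)"] conjI)
    show "ball z (min e1 (min e2 e3)) \<inter> A \<subseteq> {z}" using e2 e3 by (force simp: A_def)
  qed (use e1 e2 e3 in auto)
qed

text \<open>A single integrand for both contours: on \<open>U\<close> it is the paired tubular zeta
  function, which gives the residues and the screen integral, and on the line it is the product of
  Mellin transforms in Parseval's identity.\<close>

definition tube_kernel :: "(real \<Rightarrow> complex) \<Rightarrow> complex \<Rightarrow> complex" where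
  "tube_kernel \<psi> s = Z s * (monophase_factor d g \<kappa> s * power_moment \<psi> (of_nat d - s))"

lemma tube_kernel_eq: "s \<in> U \<Longrightarrow> paired_tubular_zeta d g \<kappa> \<zeta> \<psi> s = tube_kernel \<psi> s"
  by (simp add: paired_tubular_zeta_eq tube_kernel_def Z_def)

lemma tube_kernel_residue: 
  assumes "\<omega> \<in> U"
  shows "residue (paired_tubular_zeta d g \<kappa> \<zeta> \<psi>) \<omega> = residue (tube_kernel \<psi>) \<omega>"
proof (rule residue_cong[OF _ refl])
  have "eventually (\<lambda>z. z \<in> U) (at \<omega>)" using U(1) assms by (intro eventually_at_in_open') auto
  then show "eventually (\<lambda>z. paired_tubular_zeta d g \<kappa> \<zeta> \<psi> z = tube_kernel \<psi> z) (at \<omega>)"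
    by eventually_elim (rule tube_kernel_eq)
qed

lemma tube_kernel_screen_integrand:
  "screen_integrand f (paired_tubular_zeta d g \<kappa> \<zeta> \<psi>) = screen_integrand f (tube_kernel \<psi>)"
  using window screen_path_window by (auto simp: screen_integrand_def fun_eq_iff intro!: tube_kernel_eq)

lemma contour_shift_tube_kernel:
  assumes "supported D p q"
  shows "contour_shift f C (tube_kernel (D 0)) N A c c'"
proof
  interpret supported D p q by fact
  show "open N" unfolding N_def using U(1) open_halfspace_Re_gt[of \<tau>] by (intro open_Diff open_Un) auto
  show "tube_kernel (D 0) holomorphic_on N - A"
  proof -
    have "monophase_factor d g \<kappa> holomorphic_on N - A"
      by (rule monophase_factor_holomorphic[OF g]) (auto simp: N_def A_def le_less)
    moreover have "Z holomorphic_on N - A"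
      using Z_analytic analytic_imp_holomorphic by (metis analytic_on_analytic_at)
    moreover have "(power_moment (D 0) \<circ> (\<lambda>s. of_nat d - s)) holomorphic_on N - A"
      by (intro holomorphic_on_compose moment_holomorphic holomorphic_intros)
    then have "(\<lambda>s. power_moment (D 0) (of_nat d - s)) holomorphic_on N - A"
      unfolding o_def .
    ultimately show ?thesis unfolding tube_kernel_def[abs_def] by (intro holomorphic_on_mult)
  qed
  show "z \<in> N" if z: "f (Im z) \<le> Re z" "Re z \<le> c'" for z
  proof -
    have "z \<in> U" using z window by (auto simp: window_def)
    moreover have "z \<noteq> of_nat d" using z c by auto
    ultimately show ?thesis by (simp add: N_def)
  qed
  show "z \<in> N" if z: "c \<le> Re z" "Re z \<le> f (Im z)" for z
  proof -
    \<comment> \<open>If \<open>z\<close> were the point \<open>d\<close>, it would satisfy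
      \<open>d \<le> f 0\<close>, but the screen passes left of it.\<close>
    have "z \<noteq> of_nat d" using z f0 by auto
    then show ?thesis using z c by (simp add: N_def)
  qed
  show "Re z < c" if "z \<in> A" for z using A_le[OF that] c by linarith
qed (use f_lip locally_finite_A c screen_not_A in auto)

text \<open>Languidity bounds \<open>\<zeta>\<close> on the whole ray right of the screen at height
  \<open>T n\<close>, so no pole can lie on that ray; the integer points of \<open>A\<close> have
  height 0.\<close>

lemma admissible_T:
  assumes "T n \<noteq> 0" "\<omega> \<in> A" "Im \<omega> = T n"
  shows "Re \<omega> < f (T n)"
proof (rule ccontr)
  assume *: "\<not> Re \<omega> < f (T n)"
  have "is_pole \<zeta> \<omega>" using assms by (auto simp: A_def)
  from pole_unbounded_right[OF this, of "L * (\<bar>T n\<bar> + 1) powr M"]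
  obtain k where "L * (\<bar>T n\<bar> + 1) powr M < norm (\<zeta> (\<omega> + complex_of_real (1 / real (Suc k))))"
    by (auto simp: eventually_sequentially)
  moreover have "\<omega> + complex_of_real (1 / real (Suc k)) = Complex (Re \<omega> + 1 / real (Suc k)) (T n)"
    using assms by (simp add: complex_eq_iff del: of_nat_Suc)
  moreover have "0 \<le> 1 / real (Suc k)" by simp
  then have "f (T n) \<le> Re \<omega> + 1 / real (Suc k)" using * by linarith
  ultimately show False using languid1[of n "Re \<omega> + 1 / real (Suc k)"] by simp
qed

lemma tube_kernel_screen_bound:
  assumes "supported D p q"
  obtains K where "K \<ge> 0" "\<And>t. norm (tube_kernel (D 0) (screen_path f t)) \<le> K / (1 + t\<^sup>2)"
proof -
  interpret supported D p q by fact
  interpret S: contour_shift f C "tube_kernel (D 0)" N A c c' by (rule contour_shift_tube_kernel) fact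
  obtain K1 where K1: "K1 \<ge> 0" "\<And>s. 1 \<le> \<bar>Im s\<bar> \<Longrightarrow> \<bar>Re s\<bar> \<le> R \<Longrightarrow>
    (\<bar>Im s\<bar> + 1) powr M * norm (monophase_factor d g \<kappa> s * power_moment (D 0) (of_nat d - s)) \<le> K1 / (1 + (Im s)\<^sup>2)"
    using paired_decay[OF g] by metis
  have sub: "screen_path f ` {-1..1} \<subseteq> N - A"
  proof
    fix z assume "z \<in> screen_path f ` {-1..1}"
    then have "Re z = f (Im z)" "z \<notin> A" using screen_not_A by (auto simp: screen_path_def)
    then show "z \<in> N - A" using S.right_of_screen[of z] S.left_of_screen[of z] c by fastforce
  qed
  have "compact (tube_kernel (D 0) ` screen_path f ` {-1..1})"
    by (intro compact_continuous_image S.F_continuous sub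
        lipschitz_on_continuous_on[OF screen_path_lipschitz[OF f_lip]]) auto
  then obtain K2 where K2: "\<And>t. t \<in> {-1..1} \<Longrightarrow> norm (tube_kernel (D 0) (screen_path f t)) \<le> K2"
    by (meson compact_imp_bounded bounded_iff image_eqI)
  have "0 \<le> K2" by (rule order_trans[OF norm_ge_zero K2[of 0]]) simp
  \<comment> \<open>\<open>L * K1\<close> comes from languidity for
    \<open>\<bar>t\<bar> \<ge> 1\<close>; the compact part contributes \<open>2 * K2\<close>, as
    \<open>1 + t\<^sup>2 \<le> 2\<close> there.\<close>
  have "norm (tube_kernel (D 0) (screen_path f t)) \<le> (L * K1 + 2 * K2) / (1 + t\<^sup>2)" for t
  proof (cases "1 \<le> \<bar>t\<bar>")
    case True
    have "norm (Z (screen_path f t)) \<le> L * \<bar>t\<bar> powr M"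
      using languid2[OF True] window screen_path_window[of t] by (auto simp: Z_def)
    also have "\<dots> \<le> L * (\<bar>t\<bar> + 1) powr M" using L by (intro mult_left_mono powr_mono2) auto
    finally have "norm (tube_kernel (D 0) (screen_path f t)) \<le> L * (\<bar>t\<bar> + 1) powr M *
        norm (monophase_factor d g \<kappa> (screen_path f t) * power_moment (D 0) (of_nat d - screen_path f t))"
      unfolding tube_kernel_def norm_mult[of "Z _"] by (intro mult_right_mono) auto
    also have "\<dots> = L * ((\<bar>t\<bar> + 1) powr M *
        norm (monophase_factor d g \<kappa> (screen_path f t) * power_moment (D 0) (of_nat d - screen_path f t)))"
      by (simp only: mult.assoc)
    also have "\<dots> \<le> L * (K1 / (1 + t\<^sup>2))"
      using K1(2)[of "screen_path f t"] True f_bound[of t] L by (intro mult_left_mono) (auto simp: screen_path_def)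
    also have "\<dots> \<le> (L * K1 + 2 * K2) / (1 + t\<^sup>2)"
      using \<open>0 \<le> K2\<close> by (simp add: divide_right_mono)
    finally show ?thesis .
  next
    case False
    then have "norm (tube_kernel (D 0) (screen_path f t)) \<le> K2" by (intro K2) auto
    also have "K2 * (1 + t\<^sup>2) \<le> K2 * 2" using False \<open>0 \<le> K2\<close>
      by (intro mult_left_mono) (auto simp: abs_square_le_1)
    then have "K2 \<le> 2 * K2 / (1 + t\<^sup>2)" by (subst pos_le_divide_eq) (auto intro: add_pos_nonneg)
    also have "\<dots> \<le> (L * K1 + 2 * K2) / (1 + t\<^sup>2)"
      using K1 L by (simp add: divide_right_mono)
    finally show ?thesis .
  qed
  then show thesis using that[of "L * K1 + 2 * K2"] K1 L \<open>0 \<le> K2\<close> by auto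
qed

text \<open>On these segments \<open>Z\<close> is controlled by languidity right of the screen and
  by the convergent series left of it. Either bound is at most a constant times
  \<open>(\<bar>T n\<bar> + 1) powr M\<close>, which the decay of the moment beats.\<close>

lemma tube_kernel_horizontal_limit:
  assumes "supported D p q" and k: "filterlim (\<lambda>n. \<bar>T (k n)\<bar>) at_top sequentially"
  shows "(\<lambda>n. contour_integral (linepath (Complex (f (T (k n))) (T (k n))) (Complex c (T (k n)))) (tube_kernel (D 0))) \<longlonglongrightarrow> 0"
proof -
  let ?I = "\<lambda>n. contour_integral (linepath (Complex (f (T n)) (T n)) (Complex c (T n))) (tube_kernel (D 0))"
  let ?m = "\<lambda>s. monophase_factor d g \<kappa> s * power_moment (D 0) (of_nat d - s)"
  interpret supported D p q by fact
  interpret S: contour_shift f C "tube_kernel (D 0)" N A c c' by (rule contour_shift_tube_kernel) fact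
  have R: "0 \<le> R" using f_bound[of 0] by linarith
  \<comment> \<open>\<open>R + real d\<close> bounds the real parts on every segment, whose ends
    have modulus of real part at most \<open>R\<close> and
    \<open>\<bar>c\<bar> \<le> d\<close>.\<close>
  obtain K1 where K1: "K1 \<ge> 0" "\<And>s. 1 \<le> \<bar>Im s\<bar> \<Longrightarrow> \<bar>Re s\<bar> \<le> R + real d \<Longrightarrow>
    (\<bar>Im s\<bar> + 1) powr M * norm (?m s) \<le> K1 / (1 + (Im s)\<^sup>2)"
    using paired_decay[OF g] by metis
  obtain K2 where K2: "K2 \<ge> 0" "\<And>s. \<tau> \<le> Re s \<Longrightarrow> Re s \<le> R + real d \<Longrightarrow> norm (scaling_series l s) \<le> K2"
    using series_bounded by metis
  define K where "K = (L + K2) * K1"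
  have est: "norm (tube_kernel (D 0) s) \<le> K / (1 + (T n)\<^sup>2) \<and> s \<in> N - A"
    if n: "1 \<le> \<bar>T n\<bar>" and s: "s \<in> closed_segment (Complex (f (T n)) (T n)) (Complex c (T n))" for s n
  proof
    have s': "Im s = T n" "min (f (T n)) c \<le> Re s" "Re s \<le> max (f (T n)) c"
      using s by (auto simp: closed_segment_horizontal)
    have Re: "\<bar>Re s\<bar> \<le> R + real d" using s' f_bound[of "T n"] c(5) R by (auto simp: abs_le_iff min_le_iff_disj le_max_iff_disj)
    have one: "1 \<le> (\<bar>T n\<bar> + 1) powr M" using L by (intro ge_one_powr_ge_zero) auto
    have "norm (Z s) \<le> (L + K2) * (\<bar>T n\<bar> + 1) powr M"
    proof (cases "f (T n) \<le> Re s")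
      case True
      then have "s \<in> U" using s' window by (auto simp: window_def)
      then have "norm (Z s) \<le> L * (\<bar>T n\<bar> + 1) powr M"
        using languid1[OF True] s'(1) by (metis Z_def complex_surj)
      then show ?thesis using K2(1) by (simp add: distrib_right add_increasing2)
    next
      case False
      then have "norm (Z s) \<le> K2"
        using s' c Re Z_series[of s] by (auto intro!: K2(2) simp: min_le_iff_disj)
      also have "\<dots> \<le> K2 * (\<bar>T n\<bar> + 1) powr M" using K2(1) one by (simp add: mult_le_cancel_left1)
      finally show ?thesis using L by (simp add: distrib_right add_increasing)
    qed
    then have "norm (tube_kernel (D 0) s) \<le> (L + K2) * (\<bar>T n\<bar> + 1) powr M *
        norm (?m s)"
      unfolding tube_kernel_def norm_mult[of "Z _"] by (intro mult_right_mono) auto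
    also have "\<dots> = (L + K2) * ((\<bar>T n\<bar> + 1) powr M *
        norm (?m s))"
      by (simp only: mult.assoc)
    also have "\<dots> \<le> (L + K2) * (K1 / (1 + (T n)\<^sup>2))"
      using K1(2)[of s] n s' Re L K2 by (intro mult_left_mono) auto
    finally show "norm (tube_kernel (D 0) s) \<le> K / (1 + (T n)\<^sup>2)" by (simp add: K_def)
    show "s \<in> N - A"
    proof (cases "f (T n) \<le> Re s \<and> Re s \<le> c")
      case True
      have "T n \<noteq> 0" using n by auto
      then show ?thesis using True admissible_T[of n s] s' c S.right_of_screen[of s] by auto
    next
      case False
      then have "c \<le> Re s" "Re s \<le> f (T n)" using s' by (auto simp: min_def max_def split: if_splits)
      then show ?thesis using S.left_of_screen[of s] S.A_left[of s] s' by auto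
    qed
  qed
  have "norm (?I n)
      \<le> K * (R + real d) / (1 + (T n)\<^sup>2)" if n: "1 \<le> \<bar>T n\<bar>" for n
  proof -
    have "norm (?I n)
        \<le> K / (1 + (T n)\<^sup>2) * norm (Complex c (T n) - Complex (f (T n)) (T n))"
    proof (rule contour_integral_bound_linepath)
      show "tube_kernel (D 0) contour_integrable_on linepath (Complex (f (T n)) (T n)) (Complex c (T n))"
        by (intro contour_integrable_continuous_linepath S.F_continuous) (use est[OF n] in blast)
      show "0 \<le> K / (1 + (T n)\<^sup>2)" using K1 K2 L by (simp add: K_def)
    qed (use est[OF n] in blast)
    also have "norm (Complex c (T n) - Complex (f (T n)) (T n)) = \<bar>c - f (T n)\<bar>"
      by (simp add: cmod_def)
    also have "K / (1 + (T n)\<^sup>2) * \<bar>c - f (T n)\<bar> \<le> K / (1 + (T n)\<^sup>2) * (R + real d)"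
      using c(5) f_bound[of "T n"] K1 K2 L by (intro mult_left_mono) (auto simp: K_def)
    finally show ?thesis by simp
  qed
  note bound = this
  show ?thesis
  proof (rule Lim_null_comparison)
    show "eventually (\<lambda>n. norm (?I (k n))
      \<le> K * (R + real d) / (1 + \<bar>T (k n)\<bar>\<^sup>2)) sequentially"
      using k unfolding filterlim_at_top by (auto dest!: spec[of _ 1] elim!: eventually_mono intro: bound)
    have "((\<lambda>t::real. K * (R + real d) / (1 + t\<^sup>2)) \<longlongrightarrow> 0) at_top"
    proof (rule tendsto_divide_0[OF tendsto_const])
      have "filterlim (\<lambda>t::real. 1 + t\<^sup>2) at_top at_top"
        by (intro filterlim_tendsto_add_at_top[OF tendsto_const] filterlim_pow_at_top filterlim_ident) simp
      then show "filterlim (\<lambda>t::real. 1 + t\<^sup>2) at_infinity at_top" by (rule filterlim_at_top_imp_at_infinity)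
    qed
    from filterlim_compose[OF this k] show "(\<lambda>n. K * (R + real d) / (1 + \<bar>T (k n)\<bar>\<^sup>2)) \<longlonglongrightarrow> 0" .
  qed
qed

end

section \<open>Passage to the limit along the heights\<close>

context screened_zeta begin

text \<open>A bounded range of heights and the bounds on the real part, by the screen on the left
  and by \<open>c'\<close> on the right, confine the complex dimensions to a compact subset of
  \<open>N\<close>.\<close>

lemma finite_truncation:
  "finite {\<omega> \<in> complex_dimensions d \<zeta> (window f). a < Im \<omega> \<and> Im \<omega> < b}"
proof -
  \<comment> \<open>The zero test function suffices: only facts about \<open>N\<close> and
    \<open>A\<close> are wanted.\<close>
  interpret S: contour_shift f C "tube_kernel (\<lambda>_. 0)" N A c c'
    by (rule contour_shift_tube_kernel[of "\<lambda>_ _. 0" 1 2]) (unfold_locales, auto)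
  define K where "K = {z. f (Im z) \<le> Re z \<and> Re z \<le> c' \<and> a \<le> Im z \<and> Im z \<le> b}"
  have fc: "continuous_on UNIV f" by (rule lipschitz_on_continuous_on[OF f_lip])
  have "closed K" unfolding K_def
    by (intro closed_Collect_conj closed_Collect_le continuous_intros continuous_on_compose2[OF fc]) auto
  moreover have "K \<subseteq> cbox (Complex (- R) a) (Complex c' b)"
    using f_bound by (auto simp: K_def cbox_Complex abs_le_iff) (smt (verit))
  ultimately have "compact K" using compact_cbox by (meson bounded_cbox bounded_subset compact_eq_bounded_closed)
  moreover have "K \<subseteq> N" using S.right_of_screen by (auto simp: K_def)
  ultimately have "finite (A \<inter> K)" by (rule S.finite_compact)
  moreover have "{\<omega> \<in> complex_dimensions d \<zeta> (window f). a < Im \<omega> \<and> Im \<omega> < b} \<subseteq> A \<inter> K"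
  proof
    fix \<omega> assume w: "\<omega> \<in> {\<omega> \<in> complex_dimensions d \<zeta> (window f). a < Im \<omega> \<and> Im \<omega> < b}"
    then have win: "\<omega> \<in> window f" by (simp add: complex_dimensions_def)
    then have "\<omega> \<in> A" using w A_window by blast
    then show "\<omega> \<in> A \<inter> K" using win w A_le[of \<omega>] c by (auto simp: K_def window_def)
  qed
  ultimately show ?thesis by (rule rev_finite_subset)
qed

lemma screen_integrand_bound:
  assumes "supported D p q"
  obtains K where "K \<ge> 0" "\<And>t. norm (screen_integrand f (tube_kernel (D 0)) t) \<le> K / (1 + t\<^sup>2)"
proof -
  obtain K where K: "K \<ge> 0" "\<And>t. norm (tube_kernel (D 0) (screen_path f t)) \<le> K / (1 + t\<^sup>2)"
    using tube_kernel_screen_bound[OF assms] by metis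
  obtain V where V: "\<And>t. norm (vector_derivative (screen_path f) (at t)) \<le> V"
    using screen_path_vector_derivative_bounded[OF f_lip] by metis
  have "V \<ge> 0" by (rule order_trans[OF norm_ge_zero V[of 0]])
  have "norm (screen_integrand f (tube_kernel (D 0)) t) \<le> K / (1 + t\<^sup>2) * V" for t
    unfolding screen_integrand_def norm_mult using K V by (intro mult_mono) auto
  then show thesis using K \<open>V \<ge> 0\<close> by (intro that[of "K * V"]) (auto simp: mult.commute)
qed

text \<open>The slab identity between two heights is divided by 2 pi i. In the limit the horizontal
  integrals vanish and the vertical and screen integrals converge to those over their full
  contours.\<close>

lemma truncated_residues:
  assumes sup: "supported D p q" and vert: "integrable lborel (\<lambda>t. tube_kernel (D 0) (Complex c t))"
  shows "screen_integrable f (paired_tubular_zeta d g \<kappa> \<zeta> (D 0))"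
    and "has_truncated_sum (residue (paired_tubular_zeta d g \<kappa> \<zeta> (D 0))) (complex_dimensions d \<zeta> (window f)) T
      (1 / (2 * pi) * (\<integral>t. tube_kernel (D 0) (Complex c t) \<partial>lborel) - error_term d g \<kappa> \<zeta> f (D 0))"
proof -
  define F where "F = tube_kernel (D 0)"
  interpret S: contour_shift f C F N A c c' unfolding F_def by (rule contour_shift_tube_kernel) fact
  \<comment> \<open>Languidity fixes the signs of the heights only from index 1 on, and at index 0
    both truncation heights are \<open>T 0\<close>. The shift by \<open>Suc\<close> leaves the limit
    unchanged and is undone at the end.\<close>
  define a where "a = (\<lambda>n. T (- int (Suc n)))"
  define b where "b = (\<lambda>n. T (int (Suc n)))"
  let ?E = "\<lambda>n. {\<omega> \<in> complex_dimensions d \<zeta> (window f). a n < Im \<omega> \<and> Im \<omega> < b n}"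
  have ab: "a n < 0" "0 < b n" for n using T_sign[of "int (Suc n)"] by (auto simp: a_def b_def)
  have a_lim: "filterlim a at_bot sequentially" and b_lim: "filterlim b at_top sequentially"
    unfolding a_def b_def using T_lim by (auto simp: filterlim_sequentially_Suc[of "\<lambda>n. T (- int n)"] 
        filterlim_sequentially_Suc[of "\<lambda>n. T (int n)"] simp del: of_nat_Suc)
  have adm: "S.admissible (a n)" "S.admissible (b n)" for n
    unfolding S.admissible_def a_def b_def
    using admissible_T[of "- int (Suc n)"] admissible_T[of "int (Suc n)"] ab[of n] by (auto simp: a_def b_def)
  have slab: "S.slab (a n) (b n)" for n
    using ab[of n] by (intro S.slab_admissible adm) auto
  obtain K where K: "K \<ge> 0" "\<And>t. norm (screen_integrand f F t) \<le> K / (1 + t\<^sup>2)"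
    using screen_integrand_bound[OF sup] unfolding F_def by metis
  have si: "screen_integrand f F integrable_on {a n..b n}" for n
    using slab[of n] by (simp add: S.slab_def)
  note scr = integral_exhaustion[OF si K(2) inverse_square_integrable a_lim b_lim]
  then show "screen_integrable f (paired_tubular_zeta d g \<kappa> \<zeta> (D 0))"
    by (simp add: screen_integrable_def tube_kernel_screen_integrand F_def)
  have v: "set_integrable lborel UNIV (\<lambda>t. F (Complex c t))"
    using vert by (simp add: set_integrable_def F_def)
  have vn: "set_integrable lborel UNIV (\<lambda>t. norm (F (Complex c t)))" using v by (rule set_integrable_norm)
  have vi: "(\<lambda>t. F (Complex c t)) integrable_on {a n..b n}" for n
    using set_borel_integral_eq_integral(1)[OF v] by (rule integrable_on_subinterval) auto
  have vlim: "(\<lambda>n. integral {a n..b n} (\<lambda>t. F (Complex c t))) \<longlonglongrightarrow> integral UNIV (\<lambda>t. F (Complex c t))"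
    by (rule integral_exhaustion(2)[OF vi order_refl set_borel_integral_eq_integral(1)[OF vn] a_lim b_lim])
  have vval: "integral UNIV (\<lambda>t. F (Complex c t)) = (\<integral>t. F (Complex c t) \<partial>lborel)"
    using set_borel_integral_eq_integral(2)[OF v] by (simp add: set_lebesgue_integral_def)
  have hb: "(\<lambda>n. S.horizontal (a n) (f (a n)) c) \<longlonglongrightarrow> 0"
    unfolding a_def F_def
  proof (rule tube_kernel_horizontal_limit[OF sup])
    show "filterlim (\<lambda>n. \<bar>T (- int (Suc n))\<bar>) at_top sequentially"
    proof (rule filterlim_at_top_mono)
      show "filterlim (\<lambda>n. - T (- int (Suc n))) at_top sequentially"
        using a_lim unfolding a_def filterlim_uminus_at_bot .
    qed (intro always_eventually allI abs_ge_minus_self)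
  qed
  have ht: "(\<lambda>n. S.horizontal (b n) (f (b n)) c) \<longlonglongrightarrow> 0"
    unfolding b_def F_def
  proof (rule tube_kernel_horizontal_limit[OF sup])
    show "filterlim (\<lambda>n. \<bar>T (int (Suc n))\<bar>) at_top sequentially"
      using b_lim unfolding b_def
      by (rule filterlim_at_top_mono) (intro always_eventually allI abs_ge_self)
  qed
  have enc: "S.enclosed (a n) (b n) = ?E n" for n
    using A_window by (auto simp: S.enclosed_def window_def complex_dimensions_def)
  define r where "r = residue (paired_tubular_zeta d g \<kappa> \<zeta> (D 0))"
  have res: "(\<Sum>\<omega>\<in>S.enclosed (a n) (b n). residue F \<omega>)
      = (\<Sum>\<omega>\<in>?E n. r \<omega>)" for n
    unfolding enc r_def F_def using window
    by (intro sum.cong tube_kernel_residue[symmetric]) (auto simp: complex_dimensions_def)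
  have vertical: "S.vertical c (a n) (b n) = \<i> * integral {a n..b n} (\<lambda>t. F (Complex c t))" for n
    using ab[of n] by (intro contour_integral_linepath_same_Re) auto
  have sum_eq: "2 * pi * \<i> * (\<Sum>\<omega>\<in>?E n. r \<omega>)
     = S.horizontal (a n) (f (a n)) c + \<i> * integral {a n..b n} (\<lambda>t. F (Complex c t))
       - S.horizontal (b n) (f (b n)) c - integral {a n..b n} (screen_integrand f F)" for n
    using slab[of n] unfolding S.slab_def vertical res by simp
  have "(\<lambda>n. 2 * pi * \<i> * (\<Sum>\<omega>\<in>?E n. r \<omega>))
     \<longlonglongrightarrow> 0 + \<i> * integral UNIV (\<lambda>t. F (Complex c t)) - 0 - integral UNIV (screen_integrand f F)"
    unfolding sum_eq by (intro tendsto_add tendsto_diff tendsto_mult tendsto_const hb ht vlim scr)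
  from tendsto_mult[OF tendsto_const[of "1 / (2 * pi * \<i>)"] this]
  have "(\<lambda>n. \<Sum>\<omega>\<in>?E n. r \<omega>)
     \<longlonglongrightarrow> 1 / (2 * pi * \<i>) * (\<i> * integral UNIV (\<lambda>t. F (Complex c t)) - integral UNIV (screen_integrand f F))"
    by simp
  also have "1 / (2 * pi * \<i>) * (\<i> * integral UNIV (\<lambda>t. F (Complex c t)) - integral UNIV (screen_integrand f F))
     = 1 / (2 * pi) * (\<integral>t. F (Complex c t) \<partial>lborel) - error_term d g \<kappa> \<zeta> f (D 0)"
    unfolding vval error_term_def screen_integral_def tube_kernel_screen_integrand F_def[symmetric]
    by (simp add: field_simps)
  finally have lim: "(\<lambda>n. \<Sum>\<omega>\<in>{\<omega> \<in> complex_dimensions d \<zeta> (window f). T (- int (Suc n)) < Im \<omega> \<and> Im \<omega> < T (int (Suc n))}. r \<omega>)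
     \<longlonglongrightarrow> 1 / (2 * pi) * (\<integral>t. F (Complex c t) \<partial>lborel) - error_term d g \<kappa> \<zeta> f (D 0)"
    by (simp only: a_def b_def)
  show "has_truncated_sum (residue (paired_tubular_zeta d g \<kappa> \<zeta> (D 0))) (complex_dimensions d \<zeta> (window f)) T
      (1 / (2 * pi) * (\<integral>t. tube_kernel (D 0) (Complex c t) \<partial>lborel) - error_term d g \<kappa> \<zeta> f (D 0))"
    unfolding has_truncated_sum_def
    using finite_truncation LIMSEQ_imp_Suc[OF lim] by (simp only: r_def F_def) blast
qed

text \<open>Rescaling by \<open>a\<close> multiplies the integrand by \<open>a powr (d - s)\<close>.
  On the screen its modulus is \<open>a powr (d - f t)\<close>, at most
  \<open>a powr (d - sup S)\<close> when \<open>a < 1\<close>, and the remaining factor has an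
  integrable majorant independent of \<open>a\<close>.\<close>

lemma error_term_bigo:
  assumes sup: "supported D p q"
  shows "(\<lambda>a. error_term d g \<kappa> \<zeta> f (rescale a (D 0))) \<in>
    O[at_right 0](\<lambda>a. complex_of_real (a powr (real d - Sup (range f))))"
proof -
  define F where "F = tube_kernel (D 0)"
  obtain K where K: "K \<ge> 0" "\<And>t. norm (screen_integrand f F t) \<le> K / (1 + t\<^sup>2)"
    using screen_integrand_bound[OF sup] unfolding F_def by metis
  define I where "I = integral UNIV (\<lambda>t::real. K / (1 + t\<^sup>2))"
  have "I \<ge> 0" unfolding I_def using K(1)
    by (intro Henstock_Kurzweil_Integration.integral_nonneg inverse_square_integrable) auto
  have bdd: "bdd_above (range f)" using f_bound by (intro bdd_aboveI[of _ R]) (auto simp: abs_le_iff)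
  have est: "norm (error_term d g \<kappa> \<zeta> f (rescale a (D 0))) \<le> (I / (2 * pi)) * norm (complex_of_real (a powr (real d - Sup (range f))))"
    if a: "0 < a" "a < 1" for a
  proof -
    define E where "E = a powr (real d - Sup (range f))"
    define G where "G = screen_integrand f (paired_tubular_zeta d g \<kappa> \<zeta> (rescale a (D 0)))"
    have G: "norm (G t) \<le> E * (K / (1 + t\<^sup>2))" for t
    proof -
      have "paired_tubular_zeta d g \<kappa> \<zeta> (rescale a (D 0)) s = of_real a powr (of_nat d - s) * paired_tubular_zeta d g \<kappa> \<zeta> (D 0) s" for s
        by (simp add: paired_tubular_zeta_eq power_moment_rescale[OF sup a(1)] mult_ac)
      then have "G t = of_real a powr (of_nat d - screen_path f t) * screen_integrand f (paired_tubular_zeta d g \<kappa> \<zeta> (D 0)) t"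
        by (simp add: G_def screen_integrand_def mult_ac)
      then have "norm (G t) = a powr (real d - f t) * norm (screen_integrand f F t)"
        using a by (simp add: norm_mult norm_of_real_powr tube_kernel_screen_integrand F_def screen_path_def)
      moreover have "a powr (real d - f t) \<le> E"
        unfolding E_def using a cSup_upper[OF _ bdd, of "f t"] by (intro powr_mono') auto
      moreover have "0 \<le> E" by (simp add: E_def)
      ultimately show ?thesis using K(2)[of t] by (simp only:) (intro mult_mono; simp)
    qed
    have "norm (integral UNIV G) \<le> E * I"
    proof (cases "G integrable_on UNIV")
      case True
      have "norm (integral UNIV G) \<le> integral UNIV (\<lambda>t. E * (K / (1 + t\<^sup>2)))"
        using True G by (intro integral_norm_bound_integral integrable_on_mult_right inverse_square_integrable) auto
      then show ?thesis by (simp only: integral_mult_right I_def)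
    next
      \<comment> \<open>A non-integrable \<open>G\<close> has the default integral 0, so the bound
        is trivial.\<close>
      case False
      then show ?thesis using \<open>I \<ge> 0\<close> by (simp add: not_integrable_integral E_def)
    qed
    then show ?thesis
      by (simp add: error_term_def screen_integral_def G_def[symmetric] E_def[symmetric] norm_mult norm_divide field_simps)
         (simp add: E_def mult.commute)
  qed
  have "eventually (\<lambda>a::real. 0 < a \<and> a < 1) (at_right 0)"
    by (auto simp: eventually_at_right_field intro!: exI[of _ 1])
  then show ?thesis by (intro bigoI[of _ "I / (2 * pi)"]) (auto elim!: eventually_mono dest: est)
qed

end

section \<open>Assembly of the tube formula\<close>

lemma spray_tube_volume_measurable:
  assumes "fractal_spray G l \<Omega> \<T>"
  shows "spray_tube_volume \<Omega> \<in> borel_measurable borel"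
proof -
  have "(\<lambda>x. inner_tube_volume (\<Omega> n) x) \<in> borel_measurable borel" for n
    using assms by (intro borel_measurable_mono monoI inner_tube_volume_mono)
      (auto simp: fractal_spray_def intro: bounded_subset)
  then show ?thesis unfolding spray_tube_volume_def[abs_def] by measurable
qed

theorem theorem7p4:
  fixes G \<T> :: "'a::euclidean_space set"
    and \<Omega> :: "nat \<Rightarrow> 'a set"
    and \<l> :: "nat \<Rightarrow> real"
    and \<kappa> :: "nat \<Rightarrow> real"
    and g :: real
    and \<zeta> :: "complex \<Rightarrow> complex"
    and U :: "complex set"
    and f :: "real \<Rightarrow> real"
    and T :: "int \<Rightarrow> real"
  assumes spray: "fractal_spray G \<l> \<Omega> \<T>"
    and monophase: "monophase_with G \<kappa>"
    and inradius: "g = inradius G" "g > 0"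
    and screen_fun: "screen_function f"
    and zeta: "scaling_zeta_on \<l> U \<zeta>" "window f \<subseteq> U"
    and languid: "languid_along \<zeta> f T"
    and avoids: "screen f \<inter> complex_dimensions DIM('a) \<zeta> (window f) = {}"
    and screen_left_of_dim: "f 0 < real DIM('a)"
  shows "(\<forall>\<psi>. test_function \<psi> \<longrightarrow>
            screen_integrable f (paired_tubular_zeta DIM('a) g \<kappa> \<zeta> \<psi>) \<and>
            (\<exists>L. has_truncated_sum (residue (paired_tubular_zeta DIM('a) g \<kappa> \<zeta> \<psi>))
                   (complex_dimensions DIM('a) \<zeta> (window f)) T L \<and>
                 pairing (\<lambda>\<epsilon>. complex_of_real (spray_tube_volume \<Omega> \<epsilon>)) \<psi> =
                   L + error_term DIM('a) g \<kappa> \<zeta> f \<psi>))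
       \<and> (\<forall>\<psi>. test_function \<psi> \<longrightarrow>
            (\<lambda>a. error_term DIM('a) g \<kappa> \<zeta> f (rescale a \<psi>)) \<in>
              O[at_right 0](\<lambda>a. complex_of_real (a powr (real DIM('a) - Sup (range f)))))"
proof -
  define d where "d = DIM('a)"
  have d: "0 < d" by (simp add: d_def)
  have l: "0 < \<l> n" for n using spray by (auto simp: fractal_spray_def)
  have smd: "summable (\<lambda>n. \<l> n powr real d)"
    using fractal_spray_summable[OF spray] l by (simp add: powr_realpow d_def)
  have l0: "\<l> \<longlonglongrightarrow> 0"
  proof -
    have "(\<lambda>n. (\<l> n powr real d) powr (1 / real d)) \<longlonglongrightarrow> 0"
      by (rule tendsto_zero_powrI[OF summable_LIMSEQ_zero[OF smd] tendsto_const]) (use d in auto)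
    then show ?thesis using l d by (simp add: powr_powr abs_of_pos)
  qed
  obtain B where B: "\<And>n. \<l> n \<le> B" "1 \<le> B"
    by (rule convergent_bounded_above[OF l0]) (rule that)
  \<comment> \<open>As \<open>f 0 < d\<close>, the point \<open>d\<close> is in the window, so the
    extension exists around it. This is what allows Landau's theorem to push convergence left of
    \<open>d\<close>.\<close>
  have "complex_of_real (real d) \<in> U"
    using zeta(2) screen_left_of_dim by (auto simp: window_def d_def)
  then obtain \<tau>' where \<tau>': "\<tau>' < real d" "summable (\<lambda>n. \<l> n powr \<tau>')"
    by (rule summable_left_of_regular_point[OF l l0 smd zeta(1)]) (rule that)
  \<comment> \<open>The maximum keeps the exponent inside the strip where the Mellin transform of
    the tube volume converges.\<close>
  define \<tau> where "\<tau> = max \<tau>' (real d - 1)"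
  have sm: "summable (\<lambda>n. \<l> n powr t)" if "\<tau> \<le> t" for t
    using that by (intro summable_powr_mono[OF l B \<tau>'(2)]) (simp add: \<tau>_def)
  obtain C where C: "C-lipschitz_on UNIV f" using screen_fun by (auto simp: screen_function_def)
  obtain R where R: "\<And>t. \<bar>f t\<bar> \<le> R"
    using screen_fun by (auto simp: screen_function_def bounded_iff)
  obtain M L where LM: "0 < M" "0 < L"
    "\<And>n \<sigma>. f (T n) \<le> \<sigma> \<Longrightarrow> norm (\<zeta> (Complex \<sigma> (T n))) \<le> L * (\<bar>T n\<bar> + 1) powr M"
    "\<And>t. 1 \<le> \<bar>t\<bar> \<Longrightarrow> norm (\<zeta> (screen_path f t)) \<le> L * \<bar>t\<bar> powr M"
    using languid unfolding languid_along_def by blast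
  interpret Z: screened_zeta \<l> \<zeta> U f T \<kappa> g d \<tau> C B L M R
  proof
    show "real d - 1 \<le> \<tau>" "\<tau> < real d" using \<tau>' by (auto simp: \<tau>_def)
    show "\<zeta> s = scaling_series \<l> s" if "s \<in> U" "\<tau> \<le> Re s" for s
      using zeta(1) sm that by (auto simp: scaling_zeta_on_def)
    show "filterlim (\<lambda>n. T (int n)) at_top sequentially" "filterlim (\<lambda>n. T (- int n)) at_bot sequentially"
      "\<And>n. 1 \<le> n \<Longrightarrow> T (- n) < 0 \<and> 0 < T n"
      using languid by (auto simp: languid_along_def)
  qed (use l B sm d inradius C R zeta LM avoids screen_left_of_dim in \<open>auto simp: d_def scaling_zeta_on_def\<close>)
  have main: "screen_integrable f (paired_tubular_zeta d g \<kappa> \<zeta> \<psi>) \<and>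
      (\<exists>L. has_truncated_sum (residue (paired_tubular_zeta d g \<kappa> \<zeta> \<psi>)) (complex_dimensions d \<zeta> (window f)) T L \<and>
        pairing (\<lambda>\<epsilon>. complex_of_real (spray_tube_volume \<Omega> \<epsilon>)) \<psi> = L + error_term d g \<kappa> \<zeta> f \<psi>) \<and>
      (\<lambda>a. error_term d g \<kappa> \<zeta> f (rescale a \<psi>)) \<in> O[at_right 0](\<lambda>a. complex_of_real (a powr (real d - Sup (range f))))"
    if \<psi>: "test_function \<psi>" for \<psi>
  proof -
    obtain D p q where D\<psi>: "D 0 = \<psi>" "\<And>n x. (D n has_vector_derivative D (Suc n) x) (at x)"
      "0 < p" "p < q" "\<And>n x. x \<notin> {p<..<q} \<Longrightarrow> D n x = 0"
      by (rule test_functionE[OF \<psi>]) (rule that)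
    have sup: "supported D p q" by (rule supported.intro) (fact D\<psi>)+
    interpret supported D p q by (rule sup)
    \<comment> \<open>Parseval's identity is used with \<open>\<sigma> = d - c\<close>: at s = c +
      it the Mellin exponent s - d - 1 is then -\<sigma> - 1 + it, and the moment is taken at d - s
      = \<sigma> - it.\<close>
    have hb: "has_bochner_integral lborel (\<lambda>t. (scaling_series \<l> (Complex Z.c t) * monophase_factor d g \<kappa> (Complex Z.c t))
        * power_moment (D 0) (Complex (real d - Z.c) (- t)))
      (2 * pi * pairing (\<lambda>x. of_real (spray_tube_volume \<Omega> x)) (D 0))"
    proof (rule mellin_parseval[OF spray_tube_volume_measurable[OF spray]])
      fix t
      have e: "Complex Z.c t - of_nat DIM('a) - 1 = Complex (- (real d - Z.c) - 1) t"
        by (simp add: complex_eq_iff d_def)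
      show "has_bochner_integral lborel (\<lambda>x. indicator {0<..} x *\<^sub>R (complex_of_real (spray_tube_volume \<Omega> x)
          * of_real x powr Complex (- (real d - Z.c) - 1) t))
        (scaling_series \<l> (Complex Z.c t) * monophase_factor d g \<kappa> (Complex Z.c t))"
        unfolding monophase_factor_def e[symmetric] unfolding d_def
        by (rule spray_mellin[OF spray monophase inradius]) (use Z.c sm in \<open>auto simp: d_def\<close>)
    qed
    have eq: "(scaling_series \<l> (Complex Z.c t) * monophase_factor d g \<kappa> (Complex Z.c t))
        * power_moment (D 0) (Complex (real d - Z.c) (- t)) = Z.tube_kernel (D 0) (Complex Z.c t)" for t
    proof -
      have "of_nat d - Complex Z.c t = Complex (real d - Z.c) (- t)" by (simp add: complex_eq_iff)
      then show ?thesis using Z.Z_series[of "Complex Z.c t"] Z.c by (simp add: Z.tube_kernel_def)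
    qed
    have vert: "integrable lborel (\<lambda>t. Z.tube_kernel (D 0) (Complex Z.c t))"
      and val: "(\<integral>t. Z.tube_kernel (D 0) (Complex Z.c t) \<partial>lborel) = 2 * pi * pairing (\<lambda>x. of_real (spray_tube_volume \<Omega> x)) (D 0)"
      using hb unfolding eq by (simp_all add: has_bochner_integral_iff)
    show ?thesis
      using Z.truncated_residues[OF sup vert] Z.error_term_bigo[OF sup] unfolding val unfolding D\<psi>(1) by auto
  qed
  then show ?thesis unfolding d_def by blast
qed

end
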